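(* Let $p$ and $q$ be different primes with $p < q$. (a) There is one special case: $\mathcal{N}(2^2 \cdot 3^2) = 14$. (b) If $p = 2$ and $q \neq 3$, then $\mathcal{N}(p^2 q^2) = 12 + 4\, w_{q-1}(4)$. (c) If $p > 2$, then \[ \mathcal{N}(p^2 q^2) = 4 + \frac{p^2+p+4}{2}\, w_{q-1}(p^2) + (p+6)\, w_{q-1}(p) + 2\, w_{q+1}(p) + w_{q+1}(p^2).\]
   Context: $\mathcal{N}(n)$ denotes the number of isomorphism types of groups of order $n$. For positive integers $r, s$ define $w_r(s) = 1$ if $s \mid r$ and $w_r(s) = 0$ otherwise. *)

theory Defs
  imports Complex_Main "HOL-Computational_Algebra.Primes" "HOL-Algebra.Coset"
begin

text \<open>
  Every finite group is isomorphic to one whose elements are natural numbers (see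
  \<open>finite_group_iso_nat\<close> below), so the groups with carrier in \<^typ>\<open>nat\<close> represent all
  isomorphism types of finite groups.
\<close>

definition groups_of_order :: "nat \<Rightarrow> nat monoid set" where
  "groups_of_order n = {G. group G \<and> finite (carrier G) \<and> order G = n}"

definition group_iso_rel :: "nat \<Rightarrow> (nat monoid \<times> nat monoid) set" where
  "group_iso_rel n = {(G, H). G \<in> groups_of_order n \<and> H \<in> groups_of_order n \<and> G \<cong> H}"

definition num_groups :: "nat \<Rightarrow> nat" where
  "num_groups n = card (groups_of_order n // group_iso_rel n)"

definition w :: "nat \<Rightarrow> nat \<Rightarrow> nat" where
  "w r s = (if s dvd r then 1 else 0)"

lemma equiv_group_iso_rel: "equiv (groups_of_order n) (group_iso_rel n)"
proof (rule equivI)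
  show "group_iso_rel n \<subseteq> groups_of_order n \<times> groups_of_order n"
    by (auto simp: group_iso_rel_def)
  show "refl_on (groups_of_order n) (group_iso_rel n)"
    by (auto simp: refl_on_def group_iso_rel_def iso_refl)
  show "sym (group_iso_rel n)"
    by (auto simp: sym_def group_iso_rel_def groups_of_order_def intro: group.iso_sym)
  show "trans (group_iso_rel n)"
    by (auto simp: trans_def group_iso_rel_def intro: iso_trans)
qed

lemma finite_group_iso_nat:
  fixes G :: "('a, 'b) monoid_scheme"
  assumes G: "group G" and fin: "finite (carrier G)"
  shows "\<exists>H \<in> groups_of_order (order G). G \<cong> H"
proof -
  interpret G: group G by (rule G)
  obtain f :: "'a \<Rightarrow> nat" where f: "inj_on f (carrier G)"
    using finite_imp_inj_to_nat_seg[OF fin] by blast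
  define g where "g = inv_into (carrier G) f"
  have gf: "g (f x) = x" if "x \<in> carrier G" for x
    using f that by (simp add: g_def)
  define H :: "nat monoid" where
    "H = \<lparr>carrier = f ` carrier G, mult = (\<lambda>a b. f (g a \<otimes>\<^bsub>G\<^esub> g b)), one = f \<one>\<^bsub>G\<^esub>\<rparr>"
  have "group H"
    by (rule groupI) (auto simp: H_def gf G.m_assoc intro!: bexI[of _ "inv\<^bsub>G\<^esub> _"])
  moreover have "finite (carrier H)" "order H = order G"
    using fin f by (auto simp: H_def order_def card_image)
  moreover have "f \<in> iso G H"
    using f by (auto simp: iso_def hom_def bij_betw_def H_def gf)
  ultimately show ?thesis
    by (auto simp: groups_of_order_def is_iso_def)
qed

end

theory Submission
  imports Defs "HOL-Number_Theory.Number_Theory" "HOL-Algebra.Elementary_Groups" "HOL-Algebra.Multiplicative_Group"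
    "HOL-Algebra.Sylow" "HOL-Algebra.Group_Action"
begin

text \<open>
  A group of order \<open>p\<^sup>2 q\<^sup>2\<close> with primes \<open>p < q\<close> has a normal Sylow \<open>q\<close>-subgroup \<open>Q\<close>, except when its order
  is 36 (\<open>sylow_p2q2_normal\<close>).  By Sylow's theorem it is then a semidirect product of \<open>Q\<close>
  by a group \<open>P\<close> of order \<open>p\<^sup>2\<close> (\<open>iso_sdprod\<close>).  Both factors are abelian of prime square
  order, hence cyclic or elementary abelian (\<open>order_p2_cases\<close>).

  Since the orders of \<open>Q\<close> and \<open>P\<close> are coprime and \<open>Q\<close> is abelian, two homomorphisms from \<open>P\<close> to \<open>Aut Q\<close>
  define isomorphic products if and only if they agree up to automorphisms of \<open>P\<close> and conjugation in
  \<open>Aut Q\<close>.  For these \<open>P\<close>, homomorphisms with the same image differ by an automorphism of \<open>P\<close>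
  (\<open>image_determined_cyclic\<close>, \<open>image_determined_elementary\<close>).  Therefore the products correspond to
  the conjugacy classes of those subgroups of \<open>Aut Q\<close> that are images of \<open>P\<close>
  (\<open>card_iso_types_sdprod\<close>): the trivial subgroup, the subgroups of order \<open>p\<close>, and either the cyclic or
  the elementary abelian subgroups of order \<open>p\<^sup>2\<close>.

  It remains to count classes of subgroups.  The automorphism group of the cyclic group of order \<open>q\<^sup>2\<close> is
  cyclic of order \<open>q (q - 1)\<close>.  The automorphism group of the elementary abelian group is \<open>GL\<^sub>2(q)\<close>.
  For a power \<open>m\<close> of \<open>p\<close> dividing \<open>q - 1\<close>, every element of order \<open>m\<close> in \<open>GL\<^sub>2(q)\<close> can be diagonalised, a
  cyclic subgroup of order \<open>m\<close> is generated up to conjugacy by \<open>diag(z, z\<^sup>k)\<close> for a primitive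
  \<open>m\<close>-th root of unity \<open>z\<close>, and only \<open>k\<close> and \<open>k\<^sup>-\<^sup>1\<close> give the same class (\<open>num_conj_split\<close>).
  If \<open>m\<close> divides \<open>q\<^sup>2 - 1\<close> but not \<open>q - 1\<close>, the subgroup lies up to conjugacy in the cyclic
  multiplicative group of the field with \<open>q\<^sup>2\<close> elements, so there is one class (\<open>num_conj_nonsplit\<close>); for
  all other powers \<open>m\<close> of \<open>p\<close> there is none.  An elementary abelian subgroup of order \<open>p\<^sup>2\<close> exists only if
  \<open>p\<close> divides \<open>q - 1\<close>, and then it is conjugate to the group of diagonal matrices of exponent \<open>p\<close>
  (\<open>elementary_split\<close>, \<open>elementary_nonsplit\<close>).  Counting residues modulo \<open>p\<close> and \<open>p\<^sup>2\<close> up to inversion gives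
  the formulas.

  A group of order 36 has a normal Sylow 3-subgroup or a normal Sylow 2-subgroup (\<open>order36_normal\<close>).
  The first kind is counted as above.  The groups of the second kind that are not of the first are the
  semidirect products with the non-trivial actions of groups of order 9 on the four-group.
\<close>

section \<open>Counting isomorphism types\<close>

text \<open>An isomorphism type as the set of its representatives on the natural numbers.  Groups over any
  element type have one, so that the matrix and product constructions below can be counted together.\<close>

definition iso_type :: "nat \<Rightarrow> ('a, 'b) monoid_scheme \<Rightarrow> nat monoid set" where
  "iso_type n G = {H \<in> groups_of_order n. G \<cong> H}"

lemma iso_type_eq_iff:
  assumes G: "group G" "finite (carrier G)" "order G = n" and H: "group H"
  shows "iso_type n G = iso_type n H \<longleftrightarrow> G \<cong> H"
proof
  assume eq: "iso_type n G = iso_type n H"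
  obtain K where "K \<in> groups_of_order n" "G \<cong> K"
    using finite_group_iso_nat[OF G(1,2)] G(3) by blast
  moreover from this have "H \<cong> K" using eq by (auto simp: iso_type_def)
  ultimately show "G \<cong> H" by (intro iso_trans[OF _ group.iso_sym[OF H]])
next
  assume "G \<cong> H"
  then show "iso_type n G = iso_type n H"
    using iso_trans[OF group.iso_sym[OF G(1) \<open>G \<cong> H\<close>]] iso_trans[OF \<open>G \<cong> H\<close>]
    by (fastforce simp: iso_type_def)
qed

text \<open>Any complete family of groups, over whatever type and possibly with repetitions, computes
  \<^const>\<open>num_groups\<close>.\<close>

lemma num_groups_eq_card_iso_types:
  assumes "\<And>G. G \<in> Gs \<Longrightarrow> group G \<and> finite (carrier G) \<and> order G = n"
    and "\<And>H :: nat monoid. H \<in> groups_of_order n \<Longrightarrow> \<exists>G\<in>Gs. H \<cong> G"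
  shows "num_groups n = card (iso_type n ` Gs)"
proof -
  have "groups_of_order n // group_iso_rel n = iso_type n ` groups_of_order n"
    by (auto simp: quotient_def group_iso_rel_def iso_type_def)
  also have "\<dots> = iso_type n ` Gs"
  proof (intro equalityI subsetI; elim imageE)
    fix X and H :: "nat monoid" assume X: "X = iso_type n H" and H: "H \<in> groups_of_order n"
    then obtain G where G: "G \<in> Gs" "H \<cong> G" using assms(2) by blast
    then have "X = iso_type n G"
      using iso_type_eq_iff[of H n G] H X assms(1) by (auto simp: groups_of_order_def)
    then show "X \<in> iso_type n ` Gs" using G by blast
  next
    fix X and G assume X: "X = iso_type n G" and G: "G \<in> Gs"
    then obtain H where H: "H \<in> groups_of_order n" "G \<cong> H"
      using finite_group_iso_nat assms(1) by blast
    then have "X = iso_type n H"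
      using iso_type_eq_iff[of G n H] G X assms(1) by (auto simp: groups_of_order_def)
    then show "X \<in> iso_type n ` groups_of_order n" using H by blast
  qed
  finally show ?thesis by (simp add: num_groups_def)
qed

text \<open>Two functions on \<open>S\<close> with the same fibres have images in bijection.  This transports a count of
  isomorphism types to a count of conjugacy classes.\<close>

lemma bij_betw_image_cong_iff:
  assumes "\<And>x y. x \<in> S \<Longrightarrow> y \<in> S \<Longrightarrow> f x = f y \<longleftrightarrow> g x = g y"
  shows "\<exists>h. bij_betw h (f ` S) (g ` S)"
proof -
  define h where "h = (\<lambda>z. g (SOME x. x \<in> S \<and> f x = z))"
  have h: "h (f x) = g x" if "x \<in> S" for x
  proof -
    define y where "y = (SOME y. y \<in> S \<and> f y = f x)"
    have "y \<in> S \<and> f y = f x"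
      unfolding y_def by (rule someI[of _ x]) (use that in auto)
    then have "g y = g x" using assms[of y x] that by simp
    then show ?thesis by (simp add: h_def y_def)
  qed
  have "bij_betw h (f ` S) (g ` S)"
  proof (rule bij_betw_imageI)
    show "inj_on h (f ` S)"
      using assms h by (intro inj_onI) auto
    show "h ` f ` S = g ` S"
      using h by (simp add: image_image cong: image_cong)
  qed
  then show ?thesis by blast
qed

lemma card_image_cong_iff:
  assumes "\<And>x y. x \<in> S \<Longrightarrow> y \<in> S \<Longrightarrow> f x = f y \<longleftrightarrow> g x = g y"
  shows "card (f ` S) = card (g ` S)" "finite (f ` S) \<longleftrightarrow> finite (g ` S)"
  using bij_betw_image_cong_iff[of S f g, OF assms] bij_betw_same_card bij_betw_finite by blast+

section \<open>Conjugacy classes of subgroups\<close>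

definition conj_by :: "('a, 'b) monoid_scheme \<Rightarrow> 'a \<Rightarrow> 'a \<Rightarrow> 'a" where
  "conj_by G g x = g \<otimes>\<^bsub>G\<^esub> x \<otimes>\<^bsub>G\<^esub> inv\<^bsub>G\<^esub> g"

definition conj_class :: "('a, 'b) monoid_scheme \<Rightarrow> 'a set \<Rightarrow> 'a set set" where
  "conj_class G S = {conj_by G g ` S | g. g \<in> carrier G}"

definition num_conj :: "('a, 'b) monoid_scheme \<Rightarrow> 'a set set \<Rightarrow> nat" where
  "num_conj G \<S> = card (conj_class G ` \<S>)"

lemma num_conj_empty [simp]: "num_conj G {} = 0"
  by (simp add: num_conj_def)

context group begin

lemma conj_by_closed [simp]: "g \<in> carrier G \<Longrightarrow> x \<in> carrier G \<Longrightarrow> conj_by G g x \<in> carrier G"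
  by (simp add: conj_by_def)

lemma conj_by_mult:
  assumes "g \<in> carrier G" "x \<in> carrier G" "y \<in> carrier G"
  shows "conj_by G g (x \<otimes> y) = conj_by G g x \<otimes> conj_by G g y"
proof -
  have "inv g \<otimes> (g \<otimes> (y \<otimes> inv g)) = y \<otimes> inv g"
    using assms by (simp flip: m_assoc)
  then show ?thesis using assms unfolding conj_by_def by (simp add: m_assoc)
qed

lemma conj_by_conj_by:
  assumes "g \<in> carrier G" "h \<in> carrier G" "x \<in> carrier G"
  shows "conj_by G g (conj_by G h x) = conj_by G (g \<otimes> h) x"
  using assms unfolding conj_by_def by (simp add: m_assoc inv_mult_group)

lemma conj_by_one [simp]: "x \<in> carrier G \<Longrightarrow> conj_by G \<one> x = x"
  by (simp add: conj_by_def)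

lemma conj_by_unit [simp]: "g \<in> carrier G \<Longrightarrow> conj_by G g \<one> = \<one>"
  by (simp add: conj_by_def)

lemma conj_by_inv_cancel:
  assumes "g \<in> carrier G" "x \<in> carrier G"
  shows "conj_by G (inv g) (conj_by G g x) = x" "conj_by G g (conj_by G (inv g) x) = x"
  using assms by (simp_all add: conj_by_conj_by)

lemma conj_by_iso: "g \<in> carrier G \<Longrightarrow> conj_by G g \<in> iso G G"
  unfolding iso_def hom_def
  by (auto simp: conj_by_mult conj_by_inv_cancel intro!: bij_betw_byWitness[where f' = "conj_by G (inv g)"])

lemma conj_by_pow:
  assumes "g \<in> carrier G" "x \<in> carrier G"
  shows "conj_by G g (x [^] (n::nat)) = conj_by G g x [^] n"
proof -
  interpret h: group_hom G G "conj_by G g"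
    using conj_by_iso[OF assms(1)] by (unfold_locales) (auto simp: iso_def)
  show ?thesis using assms by (simp add: h.hom_nat_pow)
qed

lemma inj_on_conj_by: "g \<in> carrier G \<Longrightarrow> inj_on (conj_by G g) (carrier G)"
  using conj_by_iso by (auto simp: iso_def bij_betw_def)

lemma card_conj_by: "g \<in> carrier G \<Longrightarrow> S \<subseteq> carrier G \<Longrightarrow> card (conj_by G g ` S) = card S"
  by (intro card_image inj_on_subset[OF inj_on_conj_by])

lemma conj_by_image_comp:
  assumes "g \<in> carrier G" "h \<in> carrier G" "S \<subseteq> carrier G"
  shows "conj_by G g ` conj_by G h ` S = conj_by G (g \<otimes> h) ` S"
proof -
  have "conj_by G g (conj_by G h x) = conj_by G (g \<otimes> h) x" if "x \<in> S" for x
    using that assms by (intro conj_by_conj_by) auto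
  then show ?thesis by (auto simp: image_iff)
qed

lemma conj_by_image_one: "S \<subseteq> carrier G \<Longrightarrow> conj_by G \<one> ` S = S"
  by (force simp: image_iff)

lemma conj_class_refl:
  assumes "S \<subseteq> carrier G"
  shows "S \<in> conj_class G S"
proof -
  have "S = conj_by G \<one> ` S" using conj_by_image_one[OF assms] by simp
  then show ?thesis unfolding conj_class_def by blast
qed

lemma conj_class_eq_iff:
  assumes S: "S \<subseteq> carrier G" and T: "T \<subseteq> carrier G"
  shows "conj_class G S = conj_class G T \<longleftrightarrow> (\<exists>g\<in>carrier G. conj_by G g ` S = T)"
proof
  assume "conj_class G S = conj_class G T"
  then have "T \<in> conj_class G S" using conj_class_refl[OF T] by simp
  then show "\<exists>g\<in>carrier G. conj_by G g ` S = T"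
    by (auto simp: conj_class_def)
next
  assume "\<exists>g\<in>carrier G. conj_by G g ` S = T"
  then obtain g where g: "g \<in> carrier G" "T = conj_by G g ` S" by auto
  have 1: "conj_by G h ` T = conj_by G (h \<otimes> g) ` S" if "h \<in> carrier G" for h
    unfolding g(2) by (rule conj_by_image_comp[OF that g(1) S])
  have 2: "conj_by G h ` S = conj_by G (h \<otimes> inv g) ` T" if "h \<in> carrier G" for h
    using 1[of "h \<otimes> inv g"] that g(1) by (simp add: m_assoc)
  show "conj_class G S = conj_class G T"
  proof (intro equalityI subsetI)
    fix X assume "X \<in> conj_class G S"
    then obtain h where "h \<in> carrier G" "X = conj_by G h ` S" by (auto simp: conj_class_def)
    then show "X \<in> conj_class G T"
      using 2[of h] g(1) unfolding conj_class_def by (intro CollectI exI[of _ "h \<otimes> inv g"]) simp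
  next
    fix X assume "X \<in> conj_class G T"
    then obtain h where "h \<in> carrier G" "X = conj_by G h ` T" by (auto simp: conj_class_def)
    then show "X \<in> conj_class G S"
      using 1[of h] g(1) unfolding conj_class_def by (intro CollectI exI[of _ "h \<otimes> g"]) simp
  qed
qed

lemma num_conj_eq_1:
  assumes "S \<in> \<S>" and "\<And>T. T \<in> \<S> \<Longrightarrow> T \<subseteq> carrier G"
    and "\<And>T. T \<in> \<S> \<Longrightarrow> \<exists>g\<in>carrier G. conj_by G g ` T = S"
  shows "num_conj G \<S> = 1"
proof -
  have "conj_class G T = conj_class G S" if "T \<in> \<S>" for T
    using conj_class_eq_iff[OF assms(2)[OF that] assms(2)[OF assms(1)]] assms(3)[OF that] by simp
  then have "conj_class G ` \<S> \<subseteq> {conj_class G S}" by blast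
  then have "conj_class G ` \<S> = {conj_class G S}" using assms(1) by blast
  then show ?thesis by (simp add: num_conj_def)
qed

text \<open>Conjugacy classes of two families are counted separately as soon as no member of one is conjugate
  to a member of the other.\<close>

lemma num_conj_Un:
  assumes fin: "finite (carrier G)" and sub: "\<And>T. T \<in> \<S> \<union> \<T> \<Longrightarrow> T \<subseteq> carrier G"
    and disj: "\<And>S T g. S \<in> \<S> \<Longrightarrow> T \<in> \<T> \<Longrightarrow> g \<in> carrier G \<Longrightarrow> conj_by G g ` S \<noteq> T"
  shows "num_conj G (\<S> \<union> \<T>) = num_conj G \<S> + num_conj G \<T>"
proof -
  have fin2: "finite (\<S> \<union> \<T>)"
  proof (rule finite_subset)
    show "\<S> \<union> \<T> \<subseteq> Pow (carrier G)" by (intro subsetI PowI sub)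
  qed (simp add: fin)
  have dis: "conj_class G ` \<S> \<inter> conj_class G ` \<T> = {}"
  proof (rule ccontr)
    assume "conj_class G ` \<S> \<inter> conj_class G ` \<T> \<noteq> {}"
    then obtain X where "X \<in> conj_class G ` \<S>" "X \<in> conj_class G ` \<T>" by blast
    then obtain S T where ST: "S \<in> \<S>" "T \<in> \<T>" "conj_class G S = conj_class G T" by (elim imageE) simp
    then obtain g where "g \<in> carrier G" "conj_by G g ` S = T"
      using conj_class_eq_iff[of S T] sub[of S] sub[of T] by auto
    then show False using disj ST by blast
  qed
  have "card (conj_class G ` \<S> \<union> conj_class G ` \<T>) = card (conj_class G ` \<S>) + card (conj_class G ` \<T>)"
    using fin2 by (intro card_Un_disjoint finite_imageI dis) simp_all
  then show ?thesis by (simp only: num_conj_def image_Un)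
qed

end

section \<open>Semidirect products\<close>

text \<open>The semidirect product for an action that factors as a homomorphism \<open>\<theta>\<close> into a group of operators
  followed by the action \<open>act\<close> of that group: the classification varies \<open>\<theta>\<close> and keeps \<open>act\<close>.\<close>

definition sdprod ::
  "'q monoid \<Rightarrow> 'h monoid \<Rightarrow> ('g \<Rightarrow> 'q \<Rightarrow> 'q) \<Rightarrow> ('h \<Rightarrow> 'g) \<Rightarrow> ('q \<times> 'h) monoid" where
  "sdprod Q P act \<theta> = \<lparr>carrier = carrier Q \<times> carrier P,
     mult = (\<lambda>(x, h) (y, k). (x \<otimes>\<^bsub>Q\<^esub> act (\<theta> h) y, h \<otimes>\<^bsub>P\<^esub> k)),
     one = (\<one>\<^bsub>Q\<^esub>, \<one>\<^bsub>P\<^esub>)\<rparr>"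

lemma carrier_sdprod [simp]: "carrier (sdprod Q P act \<theta>) = carrier Q \<times> carrier P"
  and one_sdprod [simp]: "\<one>\<^bsub>sdprod Q P act \<theta>\<^esub> = (\<one>\<^bsub>Q\<^esub>, \<one>\<^bsub>P\<^esub>)"
  and mult_sdprod [simp]: "(x, h) \<otimes>\<^bsub>sdprod Q P act \<theta>\<^esub> (y, k) = (x \<otimes>\<^bsub>Q\<^esub> act (\<theta> h) y, h \<otimes>\<^bsub>P\<^esub> k)"
  by (simp_all add: sdprod_def)

lemma (in group) ord_dvd_card_subgroup:
  assumes "subgroup H G" "x \<in> H"
  shows "ord x dvd card H"
proof -
  interpret H: subgroup H G by (rule assms)
  interpret GH: group "G\<lparr>carrier := H\<rparr>" by (rule H.subgroup_is_group[OF is_group])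
  have "x [^]\<^bsub>G\<lparr>carrier := H\<rparr>\<^esub> card H = \<one>"
    using GH.pow_order_eq_1[of x] assms(2) by (simp add: order_def)
  then show ?thesis
    using pow_eq_id[of x "card H"] assms H.subset by (auto simp flip: nat_pow_consistent)
qed

text \<open>The operator group \<open>A\<close> is a concrete copy of the automorphism group of \<open>Q\<close>: \<^term>\<open>act\<close> is faithful,
  and every automorphism occurs.  Faithfulness is what turns identities between automorphisms into
  identities in \<open>A\<close>, where the classes of subgroups are counted.\<close>

locale full_action = Q: comm_group Q + A: group A for Q :: "'q monoid" and A :: "'g monoid" +
  fixes act :: "'g \<Rightarrow> 'q \<Rightarrow> 'q"
  assumes finQ: "finite (carrier Q)" and finA: "finite (carrier A)"
    and act_iso: "a \<in> carrier A \<Longrightarrow> act a \<in> iso Q Q"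
    and act_mult: "a \<in> carrier A \<Longrightarrow> b \<in> carrier A \<Longrightarrow> x \<in> carrier Q \<Longrightarrow>
      act (a \<otimes>\<^bsub>A\<^esub> b) x = act a (act b x)"
    and act_faithful: "a \<in> carrier A \<Longrightarrow> b \<in> carrier A \<Longrightarrow>
      (\<And>x. x \<in> carrier Q \<Longrightarrow> act a x = act b x) \<Longrightarrow> a = b"
    and act_full: "f \<in> iso Q Q \<Longrightarrow> \<exists>a\<in>carrier A. \<forall>x\<in>carrier Q. act a x = f x"
begin

lemma act_closed [simp]: "a \<in> carrier A \<Longrightarrow> x \<in> carrier Q \<Longrightarrow> act a x \<in> carrier Q"
  using act_iso by (auto simp: iso_def hom_def)

lemma act_hom: "a \<in> carrier A \<Longrightarrow> x \<in> carrier Q \<Longrightarrow> y \<in> carrier Q \<Longrightarrow>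
    act a (x \<otimes>\<^bsub>Q\<^esub> y) = act a x \<otimes>\<^bsub>Q\<^esub> act a y"
  using act_iso by (auto simp: iso_def hom_def)

lemma act_unit [simp]: "a \<in> carrier A \<Longrightarrow> act a \<one>\<^bsub>Q\<^esub> = \<one>\<^bsub>Q\<^esub>"
  using act_hom[of a "\<one>\<^bsub>Q\<^esub>" "\<one>\<^bsub>Q\<^esub>"] by (simp add: Q.l_cancel_one')

lemma act_one [simp]: "x \<in> carrier Q \<Longrightarrow> act \<one>\<^bsub>A\<^esub> x = x"
proof -
  assume x: "x \<in> carrier Q"
  have "inj_on (act \<one>\<^bsub>A\<^esub>) (carrier Q)" using act_iso by (auto simp: iso_def bij_betw_def)
  moreover have "act \<one>\<^bsub>A\<^esub> (act \<one>\<^bsub>A\<^esub> x) = act \<one>\<^bsub>A\<^esub> x" using act_mult[of "\<one>\<^bsub>A\<^esub>" "\<one>\<^bsub>A\<^esub>" x] x by simp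
  ultimately show ?thesis using x by (auto dest: inj_onD)
qed

end

locale action_hom = full_action Q A act + P: group P
  for Q :: "'q monoid" and A :: "'g monoid" and act and P :: "'h monoid" +
  fixes \<theta> :: "'h \<Rightarrow> 'g"
  assumes finP: "finite (carrier P)"
    and theta: "\<theta> \<in> hom P A"
    and coprime_orders: "coprime (order Q) (order P)"
begin

abbreviation S where "S \<equiv> sdprod Q P act \<theta>"

lemma theta_closed [simp]: "h \<in> carrier P \<Longrightarrow> \<theta> h \<in> carrier A"
  using theta by (auto simp: hom_def)

lemma theta_mult: "h \<in> carrier P \<Longrightarrow> k \<in> carrier P \<Longrightarrow> \<theta> (h \<otimes>\<^bsub>P\<^esub> k) = \<theta> h \<otimes>\<^bsub>A\<^esub> \<theta> k"
  using theta by (auto simp: hom_def)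

lemma theta_one [simp]: "\<theta> \<one>\<^bsub>P\<^esub> = \<one>\<^bsub>A\<^esub>"
  using theta hom_one P.group_axioms A.group_axioms by blast

lemma theta_image_subset: "\<theta> ` carrier P \<subseteq> carrier A"
  by auto

lemma sdprod_group: "group S"
proof (rule groupI)
  fix x assume "x \<in> carrier S"
  then obtain n h where x: "x = (n, h)" "n \<in> carrier Q" "h \<in> carrier P" by auto
  have "act (\<theta> (inv\<^bsub>P\<^esub> h)) (inv\<^bsub>Q\<^esub> n) \<otimes>\<^bsub>Q\<^esub> act (\<theta> (inv\<^bsub>P\<^esub> h)) n = \<one>\<^bsub>Q\<^esub>"
    using x by (simp flip: act_hom)
  then show "\<exists>y\<in>carrier S. y \<otimes>\<^bsub>S\<^esub> x = \<one>\<^bsub>S\<^esub>"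
    using x by (intro bexI[of _ "(act (\<theta> (inv\<^bsub>P\<^esub> h)) (inv\<^bsub>Q\<^esub> n), inv\<^bsub>P\<^esub> h)"]) auto
qed (auto simp: Q.m_assoc P.m_assoc theta_mult act_hom act_mult)

lemma sdprod_finite: "finite (carrier S)"
  using finP finQ by simp

lemma sdprod_order: "order S = order Q * order P"
  by (simp add: order_def card_cartesian_product)

lemma sdprod_pow: "x \<in> carrier S \<Longrightarrow> snd (x [^]\<^bsub>S\<^esub> (k::nat)) = snd x [^]\<^bsub>P\<^esub> k \<and> x [^]\<^bsub>S\<^esub> k \<in> carrier S"
proof (induction k)
  case (Suc k)
  then obtain a b c d where "x = (a, b)" "x [^]\<^bsub>S\<^esub> k = (c, d)" by (metis surj_pair)
  then show ?case using Suc by auto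
qed simp

lemma sdprod_pow_fst: "n \<in> carrier Q \<Longrightarrow> (n, \<one>\<^bsub>P\<^esub>) [^]\<^bsub>S\<^esub> (k::nat) = (n [^]\<^bsub>Q\<^esub> k, \<one>\<^bsub>P\<^esub>)"
  by (induction k) auto

lemma coprime_pow_eq_one:
  assumes "h \<in> carrier P" "h [^]\<^bsub>P\<^esub> order Q = \<one>\<^bsub>P\<^esub>"
  shows "h = \<one>\<^bsub>P\<^esub>"
proof -
  have "P.ord h dvd order Q" "P.ord h dvd order P"
    using assms P.pow_eq_id P.ord_dvd_group_order by auto
  then have "P.ord h = 1"
    using coprime_orders coprime_common_divisor_nat by blast
  then show ?thesis using assms P.ord_eq_1 by blast
qed

text \<open>Coprimality makes the kernel \<open>Q\<close> characteristic: it consists of the elements killed by the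
  order of \<open>Q\<close>.\<close>

lemma sdprod_kernel_iff:
  assumes "x \<in> carrier S"
  shows "x [^]\<^bsub>S\<^esub> order Q = \<one>\<^bsub>S\<^esub> \<longleftrightarrow> snd x = \<one>\<^bsub>P\<^esub>"
proof
  assume "x [^]\<^bsub>S\<^esub> order Q = \<one>\<^bsub>S\<^esub>"
  then have "snd x [^]\<^bsub>P\<^esub> order Q = \<one>\<^bsub>P\<^esub>" using sdprod_pow[OF assms, of "order Q"] by simp
  then show "snd x = \<one>\<^bsub>P\<^esub>" using coprime_pow_eq_one assms by auto
next
  assume "snd x = \<one>\<^bsub>P\<^esub>"
  then have "x = (fst x, \<one>\<^bsub>P\<^esub>)" "fst x \<in> carrier Q" using assms by auto
  then have "x [^]\<^bsub>S\<^esub> order Q = (fst x [^]\<^bsub>Q\<^esub> order Q, \<one>\<^bsub>P\<^esub>)" using sdprod_pow_fst by metis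
  also have "\<dots> = \<one>\<^bsub>S\<^esub>" using \<open>fst x \<in> carrier Q\<close> by (simp add: Q.pow_order_eq_1)
  finally show "x [^]\<^bsub>S\<^esub> order Q = \<one>\<^bsub>S\<^esub>" .
qed

end

text \<open>An isomorphism preserves the characteristic kernels, so it induces isomorphisms on the kernels
  and on the quotients.\<close>

lemma sdprod_iso_restrict:
  assumes 1: "action_hom Q A act P \<theta>" and 2: "action_hom Q' A' act' P' \<theta>'"
    and ord: "order Q = order Q'"
    and f: "f \<in> iso (sdprod Q P act \<theta>) (sdprod Q' P' act' \<theta>')"
  shows "\<exists>\<alpha>\<in>iso Q Q'. \<exists>\<beta>\<in>iso P P'. \<forall>x\<in>carrier Q. f (x, \<one>\<^bsub>P\<^esub>) = (\<alpha> x, \<one>\<^bsub>P'\<^esub>) \<and>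
           (\<forall>h\<in>carrier P. snd (f (\<one>\<^bsub>Q\<^esub>, h)) = \<beta> h)"
proof -
  interpret s: action_hom Q A act P \<theta> by (rule 1)
  interpret s': action_hom Q' A' act' P' \<theta>' by (rule 2)
  interpret S: group s.S by (rule s.sdprod_group)
  interpret S': group s'.S by (rule s'.sdprod_group)
  interpret f: group_hom s.S s'.S f using f by unfold_locales (auto simp: iso_def)
  have inj: "inj_on f (carrier s.S)" and surj: "f ` carrier s.S = carrier s'.S"
    using f by (auto simp: iso_def bij_betw_def)
  have card: "card (carrier Q) = card (carrier Q')" using ord by (simp add: order_def)
  have ker: "snd (f x) = \<one>\<^bsub>P'\<^esub> \<longleftrightarrow> snd x = \<one>\<^bsub>P\<^esub>" if x: "x \<in> carrier s.S" for x
  proof -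
    have "f x [^]\<^bsub>s'.S\<^esub> order Q' = f (x [^]\<^bsub>s.S\<^esub> order Q)" using f.hom_nat_pow[OF x] ord by simp
    moreover have "f (x [^]\<^bsub>s.S\<^esub> order Q) = \<one>\<^bsub>s'.S\<^esub> \<longleftrightarrow> x [^]\<^bsub>s.S\<^esub> order Q = \<one>\<^bsub>s.S\<^esub>"
      using inj x f.hom_one by (metis S.nat_pow_closed S.one_closed inj_onD)
    ultimately show ?thesis
      using s.sdprod_kernel_iff[OF x] s'.sdprod_kernel_iff[OF f.hom_closed[OF x]] by simp
  qed
  define \<alpha> where "\<alpha> = (\<lambda>x. fst (f (x, \<one>\<^bsub>P\<^esub>)))"
  define \<beta> where "\<beta> = (\<lambda>h. snd (f (\<one>\<^bsub>Q\<^esub>, h)))"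
  have fa: "f (x, \<one>\<^bsub>P\<^esub>) = (\<alpha> x, \<one>\<^bsub>P'\<^esub>)" "\<alpha> x \<in> carrier Q'" if "x \<in> carrier Q" for x
    using ker[of "(x, \<one>\<^bsub>P\<^esub>)"] f.hom_closed[of "(x, \<one>\<^bsub>P\<^esub>)"] that
    by (auto simp: \<alpha>_def prod_eq_iff)
  have fb: "f (\<one>\<^bsub>Q\<^esub>, h) = (fst (f (\<one>\<^bsub>Q\<^esub>, h)), \<beta> h)" "\<beta> h \<in> carrier P'" "fst (f (\<one>\<^bsub>Q\<^esub>, h)) \<in> carrier Q'"
    if "h \<in> carrier P" for h
    using f.hom_closed[of "(\<one>\<^bsub>Q\<^esub>, h)"] that by (auto simp: \<beta>_def mem_Times_iff)
  have fmult: "f (x, h) = f (x, \<one>\<^bsub>P\<^esub>) \<otimes>\<^bsub>s'.S\<^esub> f (\<one>\<^bsub>Q\<^esub>, h)" if "x \<in> carrier Q" "h \<in> carrier P" for x h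
    using that f.hom_mult[of "(x, \<one>\<^bsub>P\<^esub>)" "(\<one>\<^bsub>Q\<^esub>, h)"] by simp
  have \<alpha>: "\<alpha> \<in> iso Q Q'"
  proof (intro isoI homI)
    fix x y assume xy: "x \<in> carrier Q" "y \<in> carrier Q"
    show "\<alpha> (x \<otimes>\<^bsub>Q\<^esub> y) = \<alpha> x \<otimes>\<^bsub>Q'\<^esub> \<alpha> y"
      using f.hom_mult[of "(x, \<one>\<^bsub>P\<^esub>)" "(y, \<one>\<^bsub>P\<^esub>)"] xy fa by simp
  next
    have "inj_on \<alpha> (carrier Q)"
    proof (rule inj_onI)
      fix x y assume "x \<in> carrier Q" "y \<in> carrier Q" "\<alpha> x = \<alpha> y"
      then show "x = y" using inj_onD[OF inj, of "(x, \<one>\<^bsub>P\<^esub>)" "(y, \<one>\<^bsub>P\<^esub>)"] fa by simp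
    qed
    moreover from this have "\<alpha> ` carrier Q = carrier Q'"
      using card fa s'.finQ by (intro card_subset_eq) (auto simp: card_image)
    ultimately show "bij_betw \<alpha> (carrier Q) (carrier Q')" by (simp add: bij_betw_def)
  qed (use fa in auto)
  have hom: "\<beta> (h \<otimes>\<^bsub>P\<^esub> k) = \<beta> h \<otimes>\<^bsub>P'\<^esub> \<beta> k" if hk: "h \<in> carrier P" "k \<in> carrier P" for h k
  proof -
    have "f (\<one>\<^bsub>Q\<^esub>, h \<otimes>\<^bsub>P\<^esub> k) = f (\<one>\<^bsub>Q\<^esub>, h) \<otimes>\<^bsub>s'.S\<^esub> f (\<one>\<^bsub>Q\<^esub>, k)"
      using f.hom_mult[of "(\<one>\<^bsub>Q\<^esub>, h)" "(\<one>\<^bsub>Q\<^esub>, k)"] hk by simp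
    moreover obtain u v where "f (\<one>\<^bsub>Q\<^esub>, h) = (u, \<beta> h)" "f (\<one>\<^bsub>Q\<^esub>, k) = (v, \<beta> k)"
      using fb(1)[OF hk(1)] fb(1)[OF hk(2)] by blast
    ultimately have "snd (f (\<one>\<^bsub>Q\<^esub>, h \<otimes>\<^bsub>P\<^esub> k)) = \<beta> h \<otimes>\<^bsub>P'\<^esub> \<beta> k" by simp
    then show ?thesis by (simp only: \<beta>_def)
  qed
  have \<beta>: "\<beta> \<in> iso P P'"
  proof (intro isoI homI)
    interpret b: group_hom P P' \<beta> using fb(2) hom by unfold_locales (simp add: hom_def)
    have "inj_on \<beta> (carrier P)"
    proof (rule b.inj_on_one_iff[THEN iffD2], intro allI impI)
      fix h assume "h \<in> carrier P" "\<beta> h = \<one>\<^bsub>P'\<^esub>"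
      then show "h = \<one>\<^bsub>P\<^esub>" using ker[of "(\<one>\<^bsub>Q\<^esub>, h)"] by (simp add: \<beta>_def)
    qed
    moreover have "\<beta> ` carrier P = carrier P'"
    proof (intro equalityI subsetI)
      fix k assume "k \<in> carrier P'"
      then have "(\<one>\<^bsub>Q'\<^esub>, k) \<in> f ` carrier s.S" using surj by simp
      then obtain x h where xh: "x \<in> carrier Q" "h \<in> carrier P" "f (x, h) = (\<one>\<^bsub>Q'\<^esub>, k)" by auto
      obtain u where "f (\<one>\<^bsub>Q\<^esub>, h) = (u, \<beta> h)" using fb(1)[OF xh(2)] by blast
      then have "(\<one>\<^bsub>Q'\<^esub>, k) = (\<alpha> x, \<one>\<^bsub>P'\<^esub>) \<otimes>\<^bsub>s'.S\<^esub> (u, \<beta> h)"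
        using fmult[OF xh(1,2)] fa(1)[OF xh(1)] xh(3) by simp
      then have "k = \<beta> h" using fb(2)[OF xh(2)] by simp
      then show "k \<in> \<beta> ` carrier P" using xh by blast
    qed (use fb in auto)
    ultimately show "bij_betw \<beta> (carrier P) (carrier P')" by (simp add: bij_betw_def)
  qed (use fb hom in auto)
  show ?thesis
  proof (intro bexI[OF _ \<alpha>] bexI[OF _ \<beta>] ballI conjI)
    fix x h assume "x \<in> carrier Q" then show "f (x, \<one>\<^bsub>P\<^esub>) = (\<alpha> x, \<one>\<^bsub>P'\<^esub>)" by (rule fa)
  qed (simp add: \<beta>_def)
qed

context full_action begin

text \<open>Let \<open>\<alpha>\<close> and \<open>\<beta>\<close> be the automorphisms that an isomorphism induces on \<open>Q\<close> and on \<open>P\<close>.  Applying it to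
  \<open>h x h\<^sup>-\<^sup>1\<close> shows that \<open>\<alpha>\<close> conjugates the action of \<open>h\<close> into the action of \<open>\<beta> h\<close>, because the
  \<open>Q\<close>-component of the image of \<open>h\<close> acts trivially on the abelian group \<open>Q\<close>.\<close>

lemma sdprod_iso_imp_conj:
  assumes 1: "action_hom Q A act P \<theta>" and 2: "action_hom Q A act P \<theta>'"
    and iso: "sdprod Q P act \<theta> \<cong> sdprod Q P act \<theta>'"
  shows "\<exists>a\<in>carrier A. conj_by A a ` \<theta> ` carrier P = \<theta>' ` carrier P"
proof -
  interpret s: action_hom Q A act P \<theta> by (rule 1)
  interpret s': action_hom Q A act P \<theta>' by (rule 2)
  obtain f where f: "f \<in> iso s.S s'.S" using iso by (auto simp: is_iso_def)
  obtain \<alpha> \<beta> where \<alpha>: "\<alpha> \<in> iso Q Q" and \<beta>: "\<beta> \<in> iso P P"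
    and fa: "\<And>x. x \<in> carrier Q \<Longrightarrow> f (x, \<one>\<^bsub>P\<^esub>) = (\<alpha> x, \<one>\<^bsub>P\<^esub>)"
    and fb: "\<And>h. h \<in> carrier P \<Longrightarrow> snd (f (\<one>\<^bsub>Q\<^esub>, h)) = \<beta> h"
    using sdprod_iso_restrict[OF 1 2 refl f] by (metis Q.one_closed)
  obtain a where a: "a \<in> carrier A" "\<And>x. x \<in> carrier Q \<Longrightarrow> act a x = \<alpha> x"
    using act_full[OF \<alpha>] by blast
  have b: "\<beta> h \<in> carrier P" if "h \<in> carrier P" for h using \<beta> that by (auto simp: iso_def hom_def)
  interpret S: group s.S by (rule s.sdprod_group)
  interpret S': group s'.S by (rule s'.sdprod_group)
  interpret f: group_hom s.S s'.S f using f by unfold_locales (auto simp: iso_def)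
  have key: "conj_by A a (\<theta> h) = \<theta>' (\<beta> h)" if h: "h \<in> carrier P" for h
  proof -
    obtain u where fu: "f (\<one>\<^bsub>Q\<^esub>, h) = (u, \<beta> h)" and u: "u \<in> carrier Q"
    proof
      have "f (\<one>\<^bsub>Q\<^esub>, h) \<in> carrier Q \<times> carrier P" using f.hom_closed[of "(\<one>\<^bsub>Q\<^esub>, h)"] h by simp
      then show "fst (f (\<one>\<^bsub>Q\<^esub>, h)) \<in> carrier Q" by (simp add: mem_Times_iff)
      show "f (\<one>\<^bsub>Q\<^esub>, h) = (fst (f (\<one>\<^bsub>Q\<^esub>, h)), \<beta> h)" by (simp add: prod_eq_iff fb[OF h])
    qed
    have "a \<otimes>\<^bsub>A\<^esub> \<theta> h = \<theta>' (\<beta> h) \<otimes>\<^bsub>A\<^esub> a"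
    proof (rule act_faithful)
      fix x assume x: "x \<in> carrier Q"
      have fa': "f (y, \<one>\<^bsub>P\<^esub>) = (act a y, \<one>\<^bsub>P\<^esub>)" if "y \<in> carrier Q" for y
        using fa[OF that] a(2)[OF that] by simp
      have "f ((\<one>\<^bsub>Q\<^esub>, h) \<otimes>\<^bsub>s.S\<^esub> (x, \<one>\<^bsub>P\<^esub>)) = (u, \<beta> h) \<otimes>\<^bsub>s'.S\<^esub> (act a x, \<one>\<^bsub>P\<^esub>)"
        using x h f.hom_mult[of "(\<one>\<^bsub>Q\<^esub>, h)" "(x, \<one>\<^bsub>P\<^esub>)"] fu fa'[OF x] by simp
      moreover have "f ((act (\<theta> h) x, \<one>\<^bsub>P\<^esub>) \<otimes>\<^bsub>s.S\<^esub> (\<one>\<^bsub>Q\<^esub>, h)) = (act a (act (\<theta> h) x), \<one>\<^bsub>P\<^esub>) \<otimes>\<^bsub>s'.S\<^esub> (u, \<beta> h)"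
        using x h f.hom_mult[of "(act (\<theta> h) x, \<one>\<^bsub>P\<^esub>)" "(\<one>\<^bsub>Q\<^esub>, h)"] fu fa'[of "act (\<theta> h) x"] by simp
      moreover have "(\<one>\<^bsub>Q\<^esub>, h) \<otimes>\<^bsub>s.S\<^esub> (x, \<one>\<^bsub>P\<^esub>) = (act (\<theta> h) x, \<one>\<^bsub>P\<^esub>) \<otimes>\<^bsub>s.S\<^esub> (\<one>\<^bsub>Q\<^esub>, h)"
        using x h by simp
      ultimately have "(u, \<beta> h) \<otimes>\<^bsub>s'.S\<^esub> (act a x, \<one>\<^bsub>P\<^esub>) = (act a (act (\<theta> h) x), \<one>\<^bsub>P\<^esub>) \<otimes>\<^bsub>s'.S\<^esub> (u, \<beta> h)"
        by metis
      then have "u \<otimes>\<^bsub>Q\<^esub> act (\<theta>' (\<beta> h)) (act a x) = act a (act (\<theta> h) x) \<otimes>\<^bsub>Q\<^esub> u"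
        using u by simp
      also have "\<dots> = u \<otimes>\<^bsub>Q\<^esub> act a (act (\<theta> h) x)"
        using x h a(1) u by (simp add: Q.m_comm)
      finally have "act (\<theta>' (\<beta> h)) (act a x) = act a (act (\<theta> h) x)"
        using x h a(1) u b by simp
      then show "act (a \<otimes>\<^bsub>A\<^esub> \<theta> h) x = act (\<theta>' (\<beta> h) \<otimes>\<^bsub>A\<^esub> a) x"
        using x h a(1) b by (simp add: act_mult)
    qed (use a(1) h b in auto)
    then show ?thesis using a(1) h b by (simp add: conj_by_def A.m_assoc)
  qed
  have "conj_by A a ` \<theta> ` carrier P = \<theta>' ` \<beta> ` carrier P"
    using key by (force simp: image_iff)
  also have "\<beta> ` carrier P = carrier P" using \<beta> by (auto simp: iso_def bij_betw_def)
  finally show ?thesis using a(1) by blast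
qed

end

text \<open>Two homomorphisms with the same image differ by an automorphism of the source: the property
  of \<open>P\<close> that makes the image of an action a complete invariant.\<close>

definition image_determined :: "('h, 'x) monoid_scheme \<Rightarrow> 'g monoid \<Rightarrow> bool" where
  "image_determined P A \<longleftrightarrow> (\<forall>f\<in>hom P A. \<forall>g\<in>hom P A. f ` carrier P = g ` carrier P \<longrightarrow>
     (\<exists>\<beta>\<in>iso P P. \<forall>x\<in>carrier P. f (\<beta> x) = g x))"

context full_action begin

text \<open>If \<open>a\<close> conjugates one image into the other, then \<open>\<theta>'\<close> and the conjugate of \<open>\<theta>\<close> by \<open>a\<close> differ by an
  automorphism \<open>\<beta>\<close> of \<open>P\<close>, and \<open>(x, h) \<mapsto> (a x, \<beta> h)\<close> is an isomorphism.\<close>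

lemma conj_imp_sdprod_iso:
  assumes 1: "action_hom Q A act P \<theta>" and 2: "action_hom Q A act P \<theta>'"
    and P: "image_determined P A"
    and a: "a \<in> carrier A" "conj_by A a ` \<theta> ` carrier P = \<theta>' ` carrier P"
  shows "sdprod Q P act \<theta> \<cong> sdprod Q P act \<theta>'"
proof -
  interpret s: action_hom Q A act P \<theta> by (rule 1)
  interpret s': action_hom Q A act P \<theta>' by (rule 2)
  have c: "conj_by A a \<circ> \<theta> \<in> hom P A"
    using a(1) by (auto simp: hom_def s.theta_mult A.conj_by_mult)
  obtain \<beta> where \<beta>: "\<beta> \<in> iso P P" "\<And>h. h \<in> carrier P \<Longrightarrow> \<theta>' (\<beta> h) = conj_by A a (\<theta> h)"
  proof -
    have "\<theta>' ` carrier P = (conj_by A a \<circ> \<theta>) ` carrier P" using a(2) by (simp add: image_comp)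
    then have "\<exists>\<beta>\<in>iso P P. \<forall>x\<in>carrier P. \<theta>' (\<beta> x) = (conj_by A a \<circ> \<theta>) x"
      using P s'.theta c unfolding image_determined_def by blast
    then show ?thesis using that by auto
  qed
  have b: "\<beta> h \<in> carrier P" if "h \<in> carrier P" for h using \<beta> that by (auto simp: iso_def hom_def)
  have bm: "\<beta> (h \<otimes>\<^bsub>P\<^esub> k) = \<beta> h \<otimes>\<^bsub>P\<^esub> \<beta> k" if "h \<in> carrier P" "k \<in> carrier P" for h k
    using \<beta> that by (auto simp: iso_def hom_def)
  have comm: "\<theta>' (\<beta> h) \<otimes>\<^bsub>A\<^esub> a = a \<otimes>\<^bsub>A\<^esub> \<theta> h" if "h \<in> carrier P" for h
    using that a(1) \<beta>(2)[OF that] by (simp add: conj_by_def A.m_assoc)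
  have act: "act (\<theta>' (\<beta> h)) (act a x) = act a (act (\<theta> h) x)" if "h \<in> carrier P" "x \<in> carrier Q" for h x
    using arg_cong[OF comm[OF that(1)], of "\<lambda>c. act c x"] that a(1) b by (simp add: act_mult)
  have "map_prod (act a) \<beta> \<in> iso s.S s'.S"
  proof (intro isoI homI)
    show "bij_betw (map_prod (act a) \<beta>) (carrier s.S) (carrier s'.S)"
      using act_iso[OF a(1)] \<beta>(1) by (auto simp: iso_def intro!: bij_betw_map_prod)
  qed (use a(1) b bm act in \<open>auto simp: act_hom\<close>)
  then show ?thesis by (rule is_isoI)
qed

text \<open>The reduction at the heart of the classification: counting semidirect products becomes counting
  conjugacy classes of subgroups of the automorphism group.\<close>

theorem card_iso_types_sdprod:
  assumes P: "group P" "finite (carrier P)" "coprime (order Q) (order P)" "image_determined P A"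
    and H: "H \<subseteq> hom P A"
  shows "card (iso_type (order Q * order P) ` sdprod Q P act ` H) = num_conj A ((\<lambda>\<theta>. \<theta> ` carrier P) ` H)"
    and "finite (iso_type (order Q * order P) ` sdprod Q P act ` H)"
proof -
  have act: "action_hom Q A act P \<theta>" if "\<theta> \<in> H" for \<theta>
    using that H P full_action_axioms by (intro action_hom.intro action_hom_axioms.intro) auto
  have iff: "iso_type (order Q * order P) (sdprod Q P act \<theta>) = iso_type (order Q * order P) (sdprod Q P act \<theta>')
     \<longleftrightarrow> conj_class A (\<theta> ` carrier P) = conj_class A (\<theta>' ` carrier P)"
    if t: "\<theta> \<in> H" "\<theta>' \<in> H" for \<theta> \<theta>'
  proof -
    interpret s: action_hom Q A act P \<theta> by (rule act[OF t(1)])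
    interpret s': action_hom Q A act P \<theta>' by (rule act[OF t(2)])
    have "conj_class A (\<theta> ` carrier P) = conj_class A (\<theta>' ` carrier P) \<longleftrightarrow> s.S \<cong> s'.S"
      using sdprod_iso_imp_conj[OF act[OF t(1)] act[OF t(2)]]
        conj_imp_sdprod_iso[OF act[OF t(1)] act[OF t(2)] P(4)]
        A.conj_class_eq_iff[OF s.theta_image_subset s'.theta_image_subset] by blast
    then show ?thesis
      using iso_type_eq_iff[OF s.sdprod_group s.sdprod_finite s.sdprod_order s'.sdprod_group] by simp
  qed
  have eq: "iso_type (order Q * order P) ` sdprod Q P act ` H
      = (\<lambda>\<theta>. iso_type (order Q * order P) (sdprod Q P act \<theta>)) ` H" by (simp add: image_image)
  have eq': "conj_class A ` (\<lambda>\<theta>. \<theta> ` carrier P) ` H = (\<lambda>\<theta>. conj_class A (\<theta> ` carrier P)) ` H"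
    by (simp add: image_image)
  show "card (iso_type (order Q * order P) ` sdprod Q P act ` H) = num_conj A ((\<lambda>\<theta>. \<theta> ` carrier P) ` H)"
    unfolding num_conj_def eq eq' by (rule card_image_cong_iff(1)) (rule iff)
  have "(\<lambda>\<theta>. \<theta> ` carrier P) ` H \<subseteq> Pow (carrier A)" using H by (auto simp: hom_def)
  then have "finite ((\<lambda>\<theta>. \<theta> ` carrier P) ` H)" using finA finite_subset by blast
  then have "finite ((\<lambda>\<theta>. conj_class A (\<theta> ` carrier P)) ` H)" unfolding eq'[symmetric] by (rule finite_imageI)
  then show "finite (iso_type (order Q * order P) ` sdprod Q P act ` H)"
    unfolding eq by (subst card_image_cong_iff(2)[of H _ "\<lambda>\<theta>. conj_class A (\<theta> ` carrier P)", OF iff])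
qed

text \<open>Conjugation by an element of the complement \<open>H\<close> restricts to an automorphism of \<open>N\<close>, which
  is the action of an element of \<open>A\<close>; faithfulness makes the choice of that element a homomorphism.\<close>

lemma iso_sdprod:
  assumes G: "group G" "finite (carrier G)" "order G = order Q * order P"
    and N: "N \<lhd> G" "f \<in> iso Q (G\<lparr>carrier := N\<rparr>)"
    and H: "subgroup H G" "g \<in> iso P (G\<lparr>carrier := H\<rparr>)" and P: "group P"
    and cop: "coprime (order Q) (order P)"
  shows "\<exists>\<theta>\<in>hom P A. G \<cong> sdprod Q P act \<theta>"
proof -
  interpret G: group G by (rule G)
  interpret P: group P by (rule P)
  interpret N: normal N G by (rule N)
  interpret H: subgroup H G by (rule H)
  have fN: "f ` carrier Q = N" and f_inj: "inj_on f (carrier Q)" using N(2) by (auto simp: iso_def bij_betw_def)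
  have gH: "g ` carrier P = H" and g_inj: "inj_on g (carrier P)" using H(2) by (auto simp: iso_def bij_betw_def)
  have fc [simp]: "f x \<in> N" "f x \<in> carrier G" if "x \<in> carrier Q" for x using fN that N.subset by auto
  have gc [simp]: "g x \<in> H" "g x \<in> carrier G" if "x \<in> carrier P" for x using gH that H.subset by auto
  have fm: "f (x \<otimes>\<^bsub>Q\<^esub> y) = f x \<otimes>\<^bsub>G\<^esub> f y" if "x \<in> carrier Q" "y \<in> carrier Q" for x y
    using N(2) that by (auto simp: iso_def hom_def)
  have gm: "g (x \<otimes>\<^bsub>P\<^esub> y) = g x \<otimes>\<^bsub>G\<^esub> g y" if "x \<in> carrier P" "y \<in> carrier P" for x y
    using H(2) that by (auto simp: iso_def hom_def)
  have ex: "\<exists>a\<in>carrier A. \<forall>x\<in>carrier Q. f (act a x) = conj_by G (g h) (f x)" if h: "h \<in> carrier P" for h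
  proof -
    define \<phi> where "\<phi> = (\<lambda>x. inv_into (carrier Q) f (conj_by G (g h) (f x)))"
    have cN: "conj_by G (g h) y \<in> N" if "y \<in> N" for y
      using N.inv_op_closed2[of "g h" y] that h by (simp add: conj_by_def)
    have phi: "f (\<phi> x) = conj_by G (g h) (f x)" "\<phi> x \<in> carrier Q" if "x \<in> carrier Q" for x
      using cN[of "f x"] that fN by (auto simp: \<phi>_def f_inv_into_f inv_into_into)
    have "\<phi> \<in> iso Q Q"
    proof (intro isoI homI)
      fix x y assume xy: "x \<in> carrier Q" "y \<in> carrier Q"
      then have "f (\<phi> (x \<otimes>\<^bsub>Q\<^esub> y)) = f (\<phi> x \<otimes>\<^bsub>Q\<^esub> \<phi> y)"
        using phi h by (simp add: fm G.conj_by_mult)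
      then show "\<phi> (x \<otimes>\<^bsub>Q\<^esub> y) = \<phi> x \<otimes>\<^bsub>Q\<^esub> \<phi> y" using inj_onD[OF f_inj] phi(2) xy by simp
    next
      have "inj_on \<phi> (carrier Q)"
      proof (rule inj_onI)
        fix x y assume xy: "x \<in> carrier Q" "y \<in> carrier Q" "\<phi> x = \<phi> y"
        then have "conj_by G (g h) (f x) = conj_by G (g h) (f y)"
          using phi(1)[OF xy(1)] phi(1)[OF xy(2)] by simp
        then have "f x = f y" using xy h inj_onD[OF G.inj_on_conj_by[of "g h"]] by simp
        then show "x = y" using xy inj_onD[OF f_inj] by simp
      qed
      then show "bij_betw \<phi> (carrier Q) (carrier Q)"
        using endo_inj_surj[OF finQ, of \<phi>] phi(2) by (intro bij_betw_imageI) auto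
    qed (use phi in auto)
    then obtain a where "a \<in> carrier A" "\<And>x. x \<in> carrier Q \<Longrightarrow> act a x = \<phi> x"
      using act_full by blast
    then show ?thesis using phi(1) by (intro bexI[of _ a]) simp_all
  qed
  then obtain \<theta> where th: "\<And>h. h \<in> carrier P \<Longrightarrow> \<theta> h \<in> carrier A"
    and thf: "\<And>h x. h \<in> carrier P \<Longrightarrow> x \<in> carrier Q \<Longrightarrow> f (act (\<theta> h) x) = conj_by G (g h) (f x)"
    by metis
  have hom: "\<theta> \<in> hom P A"
  proof (rule homI)
    fix h k assume hk: "h \<in> carrier P" "k \<in> carrier P"
    show "\<theta> (h \<otimes>\<^bsub>P\<^esub> k) = \<theta> h \<otimes>\<^bsub>A\<^esub> \<theta> k"
    proof (rule act_faithful)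
      fix x assume x: "x \<in> carrier Q"
      then have "f (act (\<theta> (h \<otimes>\<^bsub>P\<^esub> k)) x) = f (act (\<theta> h \<otimes>\<^bsub>A\<^esub> \<theta> k) x)"
        using hk th by (simp add: thf act_mult gm G.conj_by_conj_by)
      then show "act (\<theta> (h \<otimes>\<^bsub>P\<^esub> k)) x = act (\<theta> h \<otimes>\<^bsub>A\<^esub> \<theta> k) x"
        using inj_onD[OF f_inj] x hk th by simp
    qed (use hk th in auto)
  qed (rule th)
  have disj: "x = \<one>\<^bsub>G\<^esub>" if "x \<in> N" "x \<in> H" for x
  proof -
    have "card N = order Q" "card H = order P"
      using fN gH f_inj g_inj by (auto simp: order_def card_image)
    then have "G.ord x dvd order Q" "G.ord x dvd order P"
      using that G.ord_dvd_card_subgroup[OF N.subgroup_axioms] G.ord_dvd_card_subgroup[OF H(1)] by metis+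
    then have "G.ord x = 1" using cop coprime_common_divisor_nat by blast
    then show ?thesis using that N.subset G.ord_eq_1 by auto
  qed
  let ?S = "sdprod Q P act \<theta>"
  define F where "F = (\<lambda>(x, h). f x \<otimes>\<^bsub>G\<^esub> g h)"
  have "F \<in> iso ?S G"
  proof (intro isoI homI)
    fix u v assume "u \<in> carrier ?S" "v \<in> carrier ?S"
    then obtain x h y k where [simp]: "u = (x, h)" "v = (y, k)" "x \<in> carrier Q" "y \<in> carrier Q"
      "h \<in> carrier P" "k \<in> carrier P" by auto
    have "F (u \<otimes>\<^bsub>?S\<^esub> v) = f x \<otimes>\<^bsub>G\<^esub> (conj_by G (g h) (f y) \<otimes>\<^bsub>G\<^esub> g h) \<otimes>\<^bsub>G\<^esub> g k"
      using th by (simp add: F_def fm gm thf G.m_assoc)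
    also have "conj_by G (g h) (f y) \<otimes>\<^bsub>G\<^esub> g h = g h \<otimes>\<^bsub>G\<^esub> f y" by (simp add: conj_by_def G.m_assoc)
    finally show "F (u \<otimes>\<^bsub>?S\<^esub> v) = F u \<otimes>\<^bsub>G\<^esub> F v" by (simp add: F_def G.m_assoc)
  next
    have inj: "inj_on F (carrier ?S)"
    proof (rule inj_onI)
      fix u v assume uv: "u \<in> carrier ?S" "v \<in> carrier ?S" "F u = F v"
      then obtain x h y k where [simp]: "u = (x, h)" "v = (y, k)" "x \<in> carrier Q" "y \<in> carrier Q"
        "h \<in> carrier P" "k \<in> carrier P" by auto
      have eq: "f x \<otimes>\<^bsub>G\<^esub> g h = f y \<otimes>\<^bsub>G\<^esub> g k" using uv by (simp add: F_def)
      then have "inv\<^bsub>G\<^esub> f y \<otimes>\<^bsub>G\<^esub> (f x \<otimes>\<^bsub>G\<^esub> g h) = g k" by (simp add: G.inv_solve_left')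
      then have "inv\<^bsub>G\<^esub> f y \<otimes>\<^bsub>G\<^esub> f x \<otimes>\<^bsub>G\<^esub> g h = g k" by (simp add: G.m_assoc)
      then have "inv\<^bsub>G\<^esub> f y \<otimes>\<^bsub>G\<^esub> f x = g k \<otimes>\<^bsub>G\<^esub> inv\<^bsub>G\<^esub> g h" by (simp add: G.inv_solve_right)
      moreover have "inv\<^bsub>G\<^esub> f y \<otimes>\<^bsub>G\<^esub> f x \<in> N" by simp
      moreover have "g k \<otimes>\<^bsub>G\<^esub> inv\<^bsub>G\<^esub> g h \<in> H" by simp
      ultimately have "inv\<^bsub>G\<^esub> f y \<otimes>\<^bsub>G\<^esub> f x = \<one>\<^bsub>G\<^esub>" "g k \<otimes>\<^bsub>G\<^esub> inv\<^bsub>G\<^esub> g h = \<one>\<^bsub>G\<^esub>" using disj by auto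
      then have "f x = f y" "g k = g h"
        by (metis G.inv_closed G.inv_equality G.inv_inv fc(2) \<open>x \<in> carrier Q\<close> \<open>y \<in> carrier Q\<close>,
            metis G.inv_closed G.inv_equality G.inv_inv gc(2) \<open>h \<in> carrier P\<close> \<open>k \<in> carrier P\<close>)
      then show "u = v" using inj_onD[OF f_inj, of x y] inj_onD[OF g_inj, of k h] by simp
    qed
    moreover have "F ` carrier ?S = carrier G"
      using G inj by (intro card_subset_eq) (auto simp: F_def card_image order_def card_cartesian_product)
    ultimately show "bij_betw F (carrier ?S) (carrier G)" by (simp add: bij_betw_def)
  qed (auto simp: F_def)
  then have "?S \<cong> G" by (rule is_isoI)
  moreover have "group ?S"
  proof -
    have "finite (carrier P)" using H.subset finite_subset[OF _ G(2)] gH g_inj by (metis finite_imageD)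
    then interpret action_hom Q A act P \<theta>
      using P cop hom by unfold_locales
    show ?thesis by (rule sdprod_group)
  qed
  ultimately show ?thesis using hom group.iso_sym by blast
qed

end

section \<open>Groups whose order is the square of a prime\<close>

text \<open>Both groups of order \<open>p\<^sup>2\<close> arise as \<^term>\<open>Zprod (p^2) 1\<close> and \<^term>\<open>Zprod p p\<close>.  Writing the cyclic one
  with a trivial second factor gives the two the same element type, so that all semidirect
  products below can be collected in one set.\<close>

definition Zprod :: "nat \<Rightarrow> nat \<Rightarrow> (int \<times> int) monoid" where
  "Zprod m n = integer_mod_group m \<times>\<times> integer_mod_group n"

lemma carrier_Zprod: "0 < m \<Longrightarrow> 0 < n \<Longrightarrow> carrier (Zprod m n) = {0..<int m} \<times> {0..<int n}"
  by (simp add: Zprod_def carrier_integer_mod_group)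

lemma mult_Zprod [simp]: "(x, y) \<otimes>\<^bsub>Zprod m n\<^esub> (x', y') = ((x + x') mod int m, (y + y') mod int n)"
  by (simp add: Zprod_def)

lemma one_Zprod: "\<one>\<^bsub>Zprod m n\<^esub> = (0, 0)"
  by (simp add: Zprod_def)

lemma comm_group_Zprod: "comm_group (Zprod m n)"
proof -
  interpret A: comm_group "integer_mod_group m" by simp
  interpret B: comm_group "integer_mod_group n" by simp
  interpret C: group "Zprod m n" unfolding Zprod_def by (intro DirProd_group A.is_group B.is_group)
  show ?thesis by (rule C.group_comm_groupI) (auto simp: Zprod_def add.commute)
qed

lemma group_Zprod: "group (Zprod m n)"
  using comm_group_Zprod by (rule comm_group.axioms(2))

lemma finite_Zprod: "0 < m \<Longrightarrow> 0 < n \<Longrightarrow> finite (carrier (Zprod m n))"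
  by (simp add: carrier_Zprod)

lemma order_Zprod: "0 < m \<Longrightarrow> 0 < n \<Longrightarrow> order (Zprod m n) = m * n"
  by (simp add: carrier_Zprod order_def card_cartesian_product)

lemma pow_Zprod: "0 < m \<Longrightarrow> 0 < n \<Longrightarrow> (x, y) [^]\<^bsub>Zprod m n\<^esub> (k::nat) = ((int k * x) mod int m, (int k * y) mod int n)"
  by (induction k) (auto simp: one_Zprod algebra_simps mod_simps)

context group begin

lemma int_pow_mod:
  assumes "a \<in> carrier G" "a [^] m = \<one>"
  shows "a [^] (i mod int m) = a [^] (i::int)"
proof -
  have "int (ord a) dvd int m" using assms pow_eq_id by simp
  also have "int m dvd i - i mod int m" by (simp add: minus_mod_eq_mult_div)
  finally show ?thesis using int_pow_eq[OF assms(1)] by simp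
qed

lemma int_pow_Zprod_hom:
  assumes "a \<in> carrier G" "a [^] m = \<one>"
  shows "(\<lambda>(i, j). a [^] (i::int)) \<in> hom (Zprod m n) G"
  using assms by (auto simp: hom_def int_pow_mod int_pow_mult Zprod_def)

text \<open>The product set of two subgroups that meet trivially has as many elements as their direct product.\<close>

lemma inj_on_subgroup_product:
  assumes H: "subgroup H G" and K: "subgroup K G" and disj: "H \<inter> K \<subseteq> {\<one>}"
  shows "inj_on (\<lambda>(h, k). h \<otimes> k) (H \<times> K)"
proof (rule inj_onI, clarify)
  interpret H: subgroup H G by (rule H)
  interpret K: subgroup K G by (rule K)
  fix h k h' k' assume hk: "h \<in> H" "k \<in> K" "h' \<in> H" "k' \<in> K" and eq: "h \<otimes> k = h' \<otimes> k'"
  have c: "h \<in> carrier G" "k \<in> carrier G" "h' \<in> carrier G" "k' \<in> carrier G"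
    using hk H.subset K.subset by auto
  have "inv h' \<otimes> (h \<otimes> k) = k'" using eq c by (simp add: inv_solve_left')
  then have "inv h' \<otimes> h = k' \<otimes> inv k"
    using c by (simp add: inv_solve_right m_assoc)
  moreover have "inv h' \<otimes> h \<in> H" "k' \<otimes> inv k \<in> K" using hk by auto
  ultimately have 1: "inv h' \<otimes> h = \<one>" "k' \<otimes> inv k = \<one>" using disj by auto
  have "h = h'" using inv_solve_left'[of \<one> h' h] 1(1) c by simp
  moreover have "k = k'" using inv_solve_right'[of \<one> k' k] 1(2) c by simp
  ultimately show "h = h' \<and> k = k'" by simp
qed

lemma subgroups_product:
  assumes fin: "finite (carrier G)" and H: "subgroup H G" and K: "subgroup K G"
    and disj: "H \<inter> K \<subseteq> {\<one>}" and card: "card H * card K = order G" and g: "g \<in> carrier G"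
  shows "\<exists>h\<in>H. \<exists>k\<in>K. g = h \<otimes> k"
proof -
  define F where "F = (\<lambda>(h, k). h \<otimes> k)"
  have "card (F ` (H \<times> K)) = order G"
    using inj_on_subgroup_product[OF H K disj] by (simp add: F_def card_image card_cartesian_product card)
  moreover have "F ` (H \<times> K) \<subseteq> carrier G"
    using subgroup.subset[OF H] subgroup.subset[OF K] by (auto simp: F_def)
  ultimately have "F ` (H \<times> K) = carrier G"
    using fin by (intro card_subset_eq) (auto simp: order_def)
  then have "g \<in> F ` (H \<times> K)" using g by simp
  then show ?thesis unfolding F_def by fast
qed

lemma generate_eq_pows: "a \<in> carrier G \<Longrightarrow> generate G {a} = range (\<lambda>k::int. a [^] k)"
  by (auto simp: generate_pow)

lemma subgroup_generate: "a \<in> carrier G \<Longrightarrow> subgroup (generate G {a}) G"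
  by (simp add: generate_is_subgroup)

lemma generate_subset: "a \<in> carrier G \<Longrightarrow> generate G {a} \<subseteq> carrier G"
  by (simp add: generate_incl)

lemma generate_self: "a \<in> generate G {a}"
  by (simp add: generate.incl)

lemma generate_eq_of_mem:
  assumes "finite (carrier G)" "a \<in> carrier G" "b \<in> generate G {a}" "ord b = ord a"
  shows "generate G {b} = generate G {a}"
proof (rule card_subset_eq)
  have b: "b \<in> carrier G" using assms generate_subset by blast
  show "finite (generate G {a})" using assms generate_subset finite_subset by blast
  show "generate G {b} \<subseteq> generate G {a}"
    using generate_subgroup_incl[OF _ subgroup_generate[OF assms(2)]] assms(3) by simp
  show "card (generate G {b}) = card (generate G {a})"
    using assms b by (simp flip: generate_pow_card)
qed

lemma ord_prime_if_pow:
  assumes "prime p" "x \<in> carrier G" "x [^] p = \<one>" "x \<noteq> \<one>"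
  shows "ord x = p"
proof -
  have "ord x dvd p" using assms pow_eq_id by blast
  moreover have "ord x \<noteq> 1" using assms ord_eq_1 by blast
  ultimately show ?thesis using assms(1) by (auto simp: prime_nat_iff)
qed

text \<open>Cyclic subgroups of prime order meet trivially or coincide.\<close>

lemma generate_Int_trivial:
  fixes p :: nat
  assumes fin: "finite (carrier G)" and p: "prime p" and ab: "a \<in> carrier G" "b \<in> carrier G"
    and pow: "\<And>x. x \<in> generate G {b} \<Longrightarrow> x [^] p = \<one>" and nm: "a \<notin> generate G {b}" and a: "a [^] p = \<one>"
  shows "generate G {a} \<inter> generate G {b} \<subseteq> {\<one>}"
proof (rule ccontr)
  assume "\<not> ?thesis"
  then obtain x where x: "x \<in> generate G {a}" "x \<in> generate G {b}" "x \<noteq> \<one>" by blast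
  have xc: "x \<in> carrier G" using x ab generate_subset by blast
  have "a \<noteq> \<one>" using nm subgroup.one_closed[OF subgroup_generate[OF ab(2)]] by blast
  then have "ord x = ord a" using ord_prime_if_pow[OF p xc pow[OF x(2)] x(3)] ord_prime_if_pow[OF p ab(1) a] by simp
  then have "generate G {x} = generate G {a}" using generate_eq_of_mem fin ab x by blast
  moreover have "generate G {x} \<subseteq> generate G {b}"
    using generate_subgroup_incl[OF _ subgroup_generate[OF ab(2)]] x by simp
  ultimately show False using nm generate_self by blast
qed

lemma conj_cancel:
  assumes "b = b \<otimes> u \<otimes> inv b \<otimes> v" and c: "b \<in> carrier G" "u \<in> carrier G" "v \<in> carrier G"
  shows "b = v \<otimes> u"
proof -
  have "b \<otimes> \<one> = b \<otimes> (u \<otimes> (inv b \<otimes> v))"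
    using assms by (simp add: m_assoc)
  then have "u \<otimes> (inv b \<otimes> v) = \<one>" using c by (simp del: r_one)
  then have "inv b \<otimes> v = inv u"
    using c inv_solve_left[of "inv b \<otimes> v" u \<one>] by simp
  then have "v = b \<otimes> inv u" using c inv_solve_left'[of "inv u" b v] by simp
  then show ?thesis using c inv_solve_right[of v b u] by simp
qed

text \<open>A subgroup \<open>H\<close> and a conjugate \<open>b\<^sup>-\<^sup>1 H b\<close> never multiply to the whole group unless
  \<open>b \<in> H\<close>; so in a group of order \<open>p\<^sup>2\<close> every subgroup of order \<open>p\<close> is normal, and
  two of them commute.\<close>

lemma order_p2_conj_in_generate:
  fixes p :: nat
  assumes fin: "finite (carrier G)" and p: "prime p" and ord: "order G = p^2"
    and exp: "\<And>x. x \<in> carrier G \<Longrightarrow> x [^] p = \<one>"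
    and ab: "a \<in> carrier G" "b \<in> carrier G" and nm: "b \<notin> generate G {a}"
  shows "conj_by G b a \<in> generate G {a}"
proof (rule ccontr)
  assume neg: "conj_by G b a \<notin> generate G {a}"
  define c where "c = conj_by G b a"
  have c: "c \<in> carrier G" using ab by (simp add: c_def)
  have one_mem: "\<one> \<in> generate G {a}" using subgroup.one_closed[OF subgroup_generate[OF ab(1)]] .
  have "a \<noteq> \<one>" using neg one_mem ab by (auto simp: conj_by_def)
  moreover have "c \<noteq> \<one>" using neg one_mem c_def by auto
  ultimately have "ord a = p" "ord c = p" using ord_prime_if_pow p exp ab c by auto
  then have cards: "card (generate G {a}) = p" "card (generate G {c}) = p"
    using generate_pow_card ab c by auto
  have triv: "generate G {c} \<inter> generate G {a} \<subseteq> {\<one>}"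
    using generate_Int_trivial[OF fin p c ab(1)] exp generate_subset[OF ab(1)] neg c unfolding c_def by blast
  have "\<exists>h\<in>generate G {c}. \<exists>k\<in>generate G {a}. b = h \<otimes> k"
    using subgroups_product[OF fin subgroup_generate[OF c] subgroup_generate[OF ab(1)] triv _ ab(2)] cards ord
    by (simp add: power2_eq_square)
  then obtain i j :: int where ij: "b = c [^] i \<otimes> a [^] j"
    using generate_eq_pows ab c by auto
  have "c [^] i = conj_by G b (a [^] i)"
  proof -
    interpret h: group_hom G G "conj_by G b"
      using conj_by_iso[OF ab(2)] by unfold_locales (auto simp: iso_def)
    show ?thesis using ab by (simp add: c_def h.hom_int_pow)
  qed
  then have "b = b \<otimes> a [^] i \<otimes> inv b \<otimes> a [^] j"
    using ij by (simp only: conj_by_def)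
  then have "b = a [^] j \<otimes> a [^] i" by (rule conj_cancel) (use ab in auto)
  then have "b = a [^] (j + i)" using ab by (simp add: int_pow_mult)
  then show False using nm ab generate_eq_pows by auto
qed

text \<open>If neither of \<open>a\<close> and \<open>b\<close> lies in the subgroup generated by the other, the two subgroups normalise
  each other, so their commutator lies in the trivial intersection.\<close>

lemma order_p2_exponent_p_comm:
  fixes p :: nat
  assumes fin: "finite (carrier G)" and p: "prime p" and ord: "order G = p^2"
    and exp: "\<And>x. x \<in> carrier G \<Longrightarrow> x [^] p = \<one>"
  shows "comm_group G"
proof (rule group_comm_groupI)
  fix a b assume ab: "a \<in> carrier G" "b \<in> carrier G"
  have comm_gen: "a \<otimes> b = b \<otimes> a" if h: "a \<in> carrier G" "b \<in> generate G {a}" for a b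
  proof -
    obtain i :: int where i: "b = a [^] i" using h(2) generate_eq_pows[OF h(1)] by auto
    have "a [^] (1::int) \<otimes> a [^] i = a [^] i \<otimes> a [^] (1::int)"
      using h(1) by (simp only: int_pow_mult[symmetric] add.commute)
    then show ?thesis using i h(1) by simp
  qed
  show "a \<otimes> b = b \<otimes> a"
  proof (cases "b \<in> generate G {a} \<or> a \<in> generate G {b}")
    case True then show ?thesis using comm_gen ab by metis
  next
    case False
    have A: "conj_by G b a \<in> generate G {a}" using order_p2_conj_in_generate[OF fin p ord exp ab] False by blast
    have B: "conj_by G a b \<in> generate G {b}" using order_p2_conj_in_generate[OF fin p ord exp ab(2,1)] False by blast
    interpret SA: subgroup "generate G {a}" G using ab by (rule_tac subgroup_generate)
    interpret SB: subgroup "generate G {b}" G using ab by (rule_tac subgroup_generate)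
    have "b \<otimes> a \<otimes> inv b \<otimes> inv a \<in> generate G {a}"
      using A SA.m_inv_closed[OF generate_self] unfolding conj_by_def by (rule SA.m_closed)
    moreover have "b \<otimes> a \<otimes> inv b \<otimes> inv a \<in> generate G {b}"
    proof -
      have "b \<otimes> inv (conj_by G a b) \<in> generate G {b}"
        using SB.m_closed[OF generate_self SB.m_inv_closed[OF B]] .
      moreover have "b \<otimes> inv (conj_by G a b) = b \<otimes> a \<otimes> inv b \<otimes> inv a"
        using ab by (simp add: conj_by_def inv_mult_group m_assoc)
      ultimately show ?thesis by simp
    qed
    moreover have "generate G {a} \<inter> generate G {b} \<subseteq> {\<one>}"
      using generate_Int_trivial[OF fin p ab] exp generate_subset ab False by blast
    ultimately have "b \<otimes> a \<otimes> inv b \<otimes> inv a = \<one>" by blast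
    then have "b \<otimes> a \<otimes> inv b = a" using ab inv_solve_right'[of \<one> "b \<otimes> a \<otimes> inv b" a] by simp
    then have "b \<otimes> a = a \<otimes> b" using ab inv_solve_right'[of a "b \<otimes> a" b] by simp
    then show ?thesis by simp
  qed
qed

end

text \<open>Equal orders make injectivity automatic: it suffices that \<open>a\<close> and \<open>b\<close> generate.\<close>

lemma (in comm_group) basis_iso:
  assumes fin: "finite (carrier G)" and ord: "order G = m * n" and mn: "0 < m" "0 < n"
    and ab: "a \<in> carrier G" "b \<in> carrier G" "a [^] m = \<one>" "b [^] n = \<one>"
    and gen: "\<And>x. x \<in> carrier G \<Longrightarrow> \<exists>(i::int) (j::int). x = a [^] i \<otimes> b [^] j"
  shows "(\<lambda>(i, j). a [^] (i::int) \<otimes> b [^] (j::int)) \<in> iso (Zprod m n) G" (is "?F \<in> _")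
proof (intro isoI)
  show "?F \<in> hom (Zprod m n) G"
    using ab by (auto simp: hom_def int_pow_mod int_pow_mult m_ac Zprod_def)
  have sub: "carrier G \<subseteq> ?F ` carrier (Zprod m n)"
  proof
    fix x assume "x \<in> carrier G"
    then obtain i j :: int where ij: "x = a [^] i \<otimes> b [^] j" using gen by blast
    have "x = ?F (i mod int m, j mod int n)"
      unfolding ij using int_pow_mod[OF ab(1,3)] int_pow_mod[OF ab(2,4)] by simp
    then show "x \<in> ?F ` carrier (Zprod m n)"
      by (rule image_eqI) (use mn in \<open>simp add: carrier_Zprod\<close>)
  qed
  moreover have "?F ` carrier (Zprod m n) \<subseteq> carrier G" using ab by auto
  ultimately have im: "?F ` carrier (Zprod m n) = carrier G" by blast
  moreover have "inj_on ?F (carrier (Zprod m n))"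
    using im ord mn by (intro eq_card_imp_inj_on finite_Zprod) (auto simp: order_def[symmetric] order_Zprod)
  ultimately show "bij_betw ?F (carrier (Zprod m n)) (carrier G)" by (simp add: bij_betw_def)
qed

locale elementary_p2 = comm_group G for G (structure) +
  fixes p :: nat
  assumes p: "prime p" and fin: "finite (carrier G)" and ord: "order G = p^2"
    and exponent: "x \<in> carrier G \<Longrightarrow> x [^] p = \<one>"
begin

lemma ord_eq: "x \<in> carrier G \<Longrightarrow> x \<noteq> \<one> \<Longrightarrow> group.ord G x = p"
  using ord_prime_if_pow p exponent by blast

lemma independent_iso:
  assumes ab: "a \<in> carrier G" "b \<in> carrier G" and "a \<noteq> \<one>" "b \<notin> generate G {a}"
  shows "(\<lambda>(i, j). a [^] (i::int) \<otimes> b [^] (j::int)) \<in> iso (Zprod p p) G"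
proof (rule basis_iso)
  fix x assume x: "x \<in> carrier G"
  have b1: "b \<noteq> \<one>" using assms subgroup.one_closed[OF subgroup_generate[OF ab(1)]] by blast
  have "generate G {b} \<inter> generate G {a} \<subseteq> {\<one>}"
    using generate_Int_trivial[OF fin p ab(2,1)] exponent generate_subset[OF ab(1)] assms by blast
  then have "\<exists>h\<in>generate G {a}. \<exists>k\<in>generate G {b}. x = h \<otimes> k"
    using assms b1 x ord ord_eq
    by (intro subgroups_product[OF fin subgroup_generate subgroup_generate])
       (auto simp: power2_eq_square simp flip: generate_pow_card)
  then show "\<exists>(i::int) (j::int). x = a [^] i \<otimes> b [^] j" using generate_eq_pows ab by auto
qed (use ab exponent ord fin prime_gt_0_nat[OF p] in \<open>auto simp: power2_eq_square\<close>)

lemma exists_not_generated: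
  assumes "a \<in> carrier G"
  shows "\<exists>b\<in>carrier G. b \<notin> generate G {a}"
proof (rule ccontr)
  assume "\<not> ?thesis"
  then have "generate G {a} = carrier G" using generate_subset[OF assms] by blast
  then have "group.ord G a = p^2" using generate_pow_card[OF assms] ord by (simp add: order_def)
  moreover have "group.ord G a dvd p" using exponent[OF assms] pow_eq_id[OF assms] by simp
  ultimately have "p^2 \<le> p" using p by (auto dest: dvd_imp_le simp: prime_gt_0_nat)
  then show False using prime_gt_1_nat[OF p] by (simp add: power2_eq_square)
qed

text \<open>It suffices to map a basis on which \<open>g\<close> takes certain values to a basis on which \<open>f\<close> takes the same
  values.  If \<open>f\<close> and \<open>g\<close> are injective, any basis can be lifted in this way; if they are neither
  injective nor trivial, each basis consists of an element of the kernel and an element outside.\<close>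

lemma image_determined_elementary:
  assumes A: "group (A :: 'g monoid)"
  shows "image_determined G A"
  unfolding image_determined_def
proof (intro ballI impI)
  fix f g assume f: "f \<in> hom G A" and g: "g \<in> hom G A" and im: "f ` carrier G = g ` carrier G"
  interpret A: group A by (rule A)
  interpret f: group_hom G A f using f by unfold_locales
  interpret g: group_hom G A g using g by unfold_locales
  have main: "\<exists>\<beta>\<in>iso G G. \<forall>x\<in>carrier G. f (\<beta> x) = g x"
    if ab: "a \<in> carrier G" "b \<in> carrier G" "a \<noteq> \<one>" "b \<notin> generate G {a}"
      and cd: "c \<in> carrier G" "d \<in> carrier G" "c \<noteq> \<one>" "d \<notin> generate G {c}"
      and eq: "f a = g c" "f b = g d" for a b c d
  proof -
    let ?F = "\<lambda>(i, j). a [^] (i::int) \<otimes> b [^] (j::int)"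
    let ?H = "\<lambda>(i, j). c [^] (i::int) \<otimes> d [^] (j::int)"
    have F: "?F \<in> iso (Zprod p p) G" and H: "?H \<in> iso (Zprod p p) G"
      using independent_iso ab cd by auto
    interpret Z: comm_group "Zprod p p" by (rule comm_group_Zprod)
    define K where "K = inv_into (carrier (Zprod p p)) ?H"
    have K: "K \<in> iso G (Zprod p p)" using Z.iso_set_sym[OF H] by (simp add: K_def)
    have HK: "?H (K x) = x" if "x \<in> carrier G" for x
      using H that by (auto simp: K_def iso_def bij_betw_def f_inv_into_f)
    show ?thesis
    proof (intro bexI ballI)
      show "?F \<circ> K \<in> iso G G" using iso_set_trans[OF K F] by simp
      fix x assume x: "x \<in> carrier G"
      obtain i j where ij: "K x = (i, j)" by fastforce
      have "g x = g (c [^] i \<otimes> d [^] j)" using HK[OF x] ij by simp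
      also have "\<dots> = f (a [^] i \<otimes> b [^] j)"
        using ab cd eq by (simp add: f.hom_int_pow g.hom_int_pow)
      finally show "f ((?F \<circ> K) x) = g x" using ij by simp
    qed
  qed
  show "\<exists>\<beta>\<in>iso G G. \<forall>x\<in>carrier G. f (\<beta> x) = g x"
  proof (cases "f ` carrier G = {\<one>\<^bsub>A\<^esub>}")
    case True
    then have "f x = g x" if "x \<in> carrier G" for x using im that by (metis imageI singletonD)
    then show ?thesis by (intro bexI[OF _ iso_set_refl]) simp
  next
    case False
    note nontriv = False
    show ?thesis
    proof (cases "inj_on f (carrier G)")
      case True
      then have gi: "inj_on g (carrier G)"
        using card_image[OF True] im by (intro eq_card_imp_inj_on fin) simp
      obtain c where c: "c \<in> carrier G" "c \<noteq> \<one>" using exists_not_generated[OF one_closed] generate_one by auto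
      obtain d where d: "d \<in> carrier G" "d \<notin> generate G {c}" using exists_not_generated[OF c(1)] by blast
      obtain a where a: "a \<in> carrier G" "f a = g c" using im c by (metis imageE imageI)
      obtain b where b: "b \<in> carrier G" "f b = g d" using im d by (metis imageE imageI)
      have a1: "a \<noteq> \<one>" using a c gi by (metis f.hom_one g.hom_one inj_onD one_closed)
      have "b \<notin> generate G {a}"
      proof
        assume "b \<in> generate G {a}"
        then obtain i :: int where "b = a [^] i" using a generate_eq_pows by auto
        then have "g d = g (c [^] i)" using a b c by (metis f.hom_int_pow g.hom_int_pow)
        then have "d = c [^] i" using gi c d by (metis inj_onD int_pow_closed)
        then show False using d c generate_eq_pows by auto
      qed
      then show ?thesis using main[of a b c d] a b c d a1 by simp
    next
      case False
      then have gi: "\<not> inj_on g (carrier G)"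
        using card_image[of g "carrier G"] im eq_card_imp_inj_on[OF fin, of f] by auto
      obtain a where a: "a \<in> carrier G" "a \<noteq> \<one>" "f a = \<one>\<^bsub>A\<^esub>" using False f.inj_on_one_iff by blast
      obtain c where c: "c \<in> carrier G" "c \<noteq> \<one>" "g c = \<one>\<^bsub>A\<^esub>" using gi g.inj_on_one_iff by blast
      obtain b where b: "b \<in> carrier G" "f b \<noteq> \<one>\<^bsub>A\<^esub>" using nontriv f.hom_one by force
      obtain d where d: "d \<in> carrier G" "g d = f b" using im b by (metis imageE imageI)
      have "b \<notin> generate G {a}" using a b generate_eq_pows f.hom_int_pow by auto
      moreover have "d \<notin> generate G {c}" using c d b generate_eq_pows g.hom_int_pow by auto
      ultimately show ?thesis using main[of a b c d] a b c d by simp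
    qed
  qed
qed

end

lemma (in comm_group) pow_coprime_iso:
  assumes fin: "finite (carrier G)" and k: "coprime k (order G)"
  shows "(\<lambda>z. z [^] (k::nat)) \<in> iso G G"
proof (rule isoI)
  show hom: "(\<lambda>z. z [^] k) \<in> hom G G" by (auto simp: hom_def pow_mult_distrib m_comm)
  have "inj_on (\<lambda>z. z [^] k) (carrier G)"
  proof (rule inj_on_one_iff'[OF hom is_group is_group, THEN iffD2], intro allI impI)
    fix x assume x: "x \<in> carrier G" "x [^] k = \<one>"
    then have "ord x dvd k" "ord x dvd order G" using pow_eq_id ord_dvd_group_order by auto
    then have "ord x = 1" using k coprime_common_divisor_nat by blast
    then show "x = \<one>" using x ord_eq_1 by blast
  qed
  moreover from this have "(\<lambda>z. z [^] k) ` carrier G = carrier G" by (intro endo_inj_surj fin) auto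
  ultimately show "bij_betw (\<lambda>z. z [^] k) (carrier G) (carrier G)" by (simp add: bij_betw_def)
qed

text \<open>Write \<open>g x = f (x\<^sup>k)\<close> for a generator \<open>x\<close>.  If \<open>k\<close> is prime to \<open>p\<close>, the \<open>k\<close>-th power map is the required
  automorphism; if \<open>p\<close> divides \<open>k\<close>, then \<open>f\<close> is trivial and so is \<open>g\<close>.\<close>

lemma (in comm_group) image_determined_cyclic:
  assumes fin: "finite (carrier G)" and p: "prime p" and ord: "order G = p ^ n"
    and x: "x \<in> carrier G" "\<And>y. y \<in> carrier G \<Longrightarrow> \<exists>k::nat. y = x [^] k"
    and A: "group (A :: 'g monoid)"
  shows "image_determined G A"
  unfolding image_determined_def
proof (intro ballI impI)
  fix f g assume f: "f \<in> hom G A" and g: "g \<in> hom G A" and im: "f ` carrier G = g ` carrier G"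
  interpret A: group A by (rule A)
  interpret f: group_hom G A f using f by unfold_locales
  interpret g: group_hom G A g using g by unfold_locales
  have "g x \<in> f ` carrier G" using im x by blast
  then obtain k :: nat where k: "g x = f (x [^] k)" using x(2) by auto
  have gk: "g y = f (y [^] k)" if "y \<in> carrier G" for y
  proof -
    obtain i :: nat where "y = x [^] i" using x(2) \<open>y \<in> carrier G\<close> by blast
    then show ?thesis using x(1) k by (simp add: f.hom_nat_pow g.hom_nat_pow A.nat_pow_pow mult.commute nat_pow_pow)
  qed
  show "\<exists>\<beta>\<in>iso G G. \<forall>x\<in>carrier G. f (\<beta> x) = g x"
  proof (cases "p dvd k")
    case False
    then have "coprime p k" using p by (rule prime_imp_coprime[rotated])
    then have "coprime k (order G)" by (simp add: ord coprime_commute)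
    then show ?thesis using pow_coprime_iso[OF fin] gk by (intro bexI[of _ "\<lambda>z. z [^] k"]) auto
  next
    case True
    have "f x \<in> g ` carrier G" using im x by blast
    then obtain i :: nat where i: "f x = g (x [^] i)" using x(2) by auto
    have e: "f x [^]\<^bsub>A\<^esub> (i * k) = f x" using gk[of "x [^] i"] x(1) i by (simp add: f.hom_nat_pow nat_pow_pow)
    have fx: "f x \<in> carrier A" using x(1) by simp
    (* f x is its own (i * k)-th power; iterating, a power of p annihilates it. *)
    have iter: "f x [^]\<^bsub>A\<^esub> ((i * k) ^ m) = f x" for m :: nat
    proof (induction m)
      case (Suc m)
      have "f x [^]\<^bsub>A\<^esub> ((i * k) ^ Suc m) = (f x [^]\<^bsub>A\<^esub> (i * k)) [^]\<^bsub>A\<^esub> ((i * k) ^ m)"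
        using fx by (simp only: A.nat_pow_pow power_Suc)
      then show ?case by (simp only: e Suc.IH)
    qed (use fx in simp)
    have "f x [^]\<^bsub>A\<^esub> (p ^ n) = \<one>\<^bsub>A\<^esub>"
      using x(1) pow_order_eq_1[OF x(1)] ord f.hom_nat_pow[OF x(1), of "p^n"] by simp
    then have "A.ord (f x) dvd p ^ n" using A.pow_eq_id fx by blast
    also have "p ^ n dvd (i * k) ^ n" using True by (intro dvd_power_same dvd_mult)
    finally have fx1: "f x = \<one>\<^bsub>A\<^esub>" using A.pow_eq_id[OF fx, of "(i * k) ^ n"] iter[of n] by simp
    have "f y = \<one>\<^bsub>A\<^esub>" if "y \<in> carrier G" for y
      using x(2)[OF that] x(1) fx1 by (auto simp: f.hom_nat_pow)
    then show ?thesis using gk by (intro bexI[OF _ iso_set_refl]) auto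
  qed
qed

lemma (in group) order_p2_cases:
  assumes fin: "finite (carrier G)" and p: "prime p" and ord: "order G = p^2"
  shows "G \<cong> Zprod (p^2) 1 \<or> G \<cong> Zprod p p"
proof (cases "\<exists>x\<in>carrier G. ord x = p^2")
  case True
  then obtain x where x: "x \<in> carrier G" "group.ord G x = p^2" by blast
  have full: "generate G {x} = carrier G"
    using x fin generate_subset[OF x(1)] ord generate_pow_card[OF x(1)]
    by (intro card_subset_eq) (auto simp: order_def)
  have pw: "\<exists>i::int. y = x [^] i" if "y \<in> carrier G" for y
    using that full generate_eq_pows[OF x(1)] by auto
  interpret comm_group G
  proof (rule group_comm_groupI)
    fix a b assume "a \<in> carrier G" "b \<in> carrier G"
    then obtain i j :: int where "a = x [^] i" "b = x [^] j" using pw by meson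
    then show "a \<otimes> b = b \<otimes> a" using x(1) by (simp add: add.commute flip: int_pow_mult)
  qed
  have "(\<lambda>(i, j). x [^] (i::int) \<otimes> \<one> [^] (j::int)) \<in> iso (Zprod (p^2) 1) G"
  proof (rule basis_iso)
    fix y assume "y \<in> carrier G"
    then obtain i :: int where "y = x [^] i" using pw by blast
    then have "y = x [^] i \<otimes> \<one> [^] (0::int)" using x by simp
    then show "\<exists>(i::int) (j::int). y = x [^] i \<otimes> \<one> [^] j" by blast
  next
    show "x [^] (p^2) = \<one>" using pow_ord_eq_1[OF x(1)] x(2) by simp
  qed (use x fin ord p in \<open>auto simp: prime_gt_0_nat\<close>)
  then have "G \<cong> Zprod (p^2) 1" by (intro group.iso_sym[OF group_Zprod] is_isoI)
  then show ?thesis ..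
next
  case False
  have exp: "x [^] p = \<one>" if x: "x \<in> carrier G" for x
  proof -
    have "group.ord G x dvd p^2" using ord_dvd_group_order[OF x] ord by simp
    then obtain i where i: "i \<le> 2" "group.ord G x = p^i" using p by (auto simp: divides_primepow_nat)
    then have "i = 0 \<or> i = 1" using False x by (cases "i = 2") auto
    then have "group.ord G x dvd p" using i by auto
    then show ?thesis using pow_eq_id x by blast
  qed
  interpret elementary_p2 G p
    using order_p2_exponent_p_comm[OF fin p ord exp] fin p ord exp
    by (intro elementary_p2.intro elementary_p2_axioms.intro)
  obtain a where a: "a \<in> carrier G" "a \<noteq> \<one>" using exists_not_generated[OF one_closed] generate_one by auto
  obtain b where b: "b \<in> carrier G" "b \<notin> generate G {a}" using exists_not_generated[OF a(1)] by blast
  have "G \<cong> Zprod p p"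
    by (intro group.iso_sym[OF group_Zprod] is_isoI) (rule independent_iso[OF a(1) b(1) a(2) b(2)])
  then show ?thesis ..
qed

lemma elementary_Zprod: "prime p \<Longrightarrow> elementary_p2 (Zprod p p) p"
  by (intro elementary_p2.intro elementary_p2_axioms.intro comm_group_Zprod finite_Zprod)
     (auto simp: prime_gt_0_nat one_Zprod order_Zprod power2_eq_square pow_Zprod carrier_Zprod)

lemma Zprod_gen:
  assumes "0 < m" "x \<in> carrier (Zprod m 1)"
  shows "x = (1, 0) [^]\<^bsub>Zprod m 1\<^esub> nat (fst x)"
proof -
  obtain k where "x = (int k, 0)" "int k < int m"
  proof (rule that[of "nat (fst x)"])
    show "x = (int (nat (fst x)), 0)" "int (nat (fst x)) < int m"
      using assms by (cases x; simp add: carrier_Zprod)+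
  qed
  then show ?thesis using assms(1) by (simp add: pow_Zprod)
qed

lemma Zprod_1_mem: "m \<ge> 2 \<Longrightarrow> (1, 0) \<in> carrier (Zprod m 1)"
  by (simp add: carrier_Zprod)

lemma Zprod_not_iso:
  assumes "prime p" shows "\<not> Zprod (p^2) 1 \<cong> Zprod p p"
proof
  interpret A: comm_group "Zprod (p^2) 1" by (rule comm_group_Zprod)
  interpret B: comm_group "Zprod p p" by (rule comm_group_Zprod)
  interpret E: elementary_p2 "Zprod p p" p by (rule elementary_Zprod[OF assms])
  have p: "p > 1" using prime_gt_1_nat[OF assms] .
  assume "Zprod (p^2) 1 \<cong> Zprod p p"
  then obtain f where f: "f \<in> iso (Zprod (p^2) 1) (Zprod p p)" by (auto simp: is_iso_def)
  interpret f: group_hom "Zprod (p^2) 1" "Zprod p p" f using f by unfold_locales (auto simp: iso_def)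
  have inj: "inj_on f (carrier (Zprod (p^2) 1))" using f by (auto simp: iso_def bij_betw_def)
  have x: "(1, 0) \<in> carrier (Zprod (p^2) 1)" using p by (simp add: carrier_Zprod)
  have "f ((1, 0) [^]\<^bsub>Zprod (p^2) 1\<^esub> p) = \<one>\<^bsub>Zprod p p\<^esub>"
    using x E.exponent by (simp only: f.hom_nat_pow f.hom_closed)
  then have "f ((1, 0) [^]\<^bsub>Zprod (p^2) 1\<^esub> p) = f \<one>\<^bsub>Zprod (p^2) 1\<^esub>" by (simp only: f.hom_one)
  then have "(1, 0) [^]\<^bsub>Zprod (p^2) 1\<^esub> p = \<one>\<^bsub>Zprod (p^2) 1\<^esub>"
    by (rule inj_onD[OF inj _ A.nat_pow_closed[OF x] A.one_closed])
  then have "int (p mod p^2) = 0" using p by (simp add: pow_Zprod one_Zprod zmod_int)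
  moreover have "p < p^2" using p by (simp add: power2_eq_square)
  ultimately show False using p by simp
qed

section \<open>Images of homomorphisms\<close>

definition cyclic_subs :: "('g, 'x) monoid_scheme \<Rightarrow> nat \<Rightarrow> 'g set set" where
  "cyclic_subs A m = {generate A {a} | a. a \<in> carrier A \<and> group.ord A a = m}"

definition elementary_subs :: "('g, 'x) monoid_scheme \<Rightarrow> nat \<Rightarrow> 'g set set" where
  "elementary_subs A p = {S. subgroup S A \<and> card S = p^2 \<and> (\<forall>x\<in>S. x [^]\<^bsub>A\<^esub> p = \<one>\<^bsub>A\<^esub>)}"

lemma (in group_hom) hom_generate_kernel:
  assumes a: "a \<in> carrier G" "h a = \<one>\<^bsub>H\<^esub>" and b: "b \<in> generate G {a}"
  shows "h b = \<one>\<^bsub>H\<^esub>"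
proof -
  obtain i :: int where "b = a [^]\<^bsub>G\<^esub> i" using G.generate_eq_pows[OF a(1)] b by auto
  then show ?thesis using a by (simp add: hom_int_pow)
qed

context group begin

lemma int_pow_image_Zprod:
  assumes "a \<in> carrier G" "a [^] m = \<one>" "0 < m" "0 < n"
  shows "(\<lambda>(i, j). a [^] (i::int)) ` carrier (Zprod m n) = generate G {a}"
proof (intro equalityI subsetI)
  fix y assume "y \<in> generate G {a}"
  then obtain i :: int where "y = a [^] i" using generate_eq_pows assms(1) by auto
  then have "y = (\<lambda>(i, j). a [^] (i::int)) (i mod int m, 0)" using int_pow_mod assms(1,2) by simp
  then show "y \<in> (\<lambda>(i, j). a [^] (i::int)) ` carrier (Zprod m n)"
    by (rule image_eqI) (use assms in \<open>simp add: carrier_Zprod\<close>)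
qed (use generate_eq_pows[OF assms(1)] in auto)

lemma p_power_ord_cases:
  assumes "prime p" "a \<in> carrier G" "a [^] (p^2) = \<one>"
  shows "ord a \<in> {1, p, p^2}"
proof -
  have "ord a dvd p^2" using assms pow_eq_id by blast
  then obtain i where "i \<le> 2" "ord a = p^i" using assms(1) by (auto simp: divides_primepow_nat)
  moreover from this have "i = 0 \<or> i = 1 \<or> i = 2" by auto
  ultimately show ?thesis by auto
qed

text \<open>A homomorphism from a cyclic group is the choice of an image \<open>a\<close> of the generator, of order
  dividing \<open>p\<^sup>2\<close>.\<close>

lemma hom_images_cyclic:
  assumes p: "prime p"
  shows "(\<lambda>\<theta>. \<theta> ` carrier (Zprod (p^2) 1)) ` hom (Zprod (p^2) 1) G
    = cyclic_subs (G) 1 \<union> cyclic_subs G p \<union> cyclic_subs G (p^2)"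
proof (intro equalityI subsetI)
  let ?Z = "Zprod (p^2) 1"
  interpret Z: comm_group ?Z by (rule comm_group_Zprod)
  have p2: "p^2 \<ge> 2" using prime_ge_2_nat[OF p] self_le_power[of p 2] by simp
  fix S assume "S \<in> (\<lambda>\<theta>. \<theta> ` carrier ?Z) ` hom ?Z G"
  then obtain \<theta> where th: "\<theta> \<in> hom ?Z G" "S = \<theta> ` carrier ?Z" by blast
  interpret t: group_hom ?Z G \<theta> using th by unfold_locales
  have x: "(1, 0) \<in> carrier ?Z" using Zprod_1_mem p2 .
  define a where "a = \<theta> (1, 0)"
  have a: "a \<in> carrier G" using x by (simp add: a_def)
  have "a [^] (p^2) = \<theta> ((1, 0) [^]\<^bsub>?Z\<^esub> (p^2))" by (simp only: t.hom_nat_pow[OF x] a_def)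
  also have "(1, 0) [^]\<^bsub>?Z\<^esub> (p^2) = \<one>\<^bsub>?Z\<^esub>"
    using prime_gt_0_nat[OF p] by (simp add: pow_Zprod one_Zprod)
  finally have a1: "a [^] (p^2) = \<one>" by (simp only: t.hom_one)
  have "S = (\<lambda>(i, j). a [^] (i::int)) ` carrier ?Z"
    unfolding th(2)
  proof (rule image_cong[OF refl])
    fix z assume z: "z \<in> carrier ?Z"
    then have "z = (1, 0) [^]\<^bsub>?Z\<^esub> nat (fst z)" using Zprod_gen[of "p^2" z] prime_gt_0_nat[OF p] by simp
    then have "\<theta> z = a [^] nat (fst z)" unfolding a_def using t.hom_nat_pow[OF x] by metis
    then show "\<theta> z = (case z of (i, j) \<Rightarrow> a [^] i)"
    proof -
      have "0 \<le> fst z" using z carrier_Zprod[of "p^2" 1] prime_gt_0_nat[OF p] by auto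
      then have "a [^] fst z = a [^] nat (fst z)" using int_pow_int[of G a "nat (fst z)"] by simp
      then show ?thesis using \<open>\<theta> z = a [^] nat (fst z)\<close> by (simp add: case_prod_beta)
    qed
  qed
  then have "S = generate G {a}" using int_pow_image_Zprod[OF a a1] prime_gt_0_nat[OF p] by simp
  then show "S \<in> cyclic_subs G 1 \<union> cyclic_subs G p \<union> cyclic_subs G (p^2)"
    using p_power_ord_cases[OF p a a1] a unfolding cyclic_subs_def by blast
next
  fix S assume "S \<in> cyclic_subs G 1 \<union> cyclic_subs G p \<union> cyclic_subs G (p^2)"
  then obtain a where a: "S = generate G {a}" "a \<in> carrier G" "ord a \<in> {1, p, p^2}"
    unfolding cyclic_subs_def by blast
  have "ord a dvd p^2" using a(3) by auto
  then have "a [^] (p^2) = \<one>" using pow_eq_id[OF a(2)] by simp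
  then have "(\<lambda>(i, j). a [^] (i::int)) \<in> hom (Zprod (p^2) 1) G"
    "S = (\<lambda>(i, j). a [^] (i::int)) ` carrier (Zprod (p^2) 1)"
    using int_pow_Zprod_hom[of a "p^2" 1] int_pow_image_Zprod[of a "p^2" 1] a(1,2) prime_gt_0_nat[OF p] by simp_all
  then show "S \<in> (\<lambda>\<theta>. \<theta> ` carrier (Zprod (p^2) 1)) ` hom (Zprod (p^2) 1) G" by blast
qed

text \<open>An injective homomorphism has an elementary abelian image of order \<open>p\<^sup>2\<close>.  A homomorphism with a
  non-trivial kernel has a cyclic image, because an element of the kernel is part of a basis.\<close>

lemma hom_images_elementary:
  assumes p: "prime p"
  shows "(\<lambda>\<theta>. \<theta> ` carrier (Zprod p p)) ` hom (Zprod p p) G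
    = cyclic_subs (G) 1 \<union> cyclic_subs G p \<union> elementary_subs G p"
proof (intro equalityI subsetI)
  let ?Z = "Zprod p p"
  interpret Z: elementary_p2 ?Z p by (rule elementary_Zprod[OF p])
  fix S assume "S \<in> (\<lambda>\<theta>. \<theta> ` carrier ?Z) ` hom ?Z G"
  then obtain \<theta> where th: "\<theta> \<in> hom ?Z G" "S = \<theta> ` carrier ?Z" by blast
  interpret t: group_hom ?Z G \<theta> using th by unfold_locales
  have exp: "x [^] p = \<one>" if xS: "x \<in> S" for x
  proof -
    obtain z where z: "z \<in> carrier ?Z" "x = \<theta> z" using xS unfolding th(2) by blast
    have "x [^] p = \<theta> (z [^]\<^bsub>?Z\<^esub> p)" unfolding z(2) by (rule t.hom_nat_pow[OF z(1), symmetric])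
    also have "\<dots> = \<theta> \<one>\<^bsub>?Z\<^esub>" unfolding Z.exponent[OF z(1)] ..
    also have "\<dots> = \<one>" by (rule t.hom_one)
    finally show ?thesis .
  qed
  show "S \<in> cyclic_subs G 1 \<union> cyclic_subs G p \<union> elementary_subs G p"
  proof (cases "inj_on \<theta> (carrier ?Z)")
    case True
    then have "card S = p^2" using Z.ord by (simp add: th(2) card_image order_def)
    then show ?thesis using exp t.img_is_subgroup by (auto simp: elementary_subs_def th(2))
  next
    case False
    then obtain a where a: "a \<in> carrier ?Z" "\<theta> a = \<one>" "a \<noteq> \<one>\<^bsub>?Z\<^esub>" using t.inj_on_one_iff by blast
    show ?thesis
    proof (cases "S = {\<one>}")
      case True
      then show ?thesis unfolding cyclic_subs_def using generate_one by (auto intro!: exI[of _ \<one>])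
    next
      case False
      then obtain b where b: "b \<in> carrier ?Z" "\<theta> b \<noteq> \<one>" using t.hom_one unfolding th(2) by force
      have nb: "b \<notin> generate ?Z {a}" using t.hom_generate_kernel[OF a(1,2)] b(2) by blast
      have im: "(\<lambda>(i, j). a [^]\<^bsub>?Z\<^esub> (i::int) \<otimes>\<^bsub>?Z\<^esub> b [^]\<^bsub>?Z\<^esub> (j::int)) ` carrier ?Z = carrier ?Z"
        using Z.independent_iso[OF a(1) b(1) a(3) nb] by (simp add: iso_def bij_betw_def)
      have "S = generate G {\<theta> b}"
      proof (intro equalityI subsetI)
        note gb = generate_eq_pows[OF t.hom_closed[OF b(1)]]
        fix y assume "y \<in> S"
        then obtain z where z: "z \<in> carrier ?Z" "y = \<theta> z" by (auto simp: th(2))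
        then have "z \<in> (\<lambda>(i, j). a [^]\<^bsub>?Z\<^esub> (i::int) \<otimes>\<^bsub>?Z\<^esub> b [^]\<^bsub>?Z\<^esub> (j::int)) ` carrier ?Z" using im by simp
        then obtain i j :: int where "z = a [^]\<^bsub>?Z\<^esub> i \<otimes>\<^bsub>?Z\<^esub> b [^]\<^bsub>?Z\<^esub> j" by (auto simp del: mult_Zprod)
        then have "y = \<theta> b [^] j" using a(1,2) b(1) z(2) by (simp add: t.hom_int_pow)
        then show "y \<in> generate G {\<theta> b}" unfolding gb by (rule range_eqI)
      next
        fix y assume "y \<in> generate G {\<theta> b}"
        then obtain j :: int where "y = \<theta> b [^] j"
          using generate_eq_pows[OF t.hom_closed[OF b(1)]] by auto
        then have "y = \<theta> (b [^]\<^bsub>?Z\<^esub> j)" using b(1) by (simp add: t.hom_int_pow)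
        then show "y \<in> S" using b(1) unfolding th(2) by (intro image_eqI[of _ _ "b [^]\<^bsub>?Z\<^esub> j"]) simp_all
      qed
      moreover have "ord (\<theta> b) = p" 
        using ord_prime_if_pow[OF p t.hom_closed[OF b(1)] exp b(2)] b(1) by (simp add: th(2))
      ultimately have "S \<in> cyclic_subs G p" unfolding cyclic_subs_def using t.hom_closed[OF b(1)] by blast
      then show ?thesis by blast
    qed
  qed
next
  fix S assume "S \<in> cyclic_subs G 1 \<union> cyclic_subs G p \<union> elementary_subs G p"
  then consider a where "S = generate G {a}" "a \<in> carrier G" "ord a dvd p" | "S \<in> elementary_subs G p"
    unfolding cyclic_subs_def by force
  then show "S \<in> (\<lambda>\<theta>. \<theta> ` carrier (Zprod p p)) ` hom (Zprod p p) G"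
  proof cases
    case 1
    then have "a [^] p = \<one>" using pow_eq_id by blast
    with 1 have "(\<lambda>(i, j). a [^] (i::int)) \<in> hom (Zprod p p) G"
      "S = (\<lambda>(i, j). a [^] (i::int)) ` carrier (Zprod p p)"
      using int_pow_Zprod_hom[of a p p] int_pow_image_Zprod[of a p p] prime_gt_0_nat[OF p] by simp_all
    then show ?thesis by blast
  next
    case 2
    then have S: "subgroup S G" "card S = p^2" "\<And>x. x \<in> S \<Longrightarrow> x [^] p = \<one>" by (auto simp: elementary_subs_def)
    interpret S: subgroup S G by (rule S)
    let ?S = "G\<lparr>carrier := S\<rparr>"
    interpret GS: group ?S by (rule S.subgroup_is_group[OF is_group])
    have fin: "finite S" using S(2) p by (metis card.infinite power_not_zero not_prime_0)
    have exp: "x [^]\<^bsub>?S\<^esub> p = \<one>\<^bsub>?S\<^esub>" if "x \<in> carrier ?S" for x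
      using S(3)[of x] that nat_pow_consistent[of x p S] by simp
    have ord: "order ?S = p^2" using S(2) by (simp add: order_def)
    have cm: "comm_group ?S" using GS.order_p2_exponent_p_comm[OF _ p ord exp] fin by simp
    interpret E: elementary_p2 ?S p
      using cm fin p ord exp by (intro elementary_p2.intro elementary_p2_axioms.intro) auto
    obtain a where a: "a \<in> carrier ?S" "a \<noteq> \<one>\<^bsub>?S\<^esub>"
      using E.exists_not_generated[OF GS.one_closed] GS.generate_one by auto
    obtain b where b: "b \<in> carrier ?S" "b \<notin> generate ?S {a}" using E.exists_not_generated[OF a(1)] by blast
    obtain F where F: "F \<in> iso (Zprod p p) ?S" using E.independent_iso[OF a(1) b(1) a(2) b(2)] by blast
    then have "F \<in> hom (Zprod p p) G" using S.subset by (auto simp: iso_def hom_def)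
    moreover have "S = F ` carrier (Zprod p p)" using F by (auto simp: iso_def bij_betw_def)
    ultimately show ?thesis by blast
  qed
qed

end

section \<open>Counting semidirect products\<close>

lemma (in group) cyclic_subs_mem:
  assumes "S \<in> cyclic_subs G m"
  shows "S \<subseteq> carrier G" "card S = m"
proof -
  obtain a where a: "S = generate G {a}" "a \<in> carrier G" "ord a = m"
    using assms by (auto simp: cyclic_subs_def)
  show "S \<subseteq> carrier G" unfolding a(1) by (rule generate_subset[OF a(2)])
  show "card S = m" using generate_pow_card[OF a(2)] a by simp
qed

lemma (in group) elementary_subs_mem:
  assumes "S \<in> elementary_subs G p"
  shows "S \<subseteq> carrier G" "card S = p^2"
  using assms subgroup.subset by (auto simp: elementary_subs_def)

text \<open>Conjugate subgroups have equal cardinality.\<close>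

lemma (in group) num_conj_Un_card:
  assumes fin: "finite (carrier G)"
    and S: "\<And>S. S \<in> \<S> \<Longrightarrow> S \<subseteq> carrier G \<and> card S \<in> M" and T: "\<And>T. T \<in> \<T> \<Longrightarrow> T \<subseteq> carrier G \<and> card T = n"
    and n: "n \<notin> M"
  shows "num_conj G (\<S> \<union> \<T>) = num_conj G \<S> + num_conj G \<T>"
proof (rule num_conj_Un[OF fin])
  fix U assume "U \<in> \<S> \<union> \<T>" then show "U \<subseteq> carrier G" using S T by blast
next
  fix U V g assume "U \<in> \<S>" "V \<in> \<T>" and g: "g \<in> carrier G"
  then have "U \<subseteq> carrier G" "card U \<in> M" "card V = n" using S T by auto
  then show "conj_by G g ` U \<noteq> V" using card_conj_by[OF g] n by metis
qed

lemma (in group) cyclic_subs_1: "cyclic_subs G 1 = {{\<one>}}"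
proof -
  have "cyclic_subs G 1 = {generate G {a} | a. a = \<one>}"
    unfolding cyclic_subs_def using ord_eq_1 by blast
  then show ?thesis using generate_one by simp
qed

lemma (in group) num_conj_cyclic_1: "num_conj G (cyclic_subs G 1) = 1"
  by (simp only: cyclic_subs_1 num_conj_def) simp

text \<open>The flag excludes the trivial action.  It is set only for order 36, where the direct products have
  been counted already among the groups with a normal Sylow 3-subgroup.\<close>

definition actions :: "bool \<Rightarrow> 'h monoid \<Rightarrow> 'g monoid \<Rightarrow> ('h \<Rightarrow> 'g) set" where
  "actions nontrivial P A = {\<theta> \<in> hom P A. nontrivial \<longrightarrow> \<theta> ` carrier P \<noteq> {\<one>\<^bsub>A\<^esub>}}"

lemma actions_subset: "actions b P A \<subseteq> hom P A"
  by (auto simp: actions_def)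

lemma image_actions:
  "(\<lambda>\<theta>. \<theta> ` carrier P) ` actions b P A
    = (\<lambda>\<theta>. \<theta> ` carrier P) ` hom P A - (if b then {{\<one>\<^bsub>A\<^esub>}} else {})"
  by (auto simp: actions_def)

lemma image_determined_Zprod:
  assumes p: "prime p" and A: "group A"
  shows "image_determined (Zprod (p^2) 1) A" "image_determined (Zprod p p) A"
proof -
  interpret Z: comm_group "Zprod (p^2) 1" by (rule comm_group_Zprod)
  have p0: "0 < p" using prime_gt_0_nat[OF p] .
  have p2: "p^2 \<ge> 2" using prime_ge_2_nat[OF p] self_le_power[of p 2] by simp
  show "image_determined (Zprod (p^2) 1) A"
  proof (rule Z.image_determined_cyclic[OF _ p _ _ _ A, where x = "(1, 0)" and n = 2])
    show "finite (carrier (Zprod (p^2) 1))" using p0 by (intro finite_Zprod) auto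
    show "order (Zprod (p^2) 1) = p^2" using p0 order_Zprod[of "p^2" 1] by simp
    show "(1, 0) \<in> carrier (Zprod (p^2) 1)" by (rule Zprod_1_mem[OF p2])
    fix y assume "y \<in> carrier (Zprod (p^2) 1)"
    then show "\<exists>k::nat. y = (1, 0) [^]\<^bsub>Zprod (p^2) 1\<^esub> k" using Zprod_gen[of "p^2" y] p0 by auto
  qed
  show "image_determined (Zprod p p) A"
    by (rule elementary_p2.image_determined_elementary[OF elementary_Zprod[OF p] A])
qed

lemma (in group) num_conj_images:
  assumes fin: "finite (carrier G)" and p: "prime p"
  shows "num_conj G (cyclic_subs G p \<union> cyclic_subs G (p^2)) = num_conj G (cyclic_subs G p) + num_conj G (cyclic_subs G (p^2))"
    and "num_conj G (cyclic_subs G p \<union> elementary_subs G p) = num_conj G (cyclic_subs G p) + num_conj G (elementary_subs G p)"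
    and "num_conj G (cyclic_subs G 1 \<union> cyclic_subs G p \<union> cyclic_subs G (p^2)) = 1 + num_conj G (cyclic_subs G p) + num_conj G (cyclic_subs G (p^2))"
    and "num_conj G (cyclic_subs G 1 \<union> cyclic_subs G p \<union> elementary_subs G p) = 1 + num_conj G (cyclic_subs G p) + num_conj G (elementary_subs G p)"
    and "cyclic_subs G 1 \<union> cyclic_subs G p \<union> cyclic_subs G (p^2) - {{\<one>}} = cyclic_subs G p \<union> cyclic_subs G (p^2)"
    and "cyclic_subs G 1 \<union> cyclic_subs G p \<union> elementary_subs G p - {{\<one>}} = cyclic_subs G p \<union> elementary_subs G p"
proof -
  have p1: "1 < p" using prime_gt_1_nat[OF p] .
  have p2: "p < p^2" using p1 by (simp add: power2_eq_square)
  have ne: "p^2 \<notin> {p}" "p^2 \<notin> {1, p}" "1 \<noteq> p" using p1 p2 by auto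
  show "num_conj G (cyclic_subs G p \<union> cyclic_subs G (p^2)) = num_conj G (cyclic_subs G p) + num_conj G (cyclic_subs G (p^2))"
    by (rule num_conj_Un_card[OF fin _ _ ne(1)]) (use cyclic_subs_mem in blast)+
  show "num_conj G (cyclic_subs G p \<union> elementary_subs G p) = num_conj G (cyclic_subs G p) + num_conj G (elementary_subs G p)"
    by (rule num_conj_Un_card[OF fin _ _ ne(1)]) (use cyclic_subs_mem elementary_subs_mem in blast)+
  have u: "num_conj G (cyclic_subs G 1 \<union> cyclic_subs G p) = 1 + num_conj G (cyclic_subs G p)"
  proof -
    have "num_conj G (cyclic_subs G 1 \<union> cyclic_subs G p) = num_conj G (cyclic_subs G 1) + num_conj G (cyclic_subs G p)"
      by (rule num_conj_Un_card[OF fin, where M = "{1}" and n = p]) (use cyclic_subs_mem ne in blast)+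
    then show ?thesis by (simp only: num_conj_cyclic_1)
  qed
  show "num_conj G (cyclic_subs G 1 \<union> cyclic_subs G p \<union> cyclic_subs G (p^2)) = 1 + num_conj G (cyclic_subs G p) + num_conj G (cyclic_subs G (p^2))"
    unfolding u[symmetric]
    by (rule num_conj_Un_card[OF fin _ _ ne(2)]) (use cyclic_subs_mem in blast)+
  show "num_conj G (cyclic_subs G 1 \<union> cyclic_subs G p \<union> elementary_subs G p) = 1 + num_conj G (cyclic_subs G p) + num_conj G (elementary_subs G p)"
    unfolding u[symmetric]
    by (rule num_conj_Un_card[OF fin _ _ ne(2)]) (use cyclic_subs_mem elementary_subs_mem in blast)+
  have c1: "card {\<one>} = 1" by simp
  have n: "{\<one>} \<notin> cyclic_subs G p" "{\<one>} \<notin> cyclic_subs G (p^2)" "{\<one>} \<notin> elementary_subs G p"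
    using cyclic_subs_mem(2)[of "{\<one>}"] elementary_subs_mem(2)[of "{\<one>}"] c1 ne by fastforce+
  then show "cyclic_subs G 1 \<union> cyclic_subs G p \<union> cyclic_subs G (p^2) - {{\<one>}} = cyclic_subs G p \<union> cyclic_subs G (p^2)"
    "cyclic_subs G 1 \<union> cyclic_subs G p \<union> elementary_subs G p - {{\<one>}} = cyclic_subs G p \<union> elementary_subs G p"
    unfolding cyclic_subs_1 by blast+
qed

context full_action begin

text \<open>The leading summand is the direct product, which the flag \<open>b\<close> removes.\<close>

lemma card_types:
  assumes p: "prime p" "coprime (order Q) p"
  shows "card (iso_type (order Q * p^2) ` sdprod Q (Zprod (p^2) 1) act ` actions b (Zprod (p^2) 1) A) =
      (if b then 0 else 1) + num_conj A (cyclic_subs A p) + num_conj A (cyclic_subs A (p^2))"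
    and "finite (iso_type (order Q * p^2) ` sdprod Q (Zprod (p^2) 1) act ` actions b (Zprod (p^2) 1) A)"
    and "card (iso_type (order Q * p^2) ` sdprod Q (Zprod p p) act ` actions b (Zprod p p) A) =
      (if b then 0 else 1) + num_conj A (cyclic_subs A p) + num_conj A (elementary_subs A p)"
    and "finite (iso_type (order Q * p^2) ` sdprod Q (Zprod p p) act ` actions b (Zprod p p) A)"
proof -
  have p0: "0 < p" using prime_gt_0_nat[OF p(1)] .
  have o: "order (Zprod (p^2) 1) = p^2" "order (Zprod p p) = p^2"
    using p0 order_Zprod[of "p^2" 1] order_Zprod[of p p] by (simp_all add: power2_eq_square)
  have f: "finite (carrier (Zprod (p^2) 1))" "finite (carrier (Zprod p p))"
    using p0 by (intro finite_Zprod; simp)+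
  have c: "coprime (order Q) (order (Zprod (p^2) 1))" "coprime (order Q) (order (Zprod p p))"
    unfolding o using p(2) by simp_all
  note C = card_iso_types_sdprod[OF group_Zprod f(1) c(1) image_determined_Zprod(1)[OF p(1) A.is_group] actions_subset, unfolded o]
  note E = card_iso_types_sdprod[OF group_Zprod f(2) c(2) image_determined_Zprod(2)[OF p(1) A.is_group] actions_subset, unfolded o]
  note im = A.num_conj_images[OF finA p(1)]
  note hc = A.hom_images_cyclic[OF p(1)] and he = A.hom_images_elementary[OF p(1)]
  show "card (iso_type (order Q * p^2) ` sdprod Q (Zprod (p^2) 1) act ` actions b (Zprod (p^2) 1) A) =
      (if b then 0 else 1) + num_conj A (cyclic_subs A p) + num_conj A (cyclic_subs A (p^2))"
  proof (cases b)
    case True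
    then have eq: "(\<lambda>\<theta>. \<theta> ` carrier (Zprod (p^2) 1)) ` actions b (Zprod (p^2) 1) A = cyclic_subs A p \<union> cyclic_subs A (p^2)"
      unfolding image_actions hc by (simp only: if_True im(5))
    show ?thesis unfolding C(1) eq im(1) using True by simp
  next
    case False
    then have eq: "(\<lambda>\<theta>. \<theta> ` carrier (Zprod (p^2) 1)) ` actions b (Zprod (p^2) 1) A
        = cyclic_subs A 1 \<union> cyclic_subs A p \<union> cyclic_subs A (p^2)"
      unfolding image_actions hc by (simp only: if_False Diff_empty)
    show ?thesis unfolding C(1) eq im(3) using False by simp
  qed
  show "card (iso_type (order Q * p^2) ` sdprod Q (Zprod p p) act ` actions b (Zprod p p) A) =
      (if b then 0 else 1) + num_conj A (cyclic_subs A p) + num_conj A (elementary_subs A p)"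
  proof (cases b)
    case True
    then have eq: "(\<lambda>\<theta>. \<theta> ` carrier (Zprod p p)) ` actions b (Zprod p p) A = cyclic_subs A p \<union> elementary_subs A p"
      unfolding image_actions he by (simp only: if_True im(6))
    show ?thesis unfolding E(1) eq im(2) using True by simp
  next
    case False
    then have eq: "(\<lambda>\<theta>. \<theta> ` carrier (Zprod p p)) ` actions b (Zprod p p) A
        = cyclic_subs A 1 \<union> cyclic_subs A p \<union> elementary_subs A p"
      unfolding image_actions he by (simp only: if_False Diff_empty)
    show ?thesis unfolding E(1) eq im(4) using False by simp
  qed
  show "finite (iso_type (order Q * p^2) ` sdprod Q (Zprod (p^2) 1) act ` actions b (Zprod (p^2) 1) A)"
    "finite (iso_type (order Q * p^2) ` sdprod Q (Zprod p p) act ` actions b (Zprod p p) A)"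
    by (rule C(2) E(2))+
qed

lemma action_homI:
  assumes "prime p" "coprime (order Q) p" "\<theta> \<in> hom P A" "P = Zprod (p^2) 1 \<or> P = Zprod p p"
  shows "action_hom Q A act P \<theta>"
proof -
  have p0: "0 < p" using prime_gt_0_nat[OF assms(1)] .
  have "order P = p^2" "finite (carrier P)"
    using p0 assms(4) order_Zprod[of "p^2" 1] order_Zprod[of p p] finite_Zprod[of "p^2" 1] finite_Zprod[of p p]
    by (auto simp: power2_eq_square)
  then show ?thesis
    using assms full_action_axioms group_Zprod
    by (intro action_hom.intro action_hom_axioms.intro) auto
qed

end

text \<open>An isomorphism of two semidirect products of coprime orders would make their factors isomorphic.\<close>

lemma iso_types_disjoint:
  assumes 1: "\<And>\<theta>. \<theta> \<in> H \<Longrightarrow> action_hom Q A act P \<theta>" and 2: "\<And>\<theta>. \<theta> \<in> H' \<Longrightarrow> action_hom Q' A' act' P' \<theta>"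
    and ord: "order Q = order Q'" "order P = order P'" "order Q * order P = n"
    and non: "\<not> (Q \<cong> Q' \<and> P \<cong> P')"
  shows "iso_type n ` sdprod Q P act ` H \<inter> iso_type n ` sdprod Q' P' act' ` H' = {}"
proof (rule ccontr)
  assume "\<not> ?thesis"
  then obtain X where "X \<in> iso_type n ` sdprod Q P act ` H" "X \<in> iso_type n ` sdprod Q' P' act' ` H'" by blast
  then obtain \<theta> \<theta>' where t: "\<theta> \<in> H" "\<theta>' \<in> H'"
    "iso_type n (sdprod Q P act \<theta>) = iso_type n (sdprod Q' P' act' \<theta>')" by (elim imageE) simp
  interpret s: action_hom Q A act P \<theta> by (rule 1[OF t(1)])
  interpret s': action_hom Q' A' act' P' \<theta>' by (rule 2[OF t(2)])
  have "s.S \<cong> s'.S"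
    using iso_type_eq_iff[OF s.sdprod_group s.sdprod_finite _ s'.sdprod_group, of n] t(3) s.sdprod_order ord(3) by simp
  then obtain f where "f \<in> iso s.S s'.S" by (auto simp: is_iso_def)
  then obtain \<alpha> \<beta> where ab: "\<alpha> \<in> iso Q Q'" "\<beta> \<in> iso P P'"
    using sdprod_iso_restrict[OF 1[OF t(1)] 2[OF t(2)] ord(1)] by blast
  show False using non is_isoI[OF ab(1)] is_isoI[OF ab(2)] by simp
qed

section \<open>Normal Sylow subgroups\<close>

definition sub_normalizer :: "('a, 'b) monoid_scheme \<Rightarrow> 'a set \<Rightarrow> 'a set" where
  "sub_normalizer G Q = {x \<in> carrier G. conj_by G x ` Q = Q}"

lemma (in group) subgroup_sub_normalizer:
  assumes Q: "Q \<subseteq> carrier G"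
  shows "subgroup (sub_normalizer G Q) G"
proof
  fix x y assume xy: "x \<in> sub_normalizer G Q" "y \<in> sub_normalizer G Q"
  then have "conj_by G x ` conj_by G y ` Q = Q" by (simp add: sub_normalizer_def)
  then show "x \<otimes> y \<in> sub_normalizer G Q"
    using xy conj_by_image_comp[of x y Q] Q by (simp add: sub_normalizer_def)
next
  fix x assume x: "x \<in> sub_normalizer G Q"
  then have xc: "x \<in> carrier G" and e: "conj_by G x ` Q = Q" by (auto simp: sub_normalizer_def)
  have "conj_by G (inv x) ` conj_by G x ` Q = Q"
    using conj_by_image_comp[of "inv x" x Q] xc Q conj_by_image_one[OF Q] by simp
  then show "inv x \<in> sub_normalizer G Q" using xc by (simp add: sub_normalizer_def e)
qed (use conj_by_image_one[OF Q] in \<open>auto simp: sub_normalizer_def\<close>)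

lemma (in group) conj_by_subgroup:
  assumes Q: "subgroup Q G" and x: "x \<in> carrier G"
  shows "subgroup (conj_by G x ` Q) G"
proof -
  interpret h: group_hom G G "conj_by G x"
    using conj_by_iso[OF x] by unfold_locales (auto simp: iso_def)
  show ?thesis by (rule h.subgroup_img_is_subgroup[OF Q])
qed

lemma (in group) subgroup_subset_normalizer:
  assumes Q: "subgroup Q G" and fin: "finite (carrier G)"
  shows "Q \<subseteq> sub_normalizer G Q"
proof
  interpret Q: subgroup Q G by (rule Q)
  fix x assume x: "x \<in> Q"
  have "conj_by G x ` Q \<subseteq> Q" using x by (auto simp: conj_by_def)
  then have "conj_by G x ` Q = Q"
    using card_conj_by[of x Q] x Q.subset fin by (intro card_subset_eq) (auto intro: finite_subset)
  then show "x \<in> sub_normalizer G Q" using x by (auto simp: sub_normalizer_def)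
qed

lemma (in group) normal_if_normalizer:
  assumes Q: "subgroup Q G" and N: "carrier G \<subseteq> sub_normalizer G Q"
  shows "Q \<lhd> G"
proof (rule normal_invI[OF Q])
  fix x h assume "x \<in> carrier G" "h \<in> Q"
  then show "x \<otimes> h \<otimes> inv x \<in> Q" using N by (auto simp: sub_normalizer_def conj_by_def)
qed

text \<open>The orbits that are not fixed points have a length divisible by \<open>q\<close>.\<close>

lemma (in group_action) card_fixed_points_mod:
  assumes ord: "order G = q ^ k" and q: "prime q" and fin: "finite E" "finite (carrier G)"
  shows "[card E = card {x \<in> E. \<forall>g\<in>carrier G. \<phi> g x = x}] (mod q)"
proof -
  interpret G: group G using group_hom by (simp add: group_hom_def)
  define F where "F = {x \<in> E. \<forall>g\<in>carrier G. \<phi> g x = x}"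
  define R where "R = orbits G E \<phi>"
  have part: "\<Union>R = E" "pairwise disjnt R" 
    using orbits_coverture disjoint_union by (auto simp: R_def pairwise_def disjnt_def)
  have orb_sub: "orb \<subseteq> E" if "orb \<in> R" for orb using part that by blast
  have finR: "finite R" using part fin by (metis finite_UnionD)
  have "card E = (\<Sum>orb\<in>R. card orb)"
    using card_Union_disjoint[of R] part orb_sub fin finite_subset by metis
  also have "\<dots> = (\<Sum>orb\<in>{orb\<in>R. card orb = 1}. card orb) + (\<Sum>orb\<in>{orb\<in>R. card orb \<noteq> 1}. card orb)"
    using sum.Int_Diff[OF finR, of card "{orb. card orb = 1}"] by (simp add: Int_def set_diff_eq)
  also have "(\<Sum>orb\<in>{orb\<in>R. card orb = 1}. card orb) = card {orb\<in>R. card orb = 1}" by simp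
  also have "\<dots> = card F"
  proof -
    have "bij_betw (\<lambda>x. {x}) F {orb\<in>R. card orb = 1}"
    proof (intro bij_betw_imageI equalityI subsetI)
      fix orb assume "orb \<in> (\<lambda>x. {x}) ` F"
      then obtain x where x: "x \<in> F" "orb = {x}" by blast
      have "orbit G \<phi> x \<subseteq> {x}" using x(1) unfolding orbit_def F_def by blast
      moreover have xE: "x \<in> E" using x(1) by (simp add: F_def)
      moreover have "x \<in> orbit G \<phi> x" using orbit_refl[OF xE] .
      ultimately have "orb = orbit G \<phi> x" using x(2) by blast
      then have "orb \<in> R" unfolding R_def orbits_def using xE by blast
      then show "orb \<in> {orb\<in>R. card orb = 1}" using x by simp
    next
      fix orb assume orb: "orb \<in> {orb\<in>R. card orb = 1}"
      then obtain x where x: "orb = {x}" by (auto simp: card_1_singleton_iff)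
      have xE: "x \<in> E" using orb_sub orb x by auto
      obtain y where y: "y \<in> E" "orb = orbit G \<phi> y" using orb by (auto simp: R_def orbits_def)
      have yx: "y = x" using orbit_refl[OF y(1)] unfolding y(2)[symmetric] x by simp
      have "\<phi> g x = x" if g: "g \<in> carrier G" for g
      proof -
        have "\<phi> g y \<in> orb" unfolding y(2) orbit_def using g by blast
        then show ?thesis using x yx by simp
      qed
      then show "orb \<in> (\<lambda>x. {x}) ` F" using x xE by (auto simp: F_def)
    qed simp
    then show ?thesis using bij_betw_same_card by metis
  qed
  finally have eq: "card E = card F + (\<Sum>orb\<in>{orb\<in>R. card orb \<noteq> 1}. card orb)" .
  have "q dvd (\<Sum>orb\<in>{orb\<in>R. card orb \<noteq> 1}. card orb)"
  proof (rule dvd_sum)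
    fix orb assume orb: "orb \<in> {orb\<in>R. card orb \<noteq> 1}"
    then obtain y where y: "y \<in> E" "orb = orbit G \<phi> y" by (auto simp: R_def orbits_def)
    have "card orb dvd q ^ k" using orbit_stabilizer_theorem[OF y(1)] y(2) ord by (metis dvd_triv_left)
    then obtain i where "card orb = q ^ i" using q by (auto simp: divides_primepow_nat)
    then show "q dvd card orb" using orb by (cases i) auto
  qed
  then have "[card F + (\<Sum>orb\<in>{orb\<in>R. card orb \<noteq> 1}. card orb) = card F + 0] (mod q)"
    by (intro cong_add cong_refl) (simp add: cong_0_iff)
  then show ?thesis unfolding eq F_def by simp
qed

lemma (in group) rcoset_eq_iff:
  assumes Q: "subgroup Q G" and xy: "x \<in> carrier G" "y \<in> carrier G"
  shows "Q #> x = Q #> y \<longleftrightarrow> x \<otimes> inv y \<in> Q"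
proof
  interpret Q: subgroup Q G by (rule Q)
  assume "Q #> x = Q #> y"
  then have "x \<in> Q #> y" using rcos_self[OF xy(1) Q] by simp
  then obtain h where "h \<in> Q" "x = h \<otimes> y" by (auto simp: r_coset_def)
  then show "x \<otimes> inv y \<in> Q" using xy by (simp add: m_assoc)
next
  interpret Q: subgroup Q G by (rule Q)
  assume a: "x \<otimes> inv y \<in> Q"
  have "x = (x \<otimes> inv y) \<otimes> y" using xy by (simp add: m_assoc)
  then have "x \<in> Q #> y" unfolding r_coset_def using a by blast
  then show "Q #> x = Q #> y" using repr_independence[OF _ xy(2) Q] by simp
qed

text \<open>Let the Sylow subgroup \<open>Q\<close> act by right multiplication on its own \<open>m\<close> cosets.  The coset of \<open>x\<close> is
  fixed precisely if \<open>x\<close> normalises \<open>Q\<close>, so the number \<open>f\<close> of fixed points is the index of \<open>Q\<close> in its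
  normaliser.\<close>

lemma (in group) sylow_normalizer_cong:
  assumes fin: "finite (carrier G)" and q: "prime q" and ord: "order G = q ^ k * m"
    and Q: "subgroup Q G" "card Q = q ^ k"
  shows "\<exists>f. f dvd m \<and> [m = f] (mod q) \<and> card (sub_normalizer G Q) = q ^ k * f"
proof -
  interpret Q: subgroup Q G by (rule Q)
  let ?Q = "G\<lparr>carrier := Q\<rparr>" and ?N = "sub_normalizer G Q"
  interpret GQ: group ?Q by (rule Q.subgroup_is_group[OF is_group])
  (* The inverse turns right multiplication into a left action. *)
  define \<phi> where "\<phi> = (\<lambda>g. \<lambda>C\<in>rcosets Q. C #> inv g)"
  have qk: "q ^ k > 0" using prime_gt_0_nat[OF q] by simp
  have rc: "C #> g \<in> rcosets Q" if "C \<in> rcosets Q" "g \<in> carrier G" for C g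
    using that Q.subset by (auto simp: RCOSETS_def coset_mult_assoc)
  have rcG: "C \<subseteq> carrier G" if "C \<in> rcosets Q" for C
    using that Q.subset by (auto simp: RCOSETS_def r_coset_def)
  have comp: "\<phi> g (\<phi> h C) = C #> inv (g \<otimes> h)" if "C \<in> rcosets Q" "g \<in> carrier G" "h \<in> carrier G" for g h C
    using that rc rcG by (simp add: \<phi>_def coset_mult_assoc inv_mult_group)
  have one: "C #> \<one> = C" if "C \<in> rcosets Q" for C using rcG[OF that] by simp
  have bij: "\<phi> g \<in> Bij (rcosets Q)" if g: "g \<in> carrier G" for g
  proof -
    have "bij_betw (\<phi> g) (rcosets Q) (rcosets Q)"
    proof (rule bij_betw_byWitness[where f' = "\<phi> (inv g)"])
      show "\<forall>C\<in>rcosets Q. \<phi> (inv g) (\<phi> g C) = C" "\<forall>C\<in>rcosets Q. \<phi> g (\<phi> (inv g) C) = C"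
        using comp g one by simp_all
      show "\<phi> g ` (rcosets Q) \<subseteq> rcosets Q" "\<phi> (inv g) ` (rcosets Q) \<subseteq> rcosets Q"
        using g rc by (auto simp: \<phi>_def)
    qed
    then show ?thesis by (simp add: Bij_def \<phi>_def)
  qed
  have hom: "\<phi> \<in> hom ?Q (BijGroup (rcosets Q))"
  proof (rule homI)
    fix g assume "g \<in> carrier ?Q"
    then show "\<phi> g \<in> carrier (BijGroup (rcosets Q))" using bij by (simp add: BijGroup_def)
  next
    fix g h assume "g \<in> carrier ?Q" "h \<in> carrier ?Q"
    then have gh: "g \<in> carrier G" "h \<in> carrier G" by auto
    have "\<phi> (g \<otimes> h) = compose (rcosets Q) (\<phi> g) (\<phi> h)"
    proof
      fix C show "\<phi> (g \<otimes> h) C = compose (rcosets Q) (\<phi> g) (\<phi> h) C"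
        using comp[of C g h] rc[of C "inv h"] gh by (cases "C \<in> rcosets Q") (simp_all add: \<phi>_def compose_def)
    qed
    then show "\<phi> (g \<otimes>\<^bsub>?Q\<^esub> h) = \<phi> g \<otimes>\<^bsub>BijGroup (rcosets Q)\<^esub> \<phi> h"
      using bij gh by (simp add: BijGroup_def)
  qed
  interpret A: group_action ?Q "rcosets Q" \<phi>
    using GQ.is_group group_BijGroup hom
    by (intro group_action.intro group_hom.intro group_hom_axioms.intro)
  have "rcosets Q \<subseteq> Pow (carrier G)" using rcG by blast
  then have finR: "finite (rcosets Q)" using fin finite_subset by blast
  have cardR: "card (rcosets Q) = m" using lagrange[OF Q(1)] ord Q(2) prime_gt_0_nat[OF q] by (simp add: mult.commute)
  interpret N: subgroup ?N G by (rule subgroup_sub_normalizer[OF Q.subset])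
  let ?GN = "G\<lparr>carrier := ?N\<rparr>"
  interpret GN: group ?GN by (rule N.subgroup_is_group[OF is_group])
  have QN: "subgroup Q ?GN"
    using subgroup_incl[OF Q(1) N.subgroup_axioms subgroup_subset_normalizer[OF Q(1) fin]] .
  have fix_iff: "(\<forall>g\<in>Q. \<phi> g (Q #> x) = Q #> x) \<longleftrightarrow> x \<in> ?N" if x: "x \<in> carrier G" for x
  proof -
    have R: "Q #> x \<in> rcosets Q" using x Q.subset by (rule rcosetsI[rotated])
    have "\<phi> g (Q #> x) = Q #> x \<longleftrightarrow> conj_by G x (inv g) \<in> Q" if g: "g \<in> Q" for g
    proof -
      have gc: "g \<in> carrier G" using g by simp
      have "\<phi> g (Q #> x) = Q #> (x \<otimes> inv g)" using R x gc Q.subset by (simp add: \<phi>_def coset_mult_assoc)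
      moreover have "Q #> (x \<otimes> inv g) = Q #> x \<longleftrightarrow> x \<otimes> inv g \<otimes> inv x \<in> Q"
        using rcoset_eq_iff[OF Q(1)] x gc by simp
      ultimately show ?thesis by (simp add: conj_by_def)
    qed
    then have "(\<forall>g\<in>Q. \<phi> g (Q #> x) = Q #> x) \<longleftrightarrow> (\<forall>g\<in>Q. conj_by G x (inv g) \<in> Q)" by blast
    also have "\<dots> \<longleftrightarrow> (\<forall>g\<in>Q. conj_by G x g \<in> Q)"
    proof
      assume a: "\<forall>g\<in>Q. conj_by G x (inv g) \<in> Q"
      show "\<forall>g\<in>Q. conj_by G x g \<in> Q"
      proof
        fix g assume "g \<in> Q"
        then show "conj_by G x g \<in> Q" using bspec[OF a, of "inv g"] by simp
      qed
    qed simp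
    also have "\<dots> \<longleftrightarrow> conj_by G x ` Q \<subseteq> Q" by blast
    also have "\<dots> \<longleftrightarrow> conj_by G x ` Q = Q"
      using card_conj_by[OF x Q.subset] finite_subset[OF Q.subset fin] card_subset_eq[of Q "conj_by G x ` Q"] by auto
    also have "\<dots> \<longleftrightarrow> x \<in> ?N" unfolding sub_normalizer_def using x by blast
    finally show ?thesis .
  qed
  have F: "{C \<in> rcosets Q. \<forall>g\<in>carrier ?Q. \<phi> g C = C} = rcosets\<^bsub>?GN\<^esub> Q"
  proof (intro equalityI subsetI)
    fix C assume C: "C \<in> {C \<in> rcosets Q. \<forall>g\<in>carrier ?Q. \<phi> g C = C}"
    note C' = CollectD[OF C]
    obtain x where x: "x \<in> carrier G" "C = Q #> x" using C'[THEN conjunct1] unfolding RCOSETS_def by blast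
    have "\<forall>g\<in>Q. \<phi> g (Q #> x) = Q #> x" using C'[THEN conjunct2] unfolding x(2) by simp
    then have "x \<in> ?N" using fix_iff[OF x(1)] by simp
    moreover have "C = Q #>\<^bsub>?GN\<^esub> x" unfolding x(2) by (simp add: r_coset_def)
    ultimately show "C \<in> rcosets\<^bsub>?GN\<^esub> Q" unfolding RCOSETS_def by auto
  next
    fix C assume "C \<in> rcosets\<^bsub>?GN\<^esub> Q"
    then obtain x where x: "x \<in> ?N" "C = Q #>\<^bsub>?GN\<^esub> x" unfolding RCOSETS_def by auto
    have C: "C = Q #> x" unfolding x(2) by (simp add: r_coset_def)
    have xG: "x \<in> carrier G" using x(1) by simp
    have "\<forall>g\<in>Q. \<phi> g (Q #> x) = Q #> x" using x(1) fix_iff[OF xG] by simp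
    then show "C \<in> {C \<in> rcosets Q. \<forall>g\<in>carrier ?Q. \<phi> g C = C}"
      unfolding C by (intro CollectI conjI rcosetsI[OF Q.subset xG]) simp
  qed
  define f where "f = card (rcosets\<^bsub>?GN\<^esub> Q)"
  have f: "card ?N = q ^ k * f" using GN.lagrange[OF QN] Q(2) by (simp add: order_def f_def mult.commute)
  have "q ^ k * f dvd q ^ k * m"
    unfolding f[symmetric] ord[symmetric] lagrange[OF N.subgroup_axioms, symmetric] by (rule dvd_triv_right)
  then have "f dvd m" using prime_gt_0_nat[OF q] by simp
  moreover have "[m = f] (mod q)"
    using A.card_fixed_points_mod[OF _ q finR] Q(2) finite_subset[OF Q.subset fin] F cardR
    by (simp add: order_def f_def)
  ultimately show ?thesis using f by blast
qed

lemma (in group) normal_if_card_normalizer: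
  assumes "finite (carrier G)" "subgroup Q G" "card (sub_normalizer G Q) = order G"
  shows "Q \<lhd> G"
proof (rule normal_if_normalizer[OF assms(2)])
  have "sub_normalizer G Q = carrier G"
    using assms by (intro card_subset_eq) (auto simp: order_def sub_normalizer_def)
  then show "carrier G \<subseteq> sub_normalizer G Q" by simp
qed

text \<open>The index \<open>f\<close> of \<open>Q\<close> in its normaliser divides \<open>p\<^sup>2\<close> and is congruent to \<open>p\<^sup>2\<close> modulo \<open>q\<close>.  As \<open>q > p\<close>,
  the case \<open>f = p\<close> is impossible, and \<open>f = 1\<close> forces \<open>q = p + 1\<close>, that is, \<open>p = 2\<close> and \<open>q = 3\<close>.\<close>

lemma (in group) sylow_p2q2_normal:
  assumes fin: "finite (carrier G)" and pq: "prime p" "prime q" "p < q" and ord: "order G = p^2 * q^2"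
    and ne: "\<not> (p = 2 \<and> q = 3)" and Q: "subgroup Q G" "card Q = q^2"
  shows "Q \<lhd> G"
proof -
  obtain f where f: "f dvd p^2" "[p^2 = f] (mod q)" "card (sub_normalizer G Q) = q^2 * f"
    using sylow_normalizer_cong[OF fin pq(2) _ Q, of "p^2"] ord by (auto simp: mult.commute)
  have p1: "1 < p" using prime_gt_1_nat[OF pq(1)] .
  obtain i where i: "i \<le> 2" "f = p^i" using f(1) pq(1) by (auto simp: divides_primepow_nat)
  have fle: "f \<le> p^2" using f(1) p1 by (intro dvd_imp_le) auto
  have dv: "q dvd p^2 - f" using f(2) fle by (metis cong_altdef_nat cong_sym)
  have "i = 2"
  proof (rule ccontr)
    assume "i \<noteq> 2"
    then consider "i = 0" | "i = 1" using i(1) by linarith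
    then show False
    proof cases
      case 1
      then have "q dvd p^2 - 1" using dv i by simp
      moreover have "p^2 - 1 = (p - 1) * (p + 1)" by (simp add: power2_eq_square algebra_simps)
      ultimately have "q dvd p - 1 \<or> q dvd p + 1" using pq(2) prime_dvd_mult_iff by metis
      then have "q = p + 1" using p1 pq(3) by (auto dest!: dvd_imp_le)
      then have "even p \<or> even q" by auto
      then have "p = 2 \<or> q = 2" using pq by (metis primes_dvd_imp_eq two_is_prime_nat)
      then show False using \<open>q = p + 1\<close> ne p1 by auto
    next
      case 2
      then have "q dvd p^2 - p" using dv i by simp
      moreover have "p^2 - p = p * (p - 1)" by (simp add: power2_eq_square algebra_simps)
      ultimately have "q dvd p \<or> q dvd p - 1" using pq(2) prime_dvd_mult_iff by metis
      then show False using p1 pq(3) by (auto dest!: dvd_imp_le)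
    qed
  qed
  then show ?thesis using f(3) i ord by (intro normal_if_card_normalizer[OF fin Q(1)]) (simp add: mult.commute)
qed

lemma (in group) order_p2_comm:
  assumes "finite (carrier G)" "prime p" "order G = p^2" "a \<in> carrier G" "b \<in> carrier G"
  shows "a \<otimes> b = b \<otimes> a"
proof -
  have "\<exists>m n. G \<cong> Zprod m n" using order_p2_cases[OF assms(1-3)] by blast
  then obtain m n f where f: "f \<in> iso G (Zprod m n)" by (auto simp: is_iso_def)
  interpret Z: comm_group "Zprod m n" by (rule comm_group_Zprod)
  have fc: "f a \<in> carrier (Zprod m n)" "f b \<in> carrier (Zprod m n)" using f assms by (auto simp: iso_def hom_def)
  have "f (a \<otimes> b) = f a \<otimes>\<^bsub>Zprod m n\<^esub> f b" "f (b \<otimes> a) = f b \<otimes>\<^bsub>Zprod m n\<^esub> f a"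
    using f assms by (auto simp: iso_def hom_def)
  then have "f (a \<otimes> b) = f (b \<otimes> a)" using Z.m_comm[OF fc] by simp
  then show ?thesis using f assms by (auto simp: iso_def bij_betw_def dest: inj_onD)
qed

lemma (in group) subgroup_order_p2_comm:
  assumes "finite (carrier G)" "prime p" "subgroup Q G" "card Q = p^2" "a \<in> Q" "b \<in> Q"
  shows "a \<otimes> b = b \<otimes> a"
proof -
  interpret Q: subgroup Q G by (rule assms)
  interpret GQ: group "G\<lparr>carrier := Q\<rparr>" by (rule Q.subgroup_is_group[OF is_group])
  show ?thesis
    using GQ.order_p2_comm[of p a b] assms finite_subset[OF Q.subset] by (simp add: order_def)
qed

definition centralizer :: "('a, 'b) monoid_scheme \<Rightarrow> 'a set \<Rightarrow> 'a set" where
  "centralizer G D = {x \<in> carrier G. \<forall>d\<in>D. x \<otimes>\<^bsub>G\<^esub> d = d \<otimes>\<^bsub>G\<^esub> x}"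

lemma (in group) subgroup_centralizer:
  assumes D: "D \<subseteq> carrier G"
  shows "subgroup (centralizer G D) G"
proof
  fix x y assume x: "x \<in> centralizer G D" and y: "y \<in> centralizer G D"
  have xc: "x \<in> carrier G" "y \<in> carrier G" using x y by (auto simp: centralizer_def)
  have "x \<otimes> y \<otimes> d = d \<otimes> (x \<otimes> y)" if d: "d \<in> D" for d
  proof -
    have dc: "d \<in> carrier G" using d D by blast
    have "x \<otimes> y \<otimes> d = x \<otimes> (d \<otimes> y)" using y d xc dc by (simp add: centralizer_def m_assoc)
    also have "\<dots> = (x \<otimes> d) \<otimes> y" using xc dc by (simp add: m_assoc)
    also have "\<dots> = d \<otimes> x \<otimes> y" using x d by (simp add: centralizer_def)
    finally show ?thesis using xc dc by (simp add: m_assoc)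
  qed
  then show "x \<otimes> y \<in> centralizer G D" using xc by (simp add: centralizer_def)
next
  fix x assume x: "x \<in> centralizer G D"
  have xc: "x \<in> carrier G" using x by (auto simp: centralizer_def)
  have "inv x \<otimes> d = d \<otimes> inv x" if d: "d \<in> D" for d
  proof -
    have dc: "d \<in> carrier G" using d D by blast
    have "x \<otimes> d = d \<otimes> x" using x d by (simp add: centralizer_def)
    then have "d = inv x \<otimes> (d \<otimes> x)" using xc dc inv_solve_left[of d x "d \<otimes> x"] by simp
    then have "d = (inv x \<otimes> d) \<otimes> x" using xc dc by (simp add: m_assoc)
    then show ?thesis using xc dc inv_solve_right[of "inv x \<otimes> d" d x] by simp
  qed
  then show "inv x \<in> centralizer G D" using xc by (simp add: centralizer_def)
qed (use D in \<open>auto simp: centralizer_def\<close>)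

lemma (in group) card_subgroup_dvd:
  assumes "subgroup H G" "subgroup K G" "H \<subseteq> K"
  shows "card H dvd card K"
proof -
  interpret K: subgroup K G by (rule assms)
  interpret GK: group "G\<lparr>carrier := K\<rparr>" by (rule K.subgroup_is_group[OF is_group])
  have "card (rcosets\<^bsub>G\<lparr>carrier := K\<rparr>\<^esub> H) * card H = card K"
    using GK.lagrange[OF subgroup_incl[OF assms]] by (simp add: order_def)
  then show ?thesis by (metis dvd_triv_right)
qed

text \<open>Two Sylow subgroups of order 9 with trivial intersection would have a product set of 81 elements.
  Both are abelian, so their intersection is centralised by both.  The centraliser therefore has
  order 9, 18 or 36 and contains \<open>R \<noteq> Q\<close>; if its order were 9 or 18, then \<open>Q\<close> would be normal in it and
  it would lie in the self-normalising \<open>Q\<close>.\<close>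

lemma (in group) order36_intersection:
  assumes fin: "finite (carrier G)" and ord: "order G = 36"
    and Q: "subgroup Q G" "card Q = 9" and N: "sub_normalizer G Q = Q"
    and R: "subgroup R G" "card R = 9" "R \<noteq> Q"
  shows "card (Q \<inter> R) = 3" "carrier G \<subseteq> centralizer G (Q \<inter> R)"
proof -
  interpret Q: subgroup Q G by (rule Q)
  interpret R: subgroup R G by (rule R)
  let ?D = "Q \<inter> R" 
  let ?C = "centralizer G (Q \<inter> R)"
  have three: "prime (3::nat)" by simp
  have finQ: "finite Q" "finite R" using Q.subset R.subset fin finite_subset by auto
  have D: "subgroup ?D G" by (rule subgroups_Inter_pair[OF Q(1) R(1)])
  have "card ?D dvd 9" using card_subgroup_dvd[OF D Q(1)] Q(2) by simp
  then have "card ?D dvd 3^2" by simp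
  then obtain i where i: "i \<le> 2" "card ?D = 3^i" using three by (auto simp only: divides_primepow_nat)
  have "i \<noteq> 2"
  proof
    assume "i = 2"
    then have "?D = Q" "?D = R" using i(2) Q(2) R(2) finQ card_subset_eq[of Q ?D] card_subset_eq[of R ?D] by auto
    then show False using R(3) by blast
  qed
  moreover have "i \<noteq> 0"
  proof
    assume "i = 0"
    then have "card ?D = 1" using i(2) by simp
    then obtain x where "?D = {x}" using card_1_singleton_iff[of ?D] by auto
    then have D1: "?D \<subseteq> {\<one>}" using subgroup.one_closed[OF D] by simp
    define F where "F = (\<lambda>(h, k). h \<otimes> k)"
    have "inj_on F (Q \<times> R)" unfolding F_def by (rule inj_on_subgroup_product[OF Q(1) R(1) D1])
    then have "card (F ` (Q \<times> R)) = 81" using Q R by (simp add: card_image card_cartesian_product)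
    moreover have "F ` (Q \<times> R) \<subseteq> carrier G" by (auto simp: F_def)
    ultimately show False using card_mono[OF fin, of "F ` (Q \<times> R)"] ord by (simp add: order_def)
  qed
  ultimately have "i = 1" using i(1) by linarith
  then show D3: "card ?D = 3" using i(2) by simp
  have Dc: "?D \<subseteq> carrier G" using Q.subset by blast
  interpret C: subgroup ?C G by (rule subgroup_centralizer[OF Dc])
  have cQ: "x \<otimes> d = d \<otimes> x" if "x \<in> Q" "d \<in> Q" for x d
    by (rule subgroup_order_p2_comm[OF fin three Q(1) _ that]) (simp add: Q(2))
  have cR: "x \<otimes> d = d \<otimes> x" if "x \<in> R" "d \<in> R" for x d
    by (rule subgroup_order_p2_comm[OF fin three R(1) _ that]) (simp add: R(2))
  have QC: "Q \<subseteq> ?C" and RC: "R \<subseteq> ?C"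
    unfolding centralizer_def using cQ cR Q.subset R.subset by blast+
  obtain m where m: "card ?C = 9 * m" using card_subgroup_dvd[OF Q(1) C.subgroup_axioms QC] Q(2) by (auto elim: dvdE)
  have "card ?C dvd 36" using lagrange[OF C.subgroup_axioms] ord by (metis dvd_triv_right)
  then have "9 * m dvd 9 * 4" using m by simp
  then have m4: "m dvd 2^2" by simp
  then obtain j where j: "j \<le> 2" "m = 2^j" using two_is_prime_nat by (auto simp only: divides_primepow_nat)
  have finC: "finite ?C" using C.subset fin finite_subset by blast
  have "j = 2"
  proof (rule ccontr)
    assume "j \<noteq> 2"
    then have m12: "m = 1 \<or> m = 2" using j by (cases j) (auto simp: le_Suc_eq numeral_2_eq_2)
    let ?GC = "G\<lparr>carrier := ?C\<rparr>"
    interpret GC: group ?GC by (rule C.subgroup_is_group[OF is_group])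
    have QGC: "subgroup Q ?GC" by (rule subgroup_incl[OF Q(1) C.subgroup_axioms QC])
    obtain f where f: "f dvd m" "[m = f] (mod 3)" "card (sub_normalizer ?GC Q) = 3^2 * f"
      using GC.sylow_normalizer_cong[OF _ three _ QGC, of 2 m] finC m Q(2) by (auto simp: order_def)
    have "f = m"
    proof -
      have "f \<le> m" "m > 0" using f(1) m12 by (auto dest: dvd_imp_le)
      then have "f = m \<or> (m = 2 \<and> f = 1)" using m12 f(1) by (auto simp: le_Suc_eq numeral_2_eq_2)
      then show ?thesis using f(2) by (auto simp: cong_def)
    qed
    then have nGC: "Q \<lhd> ?GC"
      using GC.normal_if_card_normalizer[OF _ QGC] f(3) finC m by (simp add: order_def)
    have nQ: "x \<otimes> h \<otimes> inv x \<in> Q" if "x \<in> ?C" "h \<in> Q" for x h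
      using normal.inv_op_closed2[OF nGC, of x h] that m_inv_consistent[OF C.subgroup_axioms that(1)] by simp
    have "?C \<subseteq> sub_normalizer G Q"
    proof
      fix x assume x: "x \<in> ?C"
      have "conj_by G x ` Q \<subseteq> Q" unfolding conj_by_def using nQ[OF x] by blast
      moreover have "card (conj_by G x ` Q) = card Q" using card_conj_by[OF C.mem_carrier[OF x] Q.subset] .
      ultimately have "conj_by G x ` Q = Q" using finQ by (intro card_subset_eq) auto
      then show "x \<in> sub_normalizer G Q" unfolding sub_normalizer_def using C.mem_carrier[OF x] by blast
    qed
    then have "R \<subseteq> Q" using RC N by blast
    then show False using card_subset_eq[of Q R] finQ Q R by auto
  qed
  then have "card ?C = card (carrier G)" using m j ord by (simp add: order_def)
  then have "?C = carrier G" using fin C.subset by (intro card_subset_eq) auto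
  then show "carrier G \<subseteq> ?C" by simp
qed

text \<open>The four conjugates of \<open>Q\<close> share a central subgroup \<open>D\<close> of order 3, so they cover \<open>3 + 4 * 6 = 27\<close>
  elements, all of order dividing 9.  For a Sylow 2-subgroup \<open>P\<close> the 9 products of a non-trivial
  element of \<open>P\<close> with an element of \<open>D\<close> are exactly the rest.  Hence every element \<open>y\<close> with \<open>y\<^sup>4 = 1\<close> lies in
  \<open>P\<close>, which makes \<open>P\<close> normal.\<close>

lemma (in group) order36_normal:
  assumes fin: "finite (carrier G)" and ord: "order G = 36"
    and Q: "subgroup Q G" "card Q = 9" and nn: "\<not> Q \<lhd> G"
  shows "\<exists>P. P \<lhd> G \<and> card P = 4"
proof -
  interpret Q: subgroup Q G by (rule Q)
  have three: "prime (3::nat)" by simp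
  have finQ: "finite Q" using Q.subset fin finite_subset by auto
  obtain f where f: "f dvd 4" "[4 = f] (mod 3)" "card (sub_normalizer G Q) = 3^2 * f"
    using sylow_normalizer_cong[OF fin three _ Q(1), of 2 4] ord Q(2) by auto
  have "f \<noteq> 4" using normal_if_card_normalizer[OF fin Q(1)] f(3) ord nn by auto
  moreover have "f \<le> 4" using f(1) by (auto dest: dvd_imp_le)
  moreover have "f \<noteq> 0" "f \<noteq> 2" "f \<noteq> 3" using f(1,2) by (auto simp: cong_def)
  ultimately have f1: "f = 1" by linarith
  have N: "sub_normalizer G Q = Q"
  proof -
    have "finite (sub_normalizer G Q)" using fin by (simp add: sub_normalizer_def)
    then show ?thesis
      using card_subset_eq[OF _ subgroup_subset_normalizer[OF Q(1) fin]] f(3) f1 Q(2) by simp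
  qed
  (* Conjugating by the inverse makes U constant on right cosets of Q. *)
  define U where "U = (\<lambda>x. conj_by G (inv x) ` Q)"
  have Us: "subgroup (U x) G" "card (U x) = 9" if "x \<in> carrier G" for x
    using conj_by_subgroup[OF Q(1), of "inv x"] card_conj_by[OF _ Q.subset, of "inv x"] that Q(2) by (simp_all add: U_def)
  have Ueq: "U x = U y \<longleftrightarrow> Q #> x = Q #> y" if xy: "x \<in> carrier G" "y \<in> carrier G" for x y
  proof -
    have "U x = U y \<longleftrightarrow> conj_by G y ` U x = conj_by G y ` U y"
      using inj_on_image_eq_iff[OF inj_on_conj_by[OF xy(2)], of "U x" "U y"] subgroup.subset[OF Us(1)] xy by blast
    also have "conj_by G y ` U y = Q"
      using conj_by_image_comp[OF xy(2) _ Q.subset, of "inv y"] xy conj_by_image_one[OF Q.subset] by (simp add: U_def)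
    also have "conj_by G y ` U x = conj_by G (y \<otimes> inv x) ` Q"
      using conj_by_image_comp[OF xy(2) _ Q.subset, of "inv x"] xy by (simp add: U_def)
    also have "conj_by G (y \<otimes> inv x) ` Q = Q \<longleftrightarrow> y \<otimes> inv x \<in> sub_normalizer G Q"
      unfolding sub_normalizer_def using xy by blast
    also have "\<dots> \<longleftrightarrow> Q #> y = Q #> x" unfolding N using rcoset_eq_iff[OF Q(1) xy(2,1)] by simp
    finally show ?thesis by blast
  qed
  have "card (U ` carrier G) = card ((\<lambda>x. Q #> x) ` carrier G)"
    by (rule card_image_cong_iff(1)[OF Ueq])
  also have "(\<lambda>x. Q #> x) ` carrier G = rcosets Q" by (auto simp: RCOSETS_def)
  also have "card (rcosets Q) = 4" using lagrange[OF Q(1)] ord Q(2) by simp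
  finally have cardU: "card (U ` carrier G) = 4" .
  have U1: "U \<one> = Q" using conj_by_image_one[OF Q.subset] by (simp add: U_def)
  have "\<exists>R\<in>U ` carrier G. R \<noteq> Q"
  proof (rule ccontr)
    assume "\<not> ?thesis"
    then have "U ` carrier G \<subseteq> {Q}" by blast
    then have "card (U ` carrier G) \<le> 1" using card_mono[of "{Q}"] by simp
    then show False using cardU by simp
  qed
  then obtain z where z: "z \<in> carrier G" "U z \<noteq> Q" by blast
  define D where "D = Q \<inter> U z"
  have D3: "card D = 3" and Dcent: "carrier G \<subseteq> centralizer G D"
    using order36_intersection[OF fin ord Q N Us(1)[OF z(1)] Us(2)[OF z(1)] z(2)] by (auto simp: D_def)
  have Dsub: "subgroup D G" unfolding D_def by (rule subgroups_Inter_pair[OF Q(1) Us(1)[OF z(1)]])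
  interpret D: subgroup D G by (rule Dsub)
  have comm: "x \<otimes> d = d \<otimes> x" if "x \<in> carrier G" "d \<in> D" for x d
    using Dcent that by (auto simp: centralizer_def)
  have DU: "D \<subseteq> U x" if x: "x \<in> carrier G" for x
  proof
    fix d assume d: "d \<in> D"
    have "conj_by G (inv x) d = d" using comm[of "inv x" d] x d by (simp add: conj_by_def m_assoc)
    then show "d \<in> U x" unfolding U_def using d by (metis D_def Int_iff imageI)
  qed
  have inter: "S \<inter> T = D" if ST: "S \<in> U ` carrier G" "T \<in> U ` carrier G" "S \<noteq> T" for S T
  proof -
    obtain x y where xy: "x \<in> carrier G" "y \<in> carrier G" "S = U x" "T = U y" using ST by blast
    have fS: "finite S" using subgroup.subset[OF Us(1)[OF xy(1)]] xy(3) fin finite_subset by auto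
    have I: "subgroup (S \<inter> T) G" unfolding xy(3,4) by (rule subgroups_Inter_pair[OF Us(1) Us(1)]) (use xy in auto)
    have "card (S \<inter> T) dvd 3^2" using card_subgroup_dvd[OF I Us(1)[OF xy(1)]] Us(2)[OF xy(1)] xy(3) by simp
    then obtain i where i: "i \<le> 2" "card (S \<inter> T) = 3^i" using three by (auto simp only: divides_primepow_nat)
    have sub: "D \<subseteq> S \<inter> T" using DU xy by blast
    then have "3 \<le> card (S \<inter> T)" using card_mono[of "S \<inter> T" D] fS D3 by simp
    then have "i \<noteq> 0" using i by (intro notI) simp
    moreover have "i \<noteq> 2"
    proof
      assume "i = 2"
      then have c9: "card (S \<inter> T) = 9" using i(2) by simp
      have fT: "finite T" using subgroup.subset[OF Us(1)[OF xy(2)]] xy(4) fin finite_subset by auto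
      have "S \<inter> T = S" by (rule card_subset_eq[OF fS]) (use c9 Us(2)[OF xy(1)] xy(3) in auto)
      moreover have "S \<inter> T = T" by (rule card_subset_eq[OF fT]) (use c9 Us(2)[OF xy(2)] xy(4) in auto)
      ultimately show False using ST(3) by blast
    qed
    ultimately have "card (S \<inter> T) = 3" using i by (cases "i = 1") auto
    then show ?thesis using card_subset_eq[OF _ sub] fS D3 by simp
  qed
  define V where "V = \<Union>(U ` carrier G)"
  have pow9: "v [^] (9::nat) = \<one>" "v \<in> carrier G" if v: "v \<in> V" for v
  proof -
    obtain x where x: "x \<in> carrier G" "v \<in> U x" using v by (auto simp: V_def)
    show vc: "v \<in> carrier G" using subgroup.subset[OF Us(1)[OF x(1)]] x(2) by blast
    have "ord v dvd 9" using ord_dvd_card_subgroup[OF Us(1)[OF x(1)] x(2)] Us(2)[OF x(1)] by simp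
    then show "v [^] (9::nat) = \<one>" using pow_eq_id[OF vc] by simp
  qed
  have finD: "finite D" using D3 card.infinite by force
  have Vc: "card V = 27"
  proof -
    have V: "V = D \<union> (\<Union>S\<in>U ` carrier G. S - D)" using DU one_closed unfolding V_def by blast
    have "card (\<Union>S\<in>U ` carrier G. S - D) = (\<Sum>S\<in>U ` carrier G. card (S - D))"
    proof (rule card_UN_disjoint)
      show "finite (U ` carrier G)" using fin by simp
      show "\<forall>S\<in>U ` carrier G. finite (S - D)"
        using subgroup.subset[OF Us(1)] fin finite_subset by blast
      show "\<forall>S\<in>U ` carrier G. \<forall>T\<in>U ` carrier G. S \<noteq> T \<longrightarrow> (S - D) \<inter> (T - D) = {}"
        using inter by blast
    qed
    also have "\<dots> = (\<Sum>S\<in>U ` carrier G. 6)"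
    proof (rule sum.cong[OF refl])
      fix S assume "S \<in> U ` carrier G"
      then obtain x where x: "x \<in> carrier G" "S = U x" by blast
      then show "card (S - D) = 6" using card_Diff_subset[OF finD DU[OF x(1)]] Us(2)[OF x(1)] D3 by simp
    qed
    also have "\<dots> = 24" using cardU by simp
    finally have c: "card (\<Union>S\<in>U ` carrier G. S - D) = 24" .
    then have "finite (\<Union>S\<in>U ` carrier G. S - D)" by (metis card.infinite zero_neq_numeral)
    then have "card (D \<union> (\<Union>S\<in>U ` carrier G. S - D)) = 3 + 24"
      using finD c D3 by (subst card_Un_disjoint) auto
    then show ?thesis using V by simp
  qed
  obtain P where P: "subgroup P G" "card P = 4"
    using sylow_thm[of 2 G 2 9] is_group fin ord by auto
  interpret P: subgroup P G by (rule P)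
  have finP: "finite P" using P(2) card.infinite by force
  have Ppow: "x [^] (4::nat) = \<one>" if x: "x \<in> P" for x
  proof -
    have "ord x dvd 4" using ord_dvd_card_subgroup[OF P(1) x] P(2) by simp
    then show ?thesis using pow_eq_id x by simp
  qed
  have Dpow: "d [^] (3::nat) = \<one>" if d: "d \<in> D" for d
  proof -
    have "ord d dvd 3" using ord_dvd_card_subgroup[OF Dsub d] D3 by simp
    then show ?thesis using pow_eq_id d by simp
  qed
  have mult_pow: "(x \<otimes> d) [^] (n::nat) = x [^] n \<otimes> d [^] n" if "x \<in> P" "d \<in> D" for x d n
    using that by (intro pow_mult_distrib comm) auto
  have x9: "x [^] (9::nat) = x" if x: "x \<in> P" for x
  proof -
    have "x [^] (4 * 2 + 1::nat) = (x [^] (4::nat)) [^] (2::nat) \<otimes> x"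
      using x by (simp only: nat_pow_mult[symmetric] nat_pow_pow[symmetric] P.mem_carrier nat_pow_eone nat_pow_closed)
    then show ?thesis using Ppow[OF x] x by simp
  qed
  have d9: "d [^] (9::nat) = \<one>" if d: "d \<in> D" for d
    using pow_eq_id[of d 9] pow_eq_id[of d 3] Dpow[OF d] d dvd_trans[of "ord d" 3 9] by simp
  have d4: "d [^] (4::nat) = d" if d: "d \<in> D" for d
  proof -
    have "d [^] (3 + 1::nat) = d [^] (3::nat) \<otimes> d"
      using d by (simp only: nat_pow_mult[symmetric] D.mem_carrier nat_pow_eone)
    then show ?thesis using Dpow[OF d] d by simp
  qed
  define W where "W = (\<lambda>(x, d). x \<otimes> d) ` ((P - {\<one>}) \<times> D)"
  have PD: "P \<inter> D \<subseteq> {\<one>}"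
  proof
    fix x assume "x \<in> P \<inter> D"
    then have "x = x [^] (9::nat)" "x [^] (9::nat) = \<one>" using x9[of x] d9[of x] by auto
    then show "x \<in> {\<one>}" by simp
  qed
  have Wc: "card W = 9"
  proof -
    have "inj_on (\<lambda>(x, d). x \<otimes> d) ((P - {\<one>}) \<times> D)"
      by (rule inj_on_subset[OF inj_on_subgroup_product[OF P(1) Dsub PD]]) blast
    then show ?thesis
      using P(2) D3 finP unfolding W_def by (simp add: card_image card_cartesian_product card_Diff_singleton)
  qed
  have WV: "W \<inter> V = {}"
  proof (rule ccontr)
    assume "W \<inter> V \<noteq> {}"
    then obtain x d where xd: "x \<in> P" "x \<noteq> \<one>" "d \<in> D" "x \<otimes> d \<in> V" by (auto simp: W_def)
    have "(x \<otimes> d) [^] (9::nat) = x" using mult_pow[OF xd(1,3), of 9] x9[OF xd(1)] d9[OF xd(3)] xd by simp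
    then show False using pow9(1)[OF xd(4)] xd(2) by simp
  qed
  have finV: "finite V" "finite W" using Vc Wc card.infinite by force+
  have WVc: "card (W \<union> V) = 36" using card_Un_disjoint[OF finV(2,1) WV] Vc Wc by simp
  have "W \<union> V \<subseteq> carrier G" using pow9(2) by (auto simp: W_def)
  then have full: "W \<union> V = carrier G" using WVc ord fin by (intro card_subset_eq) (auto simp: order_def)
  have Pchar: "y \<in> P" if y: "y \<in> carrier G" "y [^] (4::nat) = \<one>" for y
  proof (cases "y \<in> W")
    case True
    then obtain x d where xd: "x \<in> P" "d \<in> D" "y = x \<otimes> d" by (auto simp: W_def)
    have "y [^] (4::nat) = d" using mult_pow[OF xd(1,2), of 4] Ppow[OF xd(1)] d4[OF xd(2)] xd by simp
    then show ?thesis using xd y by simp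
  next
    case False
    then have "y [^] (9::nat) = \<one>" using full y(1) pow9(1) by blast
    then have d: "ord y dvd 9" "ord y dvd 4" using y(2) pow_eq_id[OF y(1)] by blast+
    have "ord y dvd 9 - 4 * 2" by (rule dvd_diff_nat[OF d(1) dvd_mult2[OF d(2)]])
    then show ?thesis using ord_eq_1[OF y(1)] by simp
  qed
  have "P \<lhd> G"
  proof (rule normal_invI[OF P(1)])
    fix x h assume xh: "x \<in> carrier G" "h \<in> P"
    have "(x \<otimes> h \<otimes> inv x) [^] (4::nat) = conj_by G x (h [^] (4::nat))"
      using conj_by_pow[OF xh(1), of h 4] xh by (simp add: conj_by_def)
    also have "\<dots> = \<one>" using Ppow[OF xh(2)] xh by (simp add: conj_by_def)
    finally show "x \<otimes> h \<otimes> inv x \<in> P" using xh by (intro Pchar) auto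
  qed
  then show ?thesis using P(2) by blast
qed

section \<open>Automorphisms of cyclic groups\<close>

definition unit_group :: "nat \<Rightarrow> nat monoid" where
  "unit_group m = \<lparr>carrier = totatives m, mult = (\<lambda>x y. x * y mod m), one = 1\<rparr>"

text \<open>The action on the first coordinate of \<^term>\<open>Zprod m 1\<close>, whose second coordinate is always 0.\<close>

definition unit_act :: "nat \<Rightarrow> nat \<Rightarrow> int \<times> int \<Rightarrow> int \<times> int" where
  "unit_act m u = (\<lambda>(x, y). ((int u * x) mod int m, y))"

lemma unit_group_simps [simp]:
  "carrier (unit_group m) = totatives m" "x \<otimes>\<^bsub>unit_group m\<^esub> y = x * y mod m" "\<one>\<^bsub>unit_group m\<^esub> = 1"
  by (simp_all add: unit_group_def)

lemma mod_in_totatives: "1 < m \<Longrightarrow> coprime x m \<Longrightarrow> x mod m \<in> totatives m"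
proof -
  assume m: "1 < m" and c: "coprime x m"
  have "x mod m \<noteq> 0"
  proof
    assume "x mod m = 0"
    then have "m dvd x" by (simp add: mod_0_imp_dvd)
    then show False using coprime_common_divisor_nat[OF c, of m] m by simp
  qed
  then show ?thesis using m c by (simp add: totatives_def less_imp_le)
qed

lemma group_unit_group:
  assumes "1 < m" shows "group (unit_group m)"
proof (rule groupI)
  fix x assume "x \<in> carrier (unit_group m)"
  then have "coprime x m" by (simp add: totatives_def)
  then obtain y where y: "[x * y = 1] (mod m)" using cong_solve_coprime_nat[of x m] by auto
  then have "coprime y m" by (metis cong_imp_coprime cong_sym coprime_1_left coprime_mult_left_iff)
  then show "\<exists>y\<in>carrier (unit_group m). y \<otimes>\<^bsub>unit_group m\<^esub> x = \<one>\<^bsub>unit_group m\<^esub>"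
    using y assms mod_in_totatives[OF assms] by (intro bexI[of _ "y mod m"]) (auto simp: cong_def mod_simps mult.commute)
next
  fix x y assume "x \<in> carrier (unit_group m)" "y \<in> carrier (unit_group m)"
  then show "x \<otimes>\<^bsub>unit_group m\<^esub> y \<in> carrier (unit_group m)"
    using mod_in_totatives[OF assms, of "x * y"] by (simp add: totatives_def)
next
  fix x assume "x \<in> carrier (unit_group m)"
  then show "\<one>\<^bsub>unit_group m\<^esub> \<otimes>\<^bsub>unit_group m\<^esub> x = x"
    using totatives_less[of x m] assms by simp
qed (use assms in \<open>auto simp: mod_simps mult.assoc\<close>)

lemma pow_unit_group: "1 < m \<Longrightarrow> x [^]\<^bsub>unit_group m\<^esub> (k::nat) = x ^ k mod m"
  by (induction k) (auto simp: mod_simps mult.commute)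

text \<open>An endomorphism of a cyclic group is determined by the image of the generator, and it is
  bijective if and only if that image is a unit.\<close>

lemma full_action_unit_group:
  assumes m: "1 < m"
  shows "full_action (Zprod m 1) (unit_group m) (unit_act m)"
proof -
  interpret Z: comm_group "Zprod m 1" by (rule comm_group_Zprod)
  interpret U: group "unit_group m" by (rule group_unit_group[OF m])
  have Z: "carrier (Zprod m 1) = {0..<int m} \<times> {0..<1}" using m carrier_Zprod[of m 1] by simp
  have Zm: "(x, y) \<otimes>\<^bsub>Zprod m 1\<^esub> (x', y') = ((x + x') mod int m, (y + y') mod 1)" for x y x' y'
    using mult_Zprod[of m 1 x y x' y'] by simp
  have one: "(1, 0) \<in> carrier (Zprod m 1)" unfolding Z using m by simp
  show ?thesis
  proof (unfold_locales)
    show "finite (carrier (Zprod m 1))" using m by (intro finite_Zprod) auto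
    show "finite (carrier (unit_group m))" by simp
  next
    fix u assume u: "u \<in> carrier (unit_group m)"
    then have cop: "coprime (int u) (int m)" by (simp add: totatives_def)
    have into: "unit_act m u z \<in> carrier (Zprod m 1)" if "z \<in> carrier (Zprod m 1)" for z
      using that m unfolding Z unit_act_def by (auto split: prod.splits)
    have "unit_act m u \<in> hom (Zprod m 1) (Zprod m 1)"
      by (rule homI) (use into in \<open>auto simp: unit_act_def Zm mod_simps algebra_simps\<close>)
    moreover have inj: "inj_on (unit_act m u) (carrier (Zprod m 1))"
    proof (rule inj_onI)
      fix z z' assume z: "z \<in> carrier (Zprod m 1)" "z' \<in> carrier (Zprod m 1)" "unit_act m u z = unit_act m u z'"
      then have "[int u * fst z = int u * fst z'] (mod int m)"
        by (auto simp: unit_act_def cong_def split: prod.splits)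
      then have "[fst z = fst z'] (mod int m)" using cop by (simp add: cong_mult_lcancel)
      then show "z = z'" using z(1,2) unfolding Z by (auto simp: cong_def prod_eq_iff)
    qed
    moreover have "unit_act m u ` carrier (Zprod m 1) = carrier (Zprod m 1)"
      using inj into m by (intro endo_inj_surj finite_Zprod) auto
    ultimately show "unit_act m u \<in> iso (Zprod m 1) (Zprod m 1)" by (simp add: iso_def bij_betw_def)
  next
    fix u v z assume "u \<in> carrier (unit_group m)" "v \<in> carrier (unit_group m)" "z \<in> carrier (Zprod m 1)"
    then show "unit_act m (u \<otimes>\<^bsub>unit_group m\<^esub> v) z = unit_act m u (unit_act m v z)"
      by (auto simp: unit_act_def zmod_int mod_simps mult.assoc split: prod.splits)
  next
    fix u v assume uv: "u \<in> carrier (unit_group m)" "v \<in> carrier (unit_group m)"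
      and eq: "\<And>z. z \<in> carrier (Zprod m 1) \<Longrightarrow> unit_act m u z = unit_act m v z"
    have "int u mod int m = int v mod int m" using eq[OF one] by (simp add: unit_act_def)
    then have "u mod m = v mod m" by (metis of_nat_eq_iff zmod_int)
    moreover have "u < m" "v < m" using uv m totatives_less by auto
    ultimately show "u = v" by simp
  next
    fix f assume f: "f \<in> iso (Zprod m 1) (Zprod m 1)"
    interpret f: group_hom "Zprod m 1" "Zprod m 1" f using f by unfold_locales (auto simp: iso_def)
    have "f (1, 0) \<in> carrier (Zprod m 1)" using one by (rule f.hom_closed)
    then obtain a where a: "f (1, 0) = (a, 0)" "0 \<le> a" "a < int m" unfolding Z by force
    have fz: "f z = ((a * fst z) mod int m, snd z)" if z: "z \<in> carrier (Zprod m 1)" for z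
    proof -
      have "0 \<le> fst z" "snd z = 0" using z unfolding Z by auto
      have "f z = f ((1, 0) [^]\<^bsub>Zprod m 1\<^esub> nat (fst z))" using Zprod_gen[OF _ z] m by simp
      also have "\<dots> = (a, 0) [^]\<^bsub>Zprod m 1\<^esub> nat (fst z)" using f.hom_nat_pow[OF one] a(1) by simp
      also have "\<dots> = ((a * fst z) mod int m, 0)" using pow_Zprod[of m 1 a 0] m \<open>0 \<le> fst z\<close> by (simp add: mult.commute)
      finally show ?thesis using \<open>snd z = 0\<close> by simp
    qed
    have "(1, 0) \<in> f ` carrier (Zprod m 1)" using f one by (auto simp: iso_def bij_betw_def)
    then obtain z where "z \<in> carrier (Zprod m 1)" "f z = (1, 0)" by force
    then have "(a * fst z) mod int m = 1" using fz by (metis fst_conv)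
    then have "[a * fst z = 1] (mod int m)" using m by (simp add: cong_def)
    then have cop: "coprime a (int m)" using coprime_iff_invertible_int by blast
    define u where "u = nat a"
    have u: "int u = a" using a by (simp add: u_def)
    have "coprime u m" using cop unfolding u[symmetric] by simp
    then have "u mod m \<in> totatives m" using mod_in_totatives m by blast
    moreover have "u mod m = u" using a(3) u by simp
    ultimately have "u \<in> carrier (unit_group m)" by simp
    then show "\<exists>u\<in>carrier (unit_group m). \<forall>z\<in>carrier (Zprod m 1). unit_act m u z = f z"
      using fz by (intro bexI[of _ u]) (auto simp: unit_act_def u)
  qed
qed

section \<open>Two by two matrices\<close>

text \<open>Integer matrices form a ring, so that matrix identities are checked by computation over the
  integers and reduced modulo \<open>n\<close> only afterwards.\<close>

datatype mat2 = Mat (e11: int) (e12: int) (e21: int) (e22: int)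

instantiation mat2 :: ring_1
begin
definition "0 = Mat 0 0 0 0"
definition "1 = Mat 1 0 0 1"
definition "A + B = Mat (e11 A + e11 B) (e12 A + e12 B) (e21 A + e21 B) (e22 A + e22 B)"
definition "A - B = Mat (e11 A - e11 B) (e12 A - e12 B) (e21 A - e21 B) (e22 A - e22 B)"
definition "- A = Mat (- e11 A) (- e12 A) (- e21 A) (- e22 A)"
definition "A * B = Mat (e11 A * e11 B + e12 A * e21 B) (e11 A * e12 B + e12 A * e22 B)
  (e21 A * e11 B + e22 A * e21 B) (e21 A * e12 B + e22 A * e22 B)"
instance
  by standard (simp_all add: zero_mat2_def one_mat2_def plus_mat2_def minus_mat2_def uminus_mat2_def
      times_mat2_def algebra_simps mat2.expand)
end

lemma mat2_simps [simp]:
  "Mat a b c d + Mat a' b' c' d' = Mat (a + a') (b + b') (c + c') (d + d')"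
  "Mat a b c d * Mat a' b' c' d' = Mat (a * a' + b * c') (a * b' + b * d') (c * a' + d * c') (c * b' + d * d')"
  by (simp_all add: plus_mat2_def times_mat2_def)

lemma e_one [simp]: "e11 1 = 1" "e12 1 = 0" "e21 1 = 0" "e22 1 = 1"
  by (simp_all add: one_mat2_def)

definition tr2 :: "mat2 \<Rightarrow> int" where "tr2 A = e11 A + e22 A"
definition det2 :: "mat2 \<Rightarrow> int" where "det2 A = e11 A * e22 A - e12 A * e21 A"

lemma tr2_Mat [simp]: "tr2 (Mat a b c d) = a + d" by (simp add: tr2_def)
lemma det2_Mat [simp]: "det2 (Mat a b c d) = a * d - b * c" by (simp add: det2_def)

lemma det2_mult: "det2 (A * B) = det2 A * det2 B"
  by (simp add: det2_def times_mat2_def algebra_simps)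

lemma tr2_mult_commute: "tr2 (A * B) = tr2 (B * A)"
  by (simp add: tr2_def times_mat2_def algebra_simps)

text \<open>The canonical representative modulo \<open>n\<close>, with entries in \<open>{0..<n}\<close>: matrices over the integers
  modulo \<open>n\<close> are the fixed points of this map.\<close>

definition redm :: "nat \<Rightarrow> mat2 \<Rightarrow> mat2" where
  "redm n A = Mat (e11 A mod int n) (e12 A mod int n) (e21 A mod int n) (e22 A mod int n)"

lemma redm_eq_iff: "redm n A = redm n B \<longleftrightarrow> [e11 A = e11 B] (mod int n) \<and> [e12 A = e12 B] (mod int n) \<and>
    [e21 A = e21 B] (mod int n) \<and> [e22 A = e22 B] (mod int n)"
  by (simp add: redm_def cong_def)

lemma redm_redm [simp]: "redm n (redm n A) = redm n A"
  by (simp add: redm_def)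

lemma redm_mult [simp]: "redm n (redm n A * B) = redm n (A * B)" "redm n (A * redm n B) = redm n (A * B)"
  unfolding redm_eq_iff by (simp_all add: redm_def times_mat2_def cong_add cong_mult)

lemma redm_add [simp]: "redm n (redm n A + B) = redm n (A + B)" "redm n (A + redm n B) = redm n (A + B)"
  unfolding redm_eq_iff by (simp_all add: redm_def plus_mat2_def cong_add)

lemma cong_det2_redm: "[det2 (redm n A) = det2 A] (mod int n)"
  by (simp add: redm_def det2_def cong_diff cong_mult)

lemma cong_tr2_redm: "[tr2 (redm n A) = tr2 A] (mod int n)"
  by (simp add: redm_def tr2_def cong_add)

lemma redm_det2_cong: "redm n A = redm n B \<Longrightarrow> [det2 A = det2 B] (mod int n)"
  using cong_trans[OF cong_sym[OF cong_det2_redm[of n A]], of "det2 B"] cong_det2_redm[of n B] by simp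

lemma redm_tr2_cong: "redm n A = redm n B \<Longrightarrow> [tr2 A = tr2 B] (mod int n)"
  using cong_trans[OF cong_sym[OF cong_tr2_redm[of n A]], of "tr2 B"] cong_tr2_redm[of n B] by simp

lemma coprime_det2_redm [simp]: "coprime (det2 (redm n A)) (int n) \<longleftrightarrow> coprime (det2 A) (int n)"
  using cong_imp_coprime[OF cong_det2_redm[of n A]] cong_imp_coprime[OF cong_sym[OF cong_det2_redm[of n A]]]
  by blast

definition gl2 :: "nat \<Rightarrow> mat2 monoid" where
  "gl2 n = \<lparr>carrier = {A. redm n A = A \<and> coprime (det2 A) (int n)}, mult = (\<lambda>A B. redm n (A * B)), one = redm n 1\<rparr>"

lemma carrier_gl2: "A \<in> carrier (gl2 n) \<longleftrightarrow> redm n A = A \<and> coprime (det2 A) (int n)"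
  and mult_gl2 [simp]: "A \<otimes>\<^bsub>gl2 n\<^esub> B = redm n (A * B)" and one_gl2: "\<one>\<^bsub>gl2 n\<^esub> = redm n 1"
  by (simp_all add: gl2_def)

lemma redm_in_gl2: "coprime (det2 A) (int n) \<Longrightarrow> redm n A \<in> carrier (gl2 n)"
  by (simp add: carrier_gl2)

lemma redm_carrier [simp]: "A \<in> carrier (gl2 n) \<Longrightarrow> redm n A = A"
  by (simp add: carrier_gl2)

lemma finite_gl2: "0 < n \<Longrightarrow> finite (carrier (gl2 n))"
proof -
  assume n: "0 < n"
  have "carrier (gl2 n) \<subseteq> (\<lambda>(a, b, c, d). Mat a b c d) ` ({0..<int n} \<times> {0..<int n} \<times> {0..<int n} \<times> {0..<int n})"
  proof
    fix A assume "A \<in> carrier (gl2 n)"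
    then have "A = (\<lambda>(a, b, c, d). Mat a b c d) (e11 A mod int n, e12 A mod int n, e21 A mod int n, e22 A mod int n)"
      by (simp add: carrier_gl2 redm_def)
    then show "A \<in> (\<lambda>(a, b, c, d). Mat a b c d) ` ({0..<int n} \<times> {0..<int n} \<times> {0..<int n} \<times> {0..<int n})"
      by (rule image_eqI) (use n in auto)
  qed
  then show ?thesis by (rule finite_subset) simp
qed

definition adj2 :: "mat2 \<Rightarrow> mat2" where "adj2 A = Mat (e22 A) (- e12 A) (- e21 A) (e11 A)"

lemma adj2_mult: "Mat e 0 0 e * adj2 A * A = Mat (e * det2 A) 0 0 (e * det2 A)"
  by (cases A) (simp add: adj2_def algebra_simps)

lemma group_gl2: "group (gl2 n)"
proof (rule groupI)
  fix A assume A: "A \<in> carrier (gl2 n)"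
  then obtain e where e: "[det2 A * e = 1] (mod int n)" using coprime_iff_invertible_int carrier_gl2 by blast
  have "coprime e (int n)" using e coprime_iff_invertible_int by (metis mult.commute)
  moreover have "det2 (adj2 A) = det2 A" by (cases A) (simp add: adj2_def algebra_simps)
  ultimately have c: "coprime (det2 (Mat e 0 0 e * adj2 A)) (int n)"
    using A by (simp add: det2_mult carrier_gl2)
  have "redm n (redm n (Mat e 0 0 e * adj2 A) * A) = redm n 1"
    using e by (simp add: adj2_mult redm_eq_iff mult.commute)
  then show "\<exists>B\<in>carrier (gl2 n). B \<otimes>\<^bsub>gl2 n\<^esub> A = \<one>\<^bsub>gl2 n\<^esub>"
    using redm_in_gl2[OF c] by (intro bexI[of _ "redm n (Mat e 0 0 e * adj2 A)"]) (simp_all add: one_gl2)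
qed (auto simp: carrier_gl2 det2_mult one_gl2 mult.assoc det2_def[of 1])

lemma pow_gl2: "A [^]\<^bsub>gl2 n\<^esub> (k::nat) = redm n (A ^ k)"
proof (induction k)
  case 0
  show ?case using nat_pow_0[of "gl2 n" A] by (simp add: one_gl2)
next
  case (Suc k)
  have "A [^]\<^bsub>gl2 n\<^esub> (Suc k) = redm n (A [^]\<^bsub>gl2 n\<^esub> k * A)" using nat_pow_Suc[of "gl2 n" A k] by simp
  then show ?case by (simp add: Suc.IH power_commutes)
qed

text \<open>To conjugate matrices it is enough to intertwine them by a matrix with invertible determinant.\<close>

lemma gl2_conjI:
  assumes A: "A \<in> carrier (gl2 n)" and B: "B \<in> carrier (gl2 n)" and T: "coprime (det2 T) (int n)"
    and eq: "redm n (A * T) = redm n (T * B)"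
  shows "\<exists>h\<in>carrier (gl2 n). conj_by (gl2 n) h B = A"
proof -
  interpret group "gl2 n" by (rule group_gl2)
  have T': "redm n T \<in> carrier (gl2 n)" by (rule redm_in_gl2[OF T])
  have "redm n T \<otimes>\<^bsub>gl2 n\<^esub> B = A \<otimes>\<^bsub>gl2 n\<^esub> redm n T" using eq by simp
  then have "conj_by (gl2 n) (redm n T) B = A"
    unfolding conj_by_def using inv_solve_right'[OF A _ T', of "redm n T \<otimes>\<^bsub>gl2 n\<^esub> B"] T' B m_closed by metis
  then show ?thesis using T' by blast
qed

lemma gl2_conj_invariants:
  assumes "h \<in> carrier (gl2 n)" "A \<in> carrier (gl2 n)"
  shows "[tr2 (conj_by (gl2 n) h A) = tr2 A] (mod int n)" "[det2 (conj_by (gl2 n) h A) = det2 A] (mod int n)"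
proof -
  interpret group "gl2 n" by (rule group_gl2)
  let ?i = "inv\<^bsub>gl2 n\<^esub> h"
  have i: "redm n (?i * h) = redm n 1" using l_inv[OF assms(1)] by (simp add: one_gl2)
  have c: "conj_by (gl2 n) h A = redm n (h * A * ?i)" by (simp add: conj_by_def)
  have "redm n (?i * (h * A)) = redm n A"
    using arg_cong[OF i, of "\<lambda>X. redm n (X * A)"] by (simp add: mult.assoc)
  note r = redm_tr2_cong[OF this] redm_det2_cong[OF this]
  have "tr2 (?i * (h * A)) = tr2 (h * A * ?i)" by (rule tr2_mult_commute)
  with r(1) show "[tr2 (conj_by (gl2 n) h A) = tr2 A] (mod int n)"
    unfolding c by (intro cong_trans[OF cong_tr2_redm]) simp
  have "det2 (?i * (h * A)) = det2 (h * A * ?i)" by (simp add: det2_mult)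
  with r(2) show "[det2 (conj_by (gl2 n) h A) = det2 A] (mod int n)"
    unfolding c by (intro cong_trans[OF cong_det2_redm]) simp
qed

definition gl2_act :: "nat \<Rightarrow> mat2 \<Rightarrow> int \<times> int \<Rightarrow> int \<times> int" where
  "gl2_act n A = (\<lambda>(x, y). ((e11 A * x + e12 A * y) mod int n, (e21 A * x + e22 A * y) mod int n))"

lemma gl2_act_mult: "gl2_act n (redm n (A * B)) z = gl2_act n A (gl2_act n B z)"
proof -
  obtain x y where z: "z = (x, y)" by fastforce
  have dot: "((u mod int n) * x + (v mod int n) * y) mod int n = (u * x + v * y) mod int n"
    "(u * (x mod int n) + v * (y mod int n)) mod int n = (u * x + v * y) mod int n" for u v x y
    by (fold cong_def) (simp_all add: cong_add cong_mult)
  show ?thesis unfolding z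
    by (simp add: gl2_act_def redm_def times_mat2_def dot) (simp add: algebra_simps)
qed

text \<open>An endomorphism of \<open>Zprod n n\<close> is given by the images of the two unit vectors, the columns of its
  matrix; it is bijective precisely if its determinant is a unit.\<close>

lemma full_action_gl2:
  assumes n: "1 < n"
  shows "full_action (Zprod n n) (gl2 n) (gl2_act n)"
proof -
  interpret Z: comm_group "Zprod n n" by (rule comm_group_Zprod)
  interpret A: group "gl2 n" by (rule group_gl2)
  have Z: "carrier (Zprod n n) = {0..<int n} \<times> {0..<int n}" using n carrier_Zprod[of n n] by simp
  have e: "(1, 0) \<in> carrier (Zprod n n)" "(0, 1) \<in> carrier (Zprod n n)" unfolding Z using n by auto
  have dot: "[a * (x mod int n) + b * (y mod int n) = a * x + b * y] (mod int n)" for a b x y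
    by (simp add: cong_add cong_mult)
  have into: "gl2_act n B z \<in> carrier (Zprod n n)" for B z
    using n unfolding Z gl2_act_def by (auto split: prod.splits)
  have id: "gl2_act n (redm n 1) z = z" if "z \<in> carrier (Zprod n n)" for z
    using that n unfolding Z gl2_act_def redm_def by (auto split: prod.splits)
  have eqI: "redm n B = redm n C" if "gl2_act n B (1, 0) = gl2_act n C (1, 0)" "gl2_act n B (0, 1) = gl2_act n C (0, 1)" for B C
    using that by (simp add: gl2_act_def redm_def)
  have lin: "\<exists>B. redm n B = B \<and> (\<forall>z\<in>carrier (Zprod n n). f z = gl2_act n B z)"
    if f: "f \<in> hom (Zprod n n) (Zprod n n)" for f
  proof -
    interpret f: group_hom "Zprod n n" "Zprod n n" f using f by unfold_locales
    obtain a c where ac: "f (1, 0) = (a, c)" by fastforce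
    obtain b d where bd: "f (0, 1) = (b, d)" by fastforce
    have acc: "(a, c) \<in> carrier (Zprod n n)" "(b, d) \<in> carrier (Zprod n n)"
      using f.hom_closed[OF e(1)] f.hom_closed[OF e(2)] ac bd by auto
    have "f z = gl2_act n (Mat a b c d) z" if z: "z \<in> carrier (Zprod n n)" for z
    proof -
      obtain x y where xy: "z = (int x, int y)" "int x < int n" "int y < int n"
      proof (rule that[of "nat (fst z)" "nat (snd z)"])
        show "z = (int (nat (fst z)), int (nat (snd z)))" "int (nat (fst z)) < int n" "int (nat (snd z)) < int n"
          using z unfolding Z by (cases z; simp)+
      qed
      have n0: "0 < n" using n by simp
      have "z = (1, 0) [^]\<^bsub>Zprod n n\<^esub> x \<otimes>\<^bsub>Zprod n n\<^esub> (0, 1) [^]\<^bsub>Zprod n n\<^esub> y"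
        using xy by (simp add: pow_Zprod[OF n0 n0])
      then have "f z = f (1, 0) [^]\<^bsub>Zprod n n\<^esub> x \<otimes>\<^bsub>Zprod n n\<^esub> f (0, 1) [^]\<^bsub>Zprod n n\<^esub> y"
        using e by (simp only: f.hom_mult f.hom_nat_pow Z.nat_pow_closed)
      also have "\<dots> = gl2_act n (Mat a b c d) z"
        unfolding ac bd xy(1) by (simp add: pow_Zprod[OF n0 n0] gl2_act_def mod_add_eq mult.commute)
      finally show ?thesis .
    qed
    moreover have "redm n (Mat a b c d) = Mat a b c d" using acc unfolding Z by (simp add: redm_def)
    ultimately show ?thesis by blast
  qed
  show ?thesis
  proof (unfold_locales)
    show "finite (carrier (Zprod n n))" using n by (intro finite_Zprod) auto
    show "finite (carrier (gl2 n))" using n by (intro finite_gl2) auto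
  next
    fix B assume B: "B \<in> carrier (gl2 n)"
    let ?i = "inv\<^bsub>gl2 n\<^esub> B"
    have "gl2_act n ?i (gl2_act n B z) = z" "gl2_act n B (gl2_act n ?i z) = z" if "z \<in> carrier (Zprod n n)" for z
      using A.l_inv[OF B] A.r_inv[OF B] id[OF that] by (simp_all add: one_gl2 flip: gl2_act_mult)
    then have "bij_betw (gl2_act n B) (carrier (Zprod n n)) (carrier (Zprod n n))"
      using into by (intro bij_betw_byWitness[where f' = "gl2_act n ?i"]) auto
    moreover have "gl2_act n B \<in> hom (Zprod n n) (Zprod n n)"
    proof (rule homI[OF into])
      fix z z' assume "z \<in> carrier (Zprod n n)" "z' \<in> carrier (Zprod n n)"
      obtain x y x' y' where z: "z = (x, y)" "z' = (x', y')" by fastforce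
      have "[a * ((x + x') mod int n) + b * ((y + y') mod int n)
          = (a * x + b * y) mod int n + (a * x' + b * y') mod int n] (mod int n)" for a b
        using dot[of a "x + x'" b "y + y'"] by (simp add: cong_def mod_add_eq algebra_simps)
      then show "gl2_act n B (z \<otimes>\<^bsub>Zprod n n\<^esub> z') = gl2_act n B z \<otimes>\<^bsub>Zprod n n\<^esub> gl2_act n B z'"
        unfolding z by (simp add: gl2_act_def cong_def)
    qed
    ultimately show "gl2_act n B \<in> iso (Zprod n n) (Zprod n n)" by (simp add: iso_def)
  next
    fix B C z show "gl2_act n (B \<otimes>\<^bsub>gl2 n\<^esub> C) z = gl2_act n B (gl2_act n C z)" by (simp add: gl2_act_mult)
  next
    fix B C assume B: "B \<in> carrier (gl2 n)" and C: "C \<in> carrier (gl2 n)"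
      and eq: "\<And>z. z \<in> carrier (Zprod n n) \<Longrightarrow> gl2_act n B z = gl2_act n C z"
    have "redm n B = redm n C" by (rule eqI[OF eq[OF e(1)] eq[OF e(2)]])
    then show "B = C" using B C by simp
  next
    fix f assume f: "f \<in> iso (Zprod n n) (Zprod n n)"
    define f' where "f' = inv_into (carrier (Zprod n n)) f"
    have f': "f' \<in> iso (Zprod n n) (Zprod n n)" unfolding f'_def by (rule Z.iso_set_sym[OF f])
    obtain B where B: "redm n B = B" "\<And>z. z \<in> carrier (Zprod n n) \<Longrightarrow> f z = gl2_act n B z"
      using lin[of f] f by (auto simp: iso_def)
    obtain C where C: "\<And>z. z \<in> carrier (Zprod n n) \<Longrightarrow> f' z = gl2_act n C z"
      using lin[of f'] f' by (auto simp: iso_def)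
    have ff': "f (f' z) = z" "f' z \<in> carrier (Zprod n n)" if "z \<in> carrier (Zprod n n)" for z
      using f that by (auto simp: f'_def iso_def bij_betw_def f_inv_into_f inv_into_into)
    have "gl2_act n (redm n (B * C)) z = gl2_act n (redm n 1) z" if "z \<in> carrier (Zprod n n)" for z
      using ff'[OF that] B(2)[OF ff'(2)[OF that]] C[OF that] id[OF that] by (simp add: gl2_act_mult)
    then have "redm n (redm n (B * C)) = redm n (redm n 1)" using eqI e by blast
    then have "[det2 (B * C) = det2 1] (mod int n)" by (intro redm_det2_cong) simp
    then have "[det2 B * det2 C = 1] (mod int n)" by (simp add: det2_mult det2_def[of 1])
    then have "B \<in> carrier (gl2 n)" using B(1) coprime_iff_invertible_int by (auto simp: carrier_gl2)
    then show "\<exists>B\<in>carrier (gl2 n). \<forall>z\<in>carrier (Zprod n n). gl2_act n B z = f z" using B(2) by auto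
  qed
qed

section \<open>Conjugacy of two by two matrices over a prime field\<close>

text \<open>The field with \<open>q\<close> elements appears as congruence modulo \<open>q\<close> on the integers.  A primitive root \<open>g\<close> is
  fixed because it serves twice: it supplies the roots of unity, and it is a non-square, which
  generates the quadratic extension.\<close>

locale odd_prime_field =
  fixes q :: nat and g :: int
  assumes q: "prime q" "2 < q"
    and root: "\<not> int q dvd a \<Longrightarrow> \<exists>i. [a = g ^ i] (mod int q)"
    and ord_g: "[g ^ i = 1] (mod int q) \<longleftrightarrow> (q - 1) dvd i"

lemma odd_prime_field_exists:
  assumes q: "prime q" "2 < q"
  shows "\<exists>g. odd_prime_field q g"
proof -
  have "odd q" using q prime_odd_nat by auto
  then obtain g where g: "\<forall>k>0. residue_primroot (q ^ k) g"
    using residue_primroot_odd_prime_power_exists[OF q(1)] by blast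
  then have pr: "residue_primroot q g" using g[rule_format, of 1] by simp
  have tot: "totient q = q - 1" using q totient_prime by blast
  have "odd_prime_field q (int g)"
  proof
    fix a :: int assume a: "\<not> int q dvd a"
    define b where "b = nat (a mod int q)"
    have b: "int b = a mod int q" using q by (simp add: b_def)
    have "b mod q \<in> totatives q"
    proof (rule mod_in_totatives)
      show "1 < q" using q by simp
      have "\<not> q dvd b"
      proof
        assume "q dvd b"
        then have "int q dvd a mod int q" unfolding b[symmetric] by simp
        then show False using a by (simp add: dvd_mod_iff)
      qed
      then show "coprime b q" using prime_imp_coprime[OF q(1)] coprime_commute by blast
    qed
    moreover have "b mod q = b" using b q by (metis mod_less mod_mod_trivial of_nat_eq_iff zmod_int)
    ultimately have "b \<in> (\<lambda>i. g ^ i mod q) ` {..<totient q}"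
      using residue_primroot_is_generator[OF _ pr] q by (simp add: bij_betw_def)
    then obtain i where "b = g ^ i mod q" by blast
    then have "a mod int q = int g ^ i mod int q" using b by (simp add: zmod_int)
    then show "\<exists>i. [a = int g ^ i] (mod int q)" by (auto simp: cong_def)
  next
    fix i
    have "[int g ^ i = 1] (mod int q) \<longleftrightarrow> [g ^ i = 1] (mod q)"
      by (metis cong_int_iff of_nat_1 of_nat_power)
    also have "\<dots> \<longleftrightarrow> (q - 1) dvd i"
      using pr tot ord_divides[of g i q] by (simp add: residue_primroot_def)
    finally show "[int g ^ i = 1] (mod int q) \<longleftrightarrow> (q - 1) dvd i" .
  qed (use q in auto)
  then show ?thesis ..
qed

context odd_prime_field begin

abbreviation GL where "GL \<equiv> gl2 q"
sublocale GL: group "gl2 q" by (rule group_gl2)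

lemma finGL: "finite (carrier GL)" using q by (intro finite_gl2) auto

lemma prime_int_q: "prime (int q)" using q by simp

lemma coprime_iff: "coprime a (int q) \<longleftrightarrow> \<not> int q dvd a"
  using prime_imp_coprime[OF prime_int_q, of a] prime_int_q
  by (metis coprime_absorb_left coprime_commute not_prime_unit)

lemma cancel: "\<not> int q dvd c \<Longrightarrow> [c * a = c * b] (mod int q) \<longleftrightarrow> [a = b] (mod int q)"
  by (simp add: cong_mult_lcancel coprime_iff)

lemma dvd_mult_iff: "int q dvd a * b \<longleftrightarrow> int q dvd a \<or> int q dvd b"
  using prime_dvd_mult_iff[OF prime_int_q] .

lemma not_dvd_power: "\<not> int q dvd a \<Longrightarrow> \<not> int q dvd a ^ n"
  using prime_dvd_power[OF prime_int_q] by blast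

lemma not_dvd_1: "\<not> int q dvd 1" using q by simp
lemma not_dvd_2: "\<not> int q dvd 2" using q zdvd_not_zless[of 2 "int q"] by simp
lemma not_dvd_4: "\<not> int q dvd 4" using not_dvd_2 dvd_mult_iff[of 2 2] by simp

lemma cong_1_not_dvd: "[a = 1] (mod int q) \<Longrightarrow> \<not> int q dvd a"
  using not_dvd_1 cong_dvd_iff by blast

lemma not_dvd_g: "\<not> int q dvd g"
proof
  assume "int q dvd g"
  moreover have "g dvd g ^ (q - 1)" using q by (intro dvd_power) auto
  ultimately have "int q dvd g ^ (q - 1)" by (rule dvd_trans)
  moreover have "[g ^ (q - 1) = 1] (mod int q)" using ord_g by simp
  ultimately show False using cong_1_not_dvd by blast
qed

text \<open>The primitive root \<open>g\<close> is not a square, so the norm form \<open>x\<^sup>2 - g y\<^sup>2\<close> is anisotropic.\<close>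

lemma norm_form:
  assumes "int q dvd x * x - g * (y * y)"
  shows "int q dvd x \<and> int q dvd y"
proof (rule ccontr)
  assume neg: "\<not> ?thesis"
  have c: "[x * x = g * (y * y)] (mod int q)" using assms by (simp add: cong_iff_dvd_diff)
  have y: "\<not> int q dvd y"
  proof
    assume "int q dvd y"
    then have "int q dvd x * x" using c cong_dvd_iff[OF c] by simp
    then show False using neg dvd_mult_iff \<open>int q dvd y\<close> by blast
  qed
  have x: "\<not> int q dvd x"
  proof
    assume "int q dvd x"
    then have "int q dvd g * (y * y)" using cong_dvd_iff[OF c] by simp
    then show False using y not_dvd_g dvd_mult_iff by blast
  qed
  obtain i where i: "[x = g ^ i] (mod int q)" using root[OF x] by blast
  obtain j where j: "[y = g ^ j] (mod int q)" using root[OF y] by blast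
  have gij: "[g ^ (2 * i) = g ^ (2 * j + 1)] (mod int q)"
  proof -
    have "[g ^ i * g ^ i = x * x] (mod int q)" by (intro cong_mult cong_sym[OF i])
    also have "[x * x = g * (y * y)] (mod int q)" by (rule c)
    also have "[g * (y * y) = g * (g ^ j * g ^ j)] (mod int q)" by (intro cong_mult j cong_refl)
    finally show ?thesis by (simp add: power_add mult_2)
  qed
  have ev: "even (q - 1)" using q prime_odd_nat[of q] by auto
  (* A multiple of q - 1 that exceeds 2 * i, so that the power of g can be moved across the
     congruence without inverses. *)
  define n where "n = (q - 1) * (i + j + 1)"
  have n1: "[g ^ n = 1] (mod int q)" unfolding n_def using ord_g by simp
  have big: "2 * i \<le> n"
  proof -
    have "2 \<le> q - 1" using q by simp
    then have "2 * (i + j + 1) \<le> (q - 1) * (i + j + 1)" by (rule mult_le_mono1)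
    then show ?thesis by (simp add: n_def)
  qed
  have "[g ^ (n - 2 * i) * g ^ (2 * i) = g ^ (n - 2 * i) * g ^ (2 * j + 1)] (mod int q)"
    by (rule cong_mult[OF cong_refl gij])
  then have "[g ^ n = g ^ (n - 2 * i + (2 * j + 1))] (mod int q)"
    using big by (simp only: power_add[symmetric]) simp
  then have "[g ^ (n - 2 * i + (2 * j + 1)) = 1] (mod int q)" by (rule cong_trans[OF cong_sym n1])
  then have "(q - 1) dvd n - 2 * i + (2 * j + 1)" using ord_g by blast
  then have "even (n - 2 * i + (2 * j + 1))" by (rule dvd_trans[OF ev])
  moreover have "even n" unfolding n_def using ev by simp
  ultimately show False using big by simp
qed

lemma half: "\<exists>h. [2 * h = 1] (mod int q)"
  using coprime_iff_invertible_int[of 2 "int q"] not_dvd_2 coprime_iff by blast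

definition scalar2 :: "mat2 \<Rightarrow> bool" where
  "scalar2 A \<longleftrightarrow> int q dvd e12 A \<and> int q dvd e21 A \<and> int q dvd e11 A - e22 A"

text \<open>A non-scalar matrix has a cyclic vector \<open>v\<close>; in the basis \<open>v, A v\<close> it becomes
  the companion matrix of its characteristic polynomial.\<close>

lemma companion:
  assumes "\<not> scalar2 A"
  shows "\<exists>T. coprime (det2 T) (int q) \<and> A * T = T * Mat 0 (- det2 A) 1 (tr2 A)"
proof -
  obtain a b c d where A: "A = Mat a b c d" by (cases A)
  show ?thesis
  proof (cases "int q dvd c")
    case False
    then show ?thesis unfolding A
      by (intro exI[of _ "Mat 1 a 0 c"]) (simp add: coprime_iff algebra_simps)
  next
    case c: True
    show ?thesis
    proof (cases "int q dvd b")
      case False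
      then show ?thesis unfolding A
        by (intro exI[of _ "Mat 0 b 1 d"]) (simp add: coprime_iff algebra_simps)
    next
      case b: True
      have "\<not> int q dvd a - d" using assms b c by (simp add: A scalar2_def)
      have "\<not> int q dvd (c + d) - (a + b)"
      proof
        assume "int q dvd (c + d) - (a + b)"
        then have "int q dvd c - b - ((c + d) - (a + b))" by (rule dvd_diff[OF dvd_diff[OF c b]])
        then show False using \<open>\<not> int q dvd a - d\<close> by simp
      qed
      then show ?thesis unfolding A
        by (intro exI[of _ "Mat 1 (a + b) 1 (c + d)"]) (simp add: coprime_iff algebra_simps)
    qed
  qed
qed

text \<open>Both matrices are conjugate to the same companion matrix.\<close>

lemma same_char_poly_conj:
  assumes A: "A \<in> carrier GL" "\<not> scalar2 A" and B: "B \<in> carrier GL" "\<not> scalar2 B"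
    and eq: "[tr2 A = tr2 B] (mod int q)" "[det2 A = det2 B] (mod int q)"
  shows "\<exists>h\<in>carrier GL. conj_by GL h A = B"
proof -
  let ?K = "redm q (Mat 0 (- det2 A) 1 (tr2 A))"
  have K: "?K = redm q (Mat 0 (- det2 B) 1 (tr2 B))"
    using eq by (simp add: redm_eq_iff cong_minus_minus_iff)
  have KC: "?K \<in> carrier GL" using A(1) by (intro redm_in_gl2) (simp add: carrier_gl2)
  obtain T where T: "coprime (det2 T) (int q)" "A * T = T * Mat 0 (- det2 A) 1 (tr2 A)"
    using companion[OF A(2)] by blast
  obtain S where S: "coprime (det2 S) (int q)" "B * S = S * Mat 0 (- det2 B) 1 (tr2 B)"
    using companion[OF B(2)] by blast
  have "redm q (A * T) = redm q (T * ?K)" using T(2) by simp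
  then obtain h where h: "h \<in> carrier GL" "conj_by GL h ?K = A"
    using gl2_conjI[OF A(1) KC T(1)] by blast
  have "redm q (B * S) = redm q (S * ?K)" unfolding K using S(2) by simp
  then obtain k where k: "k \<in> carrier GL" "conj_by GL k ?K = B"
    using gl2_conjI[OF B(1) KC S(1)] by blast
  have "conj_by GL (inv\<^bsub>GL\<^esub> h) A = ?K"
    using GL.conj_by_inv_cancel(1)[OF h(1) KC] h(2) by simp
  then have "conj_by GL (k \<otimes>\<^bsub>GL\<^esub> inv\<^bsub>GL\<^esub> h) A = B"
    using GL.conj_by_conj_by[OF k(1) GL.inv_closed[OF h(1)] A(1)] k(2) by simp
  then show ?thesis using h(1) k(1) GL.m_closed[OF k(1) GL.inv_closed[OF h(1)]] by blast
qed

text \<open>The matrices \<open>normm x y\<close> represent multiplication by \<open>x + y \<surd>g\<close> on the quadratic extension.\<close>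

definition diagm :: "int \<Rightarrow> int \<Rightarrow> mat2" where "diagm a b = redm q (Mat a 0 0 b)"
definition normm :: "int \<Rightarrow> int \<Rightarrow> mat2" where "normm x y = redm q (Mat x (g * y) y x)"

lemma diagm_in: "\<not> int q dvd a \<Longrightarrow> \<not> int q dvd b \<Longrightarrow> diagm a b \<in> carrier GL"
  unfolding diagm_def by (intro redm_in_gl2) (simp add: coprime_iff dvd_mult_iff)

lemma diag_power: "Mat a 0 0 b ^ n = Mat (a ^ n) 0 0 (b ^ n)"
  by (induction n) (simp_all add: one_mat2_def)

lemma diagm_pow: "diagm a b [^]\<^bsub>GL\<^esub> (n::nat) = diagm (a ^ n) (b ^ n)"
proof -
  have "redm q (redm q A ^ n) = redm q (A ^ n)" for A
  proof (induction n)
    case (Suc n)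
    have "redm q (redm q A ^ Suc n) = redm q (A * redm q (redm q A ^ n))" by simp
    then show ?case by (simp only: Suc.IH) simp
  qed simp
  then show ?thesis by (simp add: pow_gl2 diagm_def diag_power)
qed

lemma diagm_eq_iff: "diagm a b = diagm c d \<longleftrightarrow> [a = c] (mod int q) \<and> [b = d] (mod int q)"
  by (simp add: diagm_def redm_eq_iff)

lemma one_eq_diagm: "\<one>\<^bsub>GL\<^esub> = diagm 1 1"
  by (simp add: one_gl2 diagm_def one_mat2_def)

lemma scalar2_redm: "scalar2 (redm q A) \<longleftrightarrow> scalar2 A"
  unfolding scalar2_def redm_def by (simp add: dvd_mod_iff mod_0_imp_dvd dvd_eq_mod_eq_0 mod_diff_eq)

text \<open>An element whose order is prime to \<open>q\<close> is diagonalisable or, if its characteristic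
  polynomial is irreducible, conjugate to an element of the quadratic extension field
  generated by a square root of \<open>g\<close>.\<close>

lemma conj_diag_or_norm:
  assumes A: "A \<in> carrier GL" and pow: "A [^]\<^bsub>GL\<^esub> m = \<one>\<^bsub>GL\<^esub>" and m: "\<not> q dvd m"
  shows "\<exists>h\<in>carrier GL. (\<exists>a b. conj_by GL h A = diagm a b \<and> [a ^ m = 1] (mod int q) \<and> [b ^ m = 1] (mod int q)) \<or>
    (\<exists>x y. conj_by GL h A = normm x y \<and> \<not> int q dvd y)"
proof -
  have fin: ?thesis if h: "h \<in> carrier GL" and e: "conj_by GL h A = diagm a b" for h a b
  proof -
    have "diagm a b [^]\<^bsub>GL\<^esub> m = \<one>\<^bsub>GL\<^esub>"
      unfolding e[symmetric] GL.conj_by_pow[OF h A, symmetric] pow by (rule GL.conj_by_unit[OF h])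
    then show ?thesis using h e by (auto simp: diagm_pow one_eq_diagm diagm_eq_iff)
  qed
  obtain h where h: "[2 * h = 1] (mod int q)" using half by blast
  have h0: "\<not> int q dvd h" using cong_1_not_dvd[OF h] dvd_mult_iff by blast
  have hh: "[2 * (h * z) = z] (mod int q)" for z
    using cong_mult[OF h cong_refl[of z]] by (simp add: mult.assoc)
  define t d where "t = tr2 A" and "d = det2 A"
  define D where "D = t * t - 4 * d"
  show ?thesis
  proof (cases "scalar2 A")
    case True
    have "redm q A = diagm (e11 A) (e22 A)"
      using True unfolding scalar2_def diagm_def by (simp add: redm_eq_iff cong_0_iff)
    then have "conj_by GL \<one>\<^bsub>GL\<^esub> A = diagm (e11 A) (e22 A)"
      unfolding GL.conj_by_one[OF A] redm_carrier[OF A] .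
    then show ?thesis by (rule fin[OF GL.one_closed])
  next
    case ns: False
    have conjB: "\<exists>k\<in>carrier GL. conj_by GL k A = redm q B"
      if B: "\<not> scalar2 B" "[2 * tr2 B = 2 * t] (mod int q)" "[4 * det2 B = 4 * d] (mod int q)" for B
    proof -
      have tB: "[tr2 B = t] (mod int q)" using B(2) cancel[OF not_dvd_2] by blast
      have dB: "[det2 B = d] (mod int q)" using B(3) cancel[OF not_dvd_4] by blast
      have "coprime (det2 B) (int q)"
        using A cong_imp_coprime[OF cong_sym[OF dB]] by (simp add: d_def carrier_gl2)
      then have "redm q B \<in> carrier GL" by (rule redm_in_gl2)
      moreover have "\<not> scalar2 (redm q B)" using B(1) scalar2_redm by blast
      moreover have "[tr2 A = tr2 (redm q B)] (mod int q)"
        using cong_trans[OF cong_tr2_redm tB] unfolding t_def by (rule cong_sym)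
      moreover have "[det2 A = det2 (redm q B)] (mod int q)"
        using cong_trans[OF cong_det2_redm dB] unfolding d_def by (rule cong_sym)
      ultimately show ?thesis using same_char_poly_conj[OF A ns] by blast
    qed
    show ?thesis
    proof (cases "int q dvd D")
      (* A double eigenvalue l: the matrix is a Jordan block, and the m-th power of a Jordan block has
         an entry m * l ^ (m - 1) above the diagonal, which does not vanish. *)
      case True
      define l where "l = h * t"
      have l: "[2 * l = t] (mod int q)" using hh by (simp add: l_def)
      have "[(2 * l) * (2 * l) = t * t] (mod int q)" by (rule cong_mult[OF l l])
      also have "[t * t = 4 * d] (mod int q)" using True by (simp add: D_def cong_iff_dvd_diff)
      finally have l4: "[4 * (l * l) = 4 * d] (mod int q)" by (simp add: mult_ac)
      have "\<exists>k\<in>carrier GL. conj_by GL k A = redm q (Mat l 1 0 l)"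
      proof (rule conjB)
        show "\<not> scalar2 (Mat l 1 0 l)" using not_dvd_1 by (simp add: scalar2_def)
        show "[2 * tr2 (Mat l 1 0 l) = 2 * t] (mod int q)"
          unfolding tr2_Mat mult_2[of l, symmetric] by (rule cong_mult[OF cong_refl l])
        show "[4 * det2 (Mat l 1 0 l) = 4 * d] (mod int q)" using l4 by simp
      qed
      then obtain k where k: "k \<in> carrier GL" "conj_by GL k A = redm q (Mat l 1 0 l)" by blast
      have J: "redm q (redm q (Mat l 1 0 l) ^ n) = redm q (Mat (l ^ n) (int n * l ^ (n - 1)) 0 (l ^ n))" for n
      proof (induction n)
        case (Suc n)
        have "redm q (redm q (Mat l 1 0 l) ^ Suc n) = redm q (Mat l 1 0 l * redm q (redm q (Mat l 1 0 l) ^ n))" by simp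
        also have "\<dots> = redm q (Mat l 1 0 l * Mat (l ^ n) (int n * l ^ (n - 1)) 0 (l ^ n))"
          by (simp only: Suc.IH redm_mult)
        finally show ?case by (cases n) (simp_all add: algebra_simps)
      qed (simp add: one_mat2_def)
      have "redm q (Mat l 1 0 l) [^]\<^bsub>GL\<^esub> m = \<one>\<^bsub>GL\<^esub>"
        unfolding k(2)[symmetric] GL.conj_by_pow[OF k(1) A, symmetric] pow by (rule GL.conj_by_unit[OF k(1)])
      then have "redm q (Mat (l ^ m) (int m * l ^ (m - 1)) 0 (l ^ m)) = redm q 1"
        by (simp add: pow_gl2 J one_gl2)
      then have "[l ^ m = 1] (mod int q)" "int q dvd int m * l ^ (m - 1)"
        by (simp_all add: redm_eq_iff cong_0_iff)
      moreover have "\<not> int q dvd l ^ (m - 1)"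
      proof (cases "m = 0")
        case False
        then have "l ^ m = l * l ^ (m - 1)" by (simp add: power_eq_if)
        then show ?thesis using cong_1_not_dvd[OF \<open>[l ^ m = 1] (mod int q)\<close>] dvd_mult_iff by metis
      qed (use m in simp)
      ultimately have "int q dvd int m" using dvd_mult_iff by blast
      then show ?thesis using m by simp
    next
      case False
      obtain i where i: "[D = g ^ i] (mod int q)" using root[OF False] by blast
      (* The discriminant is a square or g times a square, according to the parity of i. *)
      define j where "j = i div 2"
      define s where "s = g ^ j"
      have s0: "\<not> int q dvd s" unfolding s_def by (rule not_dvd_power[OF not_dvd_g])
      have hs0: "\<not> int q dvd h * s" using h0 s0 dvd_mult_iff by blast
      show ?thesis
      proof (cases "even i")
        case True
        then have "g ^ i = s * s" by (auto simp: s_def j_def simp flip: power_add mult_2)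
        then have Ds: "[t * t - 4 * d = s * s] (mod int q)" using i by (simp add: D_def)
        define a b where "a = h * (t + s)" and "b = h * (t - s)"
        have a: "[2 * a = t + s] (mod int q)" and b: "[2 * b = t - s] (mod int q)"
          using hh by (simp_all add: a_def b_def)
        have "\<exists>k\<in>carrier GL. conj_by GL k A = redm q (Mat a 0 0 b)"
        proof (rule conjB)
          have "\<not> int q dvd 2 * (h * s)" using hs0 not_dvd_2 dvd_mult_iff by blast
          then show "\<not> scalar2 (Mat a 0 0 b)" by (simp add: scalar2_def a_def b_def algebra_simps)
          show "[2 * tr2 (Mat a 0 0 b) = 2 * t] (mod int q)"
            using cong_add[OF a b] by (simp add: algebra_simps)
          have "[(2 * a) * (2 * b) = (t + s) * (t - s)] (mod int q)" by (rule cong_mult[OF a b])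
          also have "(t + s) * (t - s) = t * t - s * s" by (simp add: algebra_simps)
          also have "[t * t - s * s = t * t - (t * t - 4 * d)] (mod int q)"
            by (intro cong_diff cong_refl cong_sym[OF Ds])
          finally show "[4 * det2 (Mat a 0 0 b) = 4 * d] (mod int q)" by (simp add: mult_ac)
        qed
        then show ?thesis using fin unfolding diagm_def by blast
      next
        case odd: False
        then have "g ^ i = g * (s * s)" unfolding s_def j_def
          by (metis odd_two_times_div_two_succ mult_2 power_add power_Suc Suc_eq_plus1)
        then have Ds: "[t * t - 4 * d = g * (s * s)] (mod int q)" using i by (simp add: D_def)
        define x y where "x = h * t" and "y = h * s"
        have x: "[2 * x = t] (mod int q)" and y: "[2 * y = s] (mod int q)"
          using hh by (simp_all add: x_def y_def)
        have "\<exists>k\<in>carrier GL. conj_by GL k A = redm q (Mat x (g * y) y x)"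
        proof (rule conjB)
          show "\<not> scalar2 (Mat x (g * y) y x)" using hs0 by (simp add: scalar2_def y_def)
          show "[2 * tr2 (Mat x (g * y) y x) = 2 * t] (mod int q)"
            unfolding tr2_Mat mult_2[of x, symmetric] by (rule cong_mult[OF cong_refl x])
          have "[(2 * x) * (2 * x) - g * ((2 * y) * (2 * y)) = t * t - g * (s * s)] (mod int q)"
            by (intro cong_diff cong_mult cong_refl x y)
          also have "[t * t - g * (s * s) = t * t - (t * t - 4 * d)] (mod int q)"
            by (intro cong_diff cong_refl cong_sym[OF Ds])
          finally show "[4 * det2 (Mat x (g * y) y x) = 4 * d] (mod int q)" by (simp add: algebra_simps)
        qed
        then show ?thesis using hs0 unfolding normm_def y_def by blast
      qed
    qed
  qed
qed

section \<open>The quadratic extension field inside the matrix ring\<close>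

text \<open>The field with \<open>q\<^sup>2\<close> elements, realised as the algebra of the matrices \<^const>\<open>normm\<close>.  It brings two facts to
  the general linear group, which contains its units: they form a cyclic group, and a polynomial
  has no more roots in the field than its degree.\<close>

definition KF :: "mat2 ring" where
  "KF = \<lparr>carrier = {normm x y | x y. True}, mult = (\<lambda>A B. redm q (A * B)), one = redm q 1,
     zero = normm 0 0, add = (\<lambda>A B. redm q (A + B))\<rparr>"

lemma KF_simps [simp]:
  "A \<otimes>\<^bsub>KF\<^esub> B = redm q (A * B)" "A \<oplus>\<^bsub>KF\<^esub> B = redm q (A + B)" "\<zero>\<^bsub>KF\<^esub> = normm 0 0" "\<one>\<^bsub>KF\<^esub> = normm 1 0"
  by (simp_all add: KF_def normm_def one_mat2_def)

lemma KF_carrier: "A \<in> carrier KF \<longleftrightarrow> (\<exists>x y. A = normm x y)"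
  by (simp add: KF_def)

lemma normm_in_KF [simp]: "normm x y \<in> carrier KF"
  using KF_carrier by blast

lemma normm_mult: "redm q (normm x y * normm x' y') = normm (x * x' + g * (y * y')) (x * y' + y * x')"
  by (simp add: normm_def) (simp add: algebra_simps)

lemma normm_add: "redm q (normm x y + normm x' y') = normm (x + x') (y + y')"
  by (simp add: normm_def) (simp add: algebra_simps)

lemma normm_eq_iff: "normm x y = normm x' y' \<longleftrightarrow> [x = x'] (mod int q) \<and> [y = y'] (mod int q)"
  unfolding normm_def redm_eq_iff using cancel[OF not_dvd_g] by auto

lemma normm_in_GL:
  assumes "normm x y \<noteq> normm 0 0"
  shows "normm x y \<in> carrier GL"
proof -
  have "\<not> (int q dvd x \<and> int q dvd y)" using assms by (simp add: normm_eq_iff cong_0_iff)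
  then have "\<not> int q dvd x * x - g * (y * y)" using norm_form by blast
  then have "coprime (det2 (Mat x (g * y) y x)) (int q)" by (simp add: coprime_iff mult.assoc)
  then show ?thesis unfolding normm_def by (rule redm_in_gl2)
qed

lemma field_KF: "field KF"
proof -
  have "cring KF"
  proof (rule cringI)
    show "abelian_group KF"
    proof (rule abelian_groupI)
      fix A assume "A \<in> carrier KF"
      then obtain x y where "A = normm x y" using KF_carrier by blast
      then show "\<exists>B\<in>carrier KF. B \<oplus>\<^bsub>KF\<^esub> A = \<zero>\<^bsub>KF\<^esub>"
        by (intro bexI[of _ "normm (- x) (- y)"]) (auto simp: normm_add KF_carrier)
    next
      fix A B assume "A \<in> carrier KF" "B \<in> carrier KF"
      then show "A \<oplus>\<^bsub>KF\<^esub> B \<in> carrier KF" "A \<oplus>\<^bsub>KF\<^esub> B = B \<oplus>\<^bsub>KF\<^esub> A"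
        by (auto simp: KF_carrier[of A] KF_carrier[of B] normm_add add.commute)
    next
      fix A assume "A \<in> carrier KF"
      then show "\<zero>\<^bsub>KF\<^esub> \<oplus>\<^bsub>KF\<^esub> A = A" by (auto simp: KF_carrier normm_add)
    qed (simp_all add: add.assoc)
    show "comm_monoid KF"
    proof (rule comm_monoidI)
      fix A B assume "A \<in> carrier KF" "B \<in> carrier KF"
      then show "A \<otimes>\<^bsub>KF\<^esub> B \<in> carrier KF" "A \<otimes>\<^bsub>KF\<^esub> B = B \<otimes>\<^bsub>KF\<^esub> A"
        by (auto simp: KF_carrier[of A] KF_carrier[of B] normm_mult mult.commute add.commute)
    next
      fix A assume "A \<in> carrier KF"
      then show "\<one>\<^bsub>KF\<^esub> \<otimes>\<^bsub>KF\<^esub> A = A" by (auto simp: KF_carrier normm_mult)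
    qed (simp_all add: mult.assoc)
    fix A B C assume "A \<in> carrier KF" "B \<in> carrier KF" "C \<in> carrier KF"
    then show "(A \<oplus>\<^bsub>KF\<^esub> B) \<otimes>\<^bsub>KF\<^esub> C = A \<otimes>\<^bsub>KF\<^esub> C \<oplus>\<^bsub>KF\<^esub> B \<otimes>\<^bsub>KF\<^esub> C"
      by (simp add: distrib_right)
  qed
  then show ?thesis
  proof (rule cring.cring_fieldI2)
    show "\<zero>\<^bsub>KF\<^esub> \<noteq> \<one>\<^bsub>KF\<^esub>" using not_dvd_1 by (simp add: normm_eq_iff cong_sym_eq[of 0] cong_0_iff)
    fix A assume A: "A \<in> carrier KF" "A \<noteq> \<zero>\<^bsub>KF\<^esub>"
    then obtain x y where xy: "A = normm x y" using KF_carrier by blast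
    have "\<not> int q dvd x * x - g * (y * y)"
      using norm_form[of x y] A(2) unfolding xy by (auto simp: normm_eq_iff cong_0_iff)
    then obtain e where e: "[(x * x - g * (y * y)) * e = 1] (mod int q)"
      using coprime_iff_invertible_int coprime_iff by blast
    have "A \<otimes>\<^bsub>KF\<^esub> normm (x * e) (- (y * e)) = \<one>\<^bsub>KF\<^esub>"
      using e unfolding xy by (simp add: normm_mult normm_eq_iff algebra_simps)
    then show "\<exists>B\<in>carrier KF. A \<otimes>\<^bsub>KF\<^esub> B = \<one>\<^bsub>KF\<^esub>" using KF_carrier by blast
  qed
qed

sublocale KF: field KF by (rule field_KF)

lemma card_KF: "finite (carrier KF)" "card (carrier KF) = q ^ 2"
proof -
  have "bij_betw (\<lambda>(x, y). normm x y) ({0..<int q} \<times> {0..<int q}) (carrier KF)"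
  proof (rule bij_betw_imageI)
    show "inj_on (\<lambda>(x, y). normm x y) ({0..<int q} \<times> {0..<int q})"
      by (rule inj_onI) (auto simp: normm_eq_iff cong_def)
    show "(\<lambda>(x, y). normm x y) ` ({0..<int q} \<times> {0..<int q}) = carrier KF"
    proof (intro equalityI subsetI)
      fix A assume "A \<in> carrier KF"
      then obtain x y where "A = normm x y" using KF_carrier by blast
      then have "A = (\<lambda>(x, y). normm x y) (x mod int q, y mod int q)" by (simp add: normm_eq_iff)
      then show "A \<in> (\<lambda>(x, y). normm x y) ` ({0..<int q} \<times> {0..<int q})"
        by (rule image_eqI) (use q in simp)
    qed (auto simp: KF_carrier)
  qed
  then show "finite (carrier KF)" "card (carrier KF) = q ^ 2"
    using bij_betw_finite bij_betw_same_card by (force simp: power2_eq_square)+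
qed

lemma KF_units_GL: "A \<in> carrier (mult_of KF) \<Longrightarrow> A \<in> carrier GL"
  using normm_in_GL by (auto simp: KF_carrier)

lemma KF_pow: "A [^]\<^bsub>KF\<^esub> (n::nat) = A [^]\<^bsub>GL\<^esub> n"
  by (induction n) (simp_all add: one_gl2 normm_def one_mat2_def)

text \<open>A polynomial over a field has no more roots than its degree.\<close>

lemma KF_roots: 
  assumes "0 < m" shows "card {z \<in> carrier KF. z [^]\<^bsub>GL\<^esub> m = \<one>\<^bsub>GL\<^esub>} \<le> m"
proof -
  have "\<one>\<^bsub>GL\<^esub> = \<one>\<^bsub>KF\<^esub>" by (simp add: one_gl2 normm_def one_mat2_def)
  then show ?thesis using KF.num_roots_le_deg[OF card_KF(1), of m] assms by (simp add: KF_pow)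
qed

text \<open>The multiplicative group of a finite field is cyclic.\<close>

lemma KF_order_exists:
  assumes m: "m dvd q ^ 2 - 1"
  shows "\<exists>a\<in>carrier GL. a \<in> carrier KF \<and> GL.ord a = m"
proof -
  interpret M: group "mult_of KF" by (rule KF.field_mult_group)
  have fin: "finite (carrier (mult_of KF))" using card_KF(1) by simp
  have ord: "order (mult_of KF) = q ^ 2 - 1" using KF.order_mult_of[OF card_KF(1)] card_KF(2) by (simp add: order_def)
  have q1: "1 < q ^ 2" by (rule one_less_power) (use q in auto)
  obtain a where a: "a \<in> carrier (mult_of KF)" "carrier (mult_of KF) = {a [^]\<^bsub>KF\<^esub> i | i::nat. i \<in> UNIV}"
    using KF.finite_field_mult_group_has_gen[OF card_KF(1)] by blast
  have "generate (mult_of KF) {a} = carrier (mult_of KF)"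
    using M.generate_pow_on_finite_carrier[OF fin a(1)] a(2) by (simp add: nat_pow_mult_of)
  then have oa: "M.ord a = q ^ 2 - 1" using M.generate_pow_card[OF a(1)] ord by (simp add: order_def)
  obtain k where k: "q ^ 2 - 1 = m * k" using m by (auto elim: dvdE)
  have k0: "k \<noteq> 0" "m \<noteq> 0" using k q1 by (auto intro!: Nat.gr0I)
  define b where "b = a [^]\<^bsub>mult_of KF\<^esub> k"
  have b: "b \<in> carrier (mult_of KF)" unfolding b_def by (rule M.nat_pow_closed[OF a(1)])
  have "M.ord b = m" unfolding b_def using M.ord_pow[OF a(1), of k] oa k k0 by simp
  moreover have bGL: "b \<in> carrier GL" by (rule KF_units_GL[OF b])
  moreover have "b [^]\<^bsub>mult_of KF\<^esub> n = b [^]\<^bsub>GL\<^esub> n" for n :: nat by (simp add: nat_pow_mult_of KF_pow)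
  moreover have "\<one>\<^bsub>mult_of KF\<^esub> = \<one>\<^bsub>GL\<^esub>" by (simp add: one_gl2 normm_def one_mat2_def)
  ultimately have "GL.ord b = m"
    using M.pow_eq_id[OF b] by (intro GL.ord_unique[OF bGL, THEN iffD2]) simp
  then show ?thesis using b bGL by auto
qed

text \<open>The field is its own centraliser: a matrix that commutes with an element outside the scalars is
  in the field.\<close>

lemma commutes_normm:
  assumes B: "B \<in> carrier GL" and y: "\<not> int q dvd y"
    and comm: "redm q (B * normm x y) = redm q (normm x y * B)"
  shows "B \<in> carrier KF"
proof -
  obtain a b c d where BM: "B = Mat a b c d" by (cases B)
  have "redm q (B * Mat x (g * y) y x) = redm q (Mat x (g * y) y x * B)" using comm by (simp add: normm_def)
  then have "[a * x + b * y = x * a + g * y * c] (mod int q)" "[c * x + d * y = y * a + x * c] (mod int q)"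
    unfolding BM by (simp_all add: redm_eq_iff)
  then have "[y * b = y * (g * c)] (mod int q)" "[y * d = y * a] (mod int q)"
    by (simp_all add: cong_iff_dvd_diff algebra_simps)
  then have "[b = g * c] (mod int q)" "[d = a] (mod int q)" using cancel[OF y] by blast+
  then have "redm q B = normm a c" unfolding BM normm_def by (simp add: redm_eq_iff)
  then show ?thesis using redm_carrier[OF B] KF_carrier by metis
qed

lemma commutes_diagm:
  assumes B: "B \<in> carrier GL" and ne: "\<not> [a = b] (mod int q)"
    and comm: "redm q (B * diagm a b) = redm q (diagm a b * B)"
  shows "\<exists>c d. B = diagm c d"
proof -
  obtain u v w z where BM: "B = Mat u v w z" by (cases B)
  have "redm q (B * Mat a 0 0 b) = redm q (Mat a 0 0 b * B)" using comm by (simp add: diagm_def)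
  then have "[v * b = a * v] (mod int q)" "[w * a = b * w] (mod int q)"
    unfolding BM by (simp_all add: redm_eq_iff)
  then have "int q dvd (a - b) * v" "int q dvd (a - b) * w"
    by (simp_all add: cong_iff_dvd_diff algebra_simps dvd_diff_commute)
  then have "int q dvd v" "int q dvd w" using ne dvd_mult_iff by (auto simp: cong_iff_dvd_diff)
  then have "redm q B = diagm u z" unfolding BM diagm_def by (simp add: redm_eq_iff cong_0_iff)
  then show ?thesis using redm_carrier[OF B] by metis
qed

end

section \<open>Counting conjugacy classes of subgroups of the general linear group\<close>

context group begin

lemma conj_by_generate:
  assumes "h \<in> carrier G" "a \<in> carrier G"
  shows "conj_by G h ` generate G {a} = generate G {conj_by G h a}"
proof -
  interpret h: group_hom G G "conj_by G h"
    using conj_by_iso[OF assms(1)] by unfold_locales (auto simp: iso_def)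
  show ?thesis using h.generate_img[of "{a}"] assms(2) by simp
qed

lemma ord_conj_by:
  assumes "h \<in> carrier G" "a \<in> carrier G"
  shows "ord (conj_by G h a) = ord a"
  using generate_pow_card[OF assms(2)] generate_pow_card[OF conj_by_closed[OF assms]]
    card_conj_by[OF assms(1) generate_subset[OF assms(2)]] conj_by_generate[OF assms] by simp

lemma conj_class_generate_eq:
  assumes "h \<in> carrier G" "a \<in> carrier G"
  shows "conj_class G (generate G {conj_by G h a}) = conj_class G (generate G {a})"
proof -
  have "conj_class G (generate G {a}) = conj_class G (generate G {conj_by G h a})"
    using conj_class_eq_iff[OF generate_subset[OF assms(2)] generate_subset[OF conj_by_closed[OF assms]]]
      conj_by_generate[OF assms] assms(1) by blast
  then show ?thesis ..
qed

end

text \<open>The orbits of inversion on the residues modulo \<open>m\<close>, where the residues that are not units are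
  singletons.  They index the classes of cyclic subgroups of order \<open>m\<close> generated by diagonal matrices.\<close>

definition inverse_orbits :: "nat \<Rightarrow> nat set set" where
  "inverse_orbits m = (\<lambda>k. {l\<in>{..<m}. l = k \<or> [k * l = 1] (mod m)}) ` {..<m}"

context odd_prime_field begin

lemma q_gt_1: "1 < q" using q by simp

text \<open>Every unit modulo \<open>q\<close> has an order dividing \<open>q - 1\<close>.\<close>

lemma pow_gcd:
  assumes "[a ^ m = 1] (mod int q)" "0 < m"
  shows "[a ^ gcd m (q - 1) = 1] (mod int q)"
proof -
  have "\<not> int q dvd a"
  proof
    assume "int q dvd a"
    then have "int q dvd a ^ m" using assms(2) dvd_trans[OF _ dvd_power[of m a]] by simp
    then show False using cong_1_not_dvd[OF assms(1)] by simp
  qed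
  then obtain i where i: "[a = g ^ i] (mod int q)" using root by blast
  have "[g ^ (i * m) = 1] (mod int q)"
    using cong_trans[OF cong_sym[OF cong_pow[OF i, of m]] assms(1)] by (simp add: power_mult)
  then have "(q - 1) dvd i * m" using ord_g by blast
  then have "(q - 1) dvd gcd (i * m) (i * (q - 1))" by simp
  also have "gcd (i * m) (i * (q - 1)) = i * gcd m (q - 1)" by (simp add: gcd_mult_distrib_nat)
  finally have "[g ^ (i * gcd m (q - 1)) = 1] (mod int q)" using ord_g by blast
  then show ?thesis using cong_trans[OF cong_pow[OF i, of "gcd m (q - 1)"]] by (simp add: power_mult)
qed

text \<open>The order of a diagonal matrix divides \<open>q - 1\<close>.\<close>

lemma diag_ord_dvd:
  assumes A: "A \<in> carrier GL" "GL.ord A = m" "0 < m" and h: "h \<in> carrier GL" "conj_by GL h A = diagm a b"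
    and ab: "[a ^ m = 1] (mod int q)" "[b ^ m = 1] (mod int q)"
  shows "m dvd q - 1"
proof -
  have "diagm a b [^]\<^bsub>GL\<^esub> gcd m (q - 1) = \<one>\<^bsub>GL\<^esub>"
    using pow_gcd[OF ab(1) A(3)] pow_gcd[OF ab(2) A(3)] by (simp add: diagm_pow one_eq_diagm diagm_eq_iff)
  moreover have "diagm a b \<in> carrier GL" using GL.conj_by_closed[OF h(1) A(1)] h(2) by simp
  ultimately have "GL.ord (diagm a b) dvd gcd m (q - 1)" using GL.pow_eq_id by blast
  moreover have "GL.ord (diagm a b) = m" using GL.ord_conj_by[OF h(1) A(1)] h(2) A(2) by simp
  ultimately show ?thesis by simp
qed

text \<open>The subgroup has \<open>m\<close> elements, and the field contains no more than \<open>m\<close> roots of \<open>X\<^sup>m - 1\<close>.\<close>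

lemma generate_in_KF:
  assumes "B \<in> carrier KF" "B \<in> carrier GL" "GL.ord B = m" "0 < m"
  shows "generate GL {B} = {z \<in> carrier KF. z [^]\<^bsub>GL\<^esub> m = \<one>\<^bsub>GL\<^esub>}"
proof (rule card_subset_eq)
  let ?R = "{z \<in> carrier KF. z [^]\<^bsub>GL\<^esub> m = \<one>\<^bsub>GL\<^esub>}"
  show fin: "finite ?R" using card_KF(1) by simp
  show sub: "generate GL {B} \<subseteq> ?R"
  proof
    fix z assume "z \<in> generate GL {B}"
    then obtain k :: nat where k: "z = B [^]\<^bsub>GL\<^esub> k"
      using GL.generate_pow_on_finite_carrier[OF finGL assms(2)] by blast
    have "z \<in> carrier KF" unfolding k KF_pow[symmetric] by (rule KF.nat_pow_closed[OF assms(1)])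
    moreover have "z [^]\<^bsub>GL\<^esub> m = \<one>\<^bsub>GL\<^esub>"
    proof -
      have "z [^]\<^bsub>GL\<^esub> m = (B [^]\<^bsub>GL\<^esub> m) [^]\<^bsub>GL\<^esub> k"
        unfolding k by (simp only: GL.nat_pow_pow[OF assms(2)] mult.commute)
      also have "\<dots> = \<one>\<^bsub>GL\<^esub>" using GL.pow_ord_eq_1[OF assms(2)] assms(3) by (simp only: GL.nat_pow_one)
      finally show ?thesis .
    qed
    ultimately show "z \<in> ?R" by blast
  qed
  have "card (generate GL {B}) = m" using GL.generate_pow_card[OF assms(2)] assms(3) by simp
  then show "card (generate GL {B}) = card ?R"
    using card_mono[OF fin sub] KF_roots[OF assms(4)] by simp
qed

lemma KF_ord_dvd:
  assumes "B \<in> carrier KF" "B \<in> carrier GL"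
  shows "GL.ord B dvd q ^ 2 - 1"
proof -
  interpret M: group "mult_of KF" by (rule KF.field_mult_group)
  have "B \<noteq> normm 0 0"
  proof
    assume "B = normm 0 0"
    then have "det2 B = 0" by (simp add: normm_def redm_def)
    then show False using assms(2) q_gt_1 by (simp add: carrier_gl2)
  qed
  then have B: "B \<in> carrier (mult_of KF)" using assms(1) by simp
  have "order (mult_of KF) = q ^ 2 - 1" using KF.order_mult_of[OF card_KF(1)] card_KF(2) by (simp add: order_def)
  then have "B [^]\<^bsub>KF\<^esub> (q ^ 2 - 1) = \<one>\<^bsub>KF\<^esub>" using M.pow_order_eq_1[OF B] by (simp add: nat_pow_mult_of)
  moreover have "\<one>\<^bsub>KF\<^esub> = \<one>\<^bsub>GL\<^esub>" by (simp add: one_gl2 normm_def one_mat2_def)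
  ultimately show ?thesis unfolding KF_pow using GL.pow_eq_id[OF assms(2)] by simp
qed

lemma not_q_dvd: "m dvd q ^ 2 - 1 \<Longrightarrow> \<not> q dvd m"
proof
  assume "m dvd q ^ 2 - 1" "q dvd m"
  then have "q dvd q ^ 2 - 1" by (rule dvd_trans[rotated])
  moreover have "q dvd q ^ 2" by simp
  ultimately have "q dvd q ^ 2 - (q ^ 2 - 1)" by (rule dvd_diff_nat[rotated])
  moreover have "1 \<le> q ^ 2" using q_gt_1 by simp
  ultimately show False using q_gt_1 by simp
qed

text \<open>If \<open>m\<close> does not divide \<open>q - 1\<close>, an element of order \<open>m\<close> cannot be diagonalised,
  so it is conjugate into the multiplicative group of the field \<open>KF\<close>, which has at most one
  subgroup of each order.\<close>

lemma nonsplit_conj: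
  assumes A: "A \<in> carrier GL" "GL.ord A = m" "0 < m" and m: "\<not> m dvd q - 1" "\<not> q dvd m"
  shows "\<exists>h\<in>carrier GL. \<exists>x y. conj_by GL h A = normm x y \<and> \<not> int q dvd y"
proof -
  have "A [^]\<^bsub>GL\<^esub> m = \<one>\<^bsub>GL\<^esub>" using GL.pow_ord_eq_1[OF A(1)] A(2) by simp
  from conj_diag_or_norm[OF A(1) this m(2)] show ?thesis
    using diag_ord_dvd[OF A] m(1) by blast
qed

text \<open>Every cyclic subgroup of order \<open>m\<close> is conjugate to the group of \<open>m\<close>-th roots of unity of the field.\<close>

lemma num_conj_nonsplit:
  assumes m: "0 < m" "\<not> m dvd q - 1" "\<not> q dvd m"
  shows "num_conj GL (cyclic_subs GL m) = (if m dvd q ^ 2 - 1 then 1 else 0)"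
proof (cases "m dvd q ^ 2 - 1")
  case False
  have "cyclic_subs GL m = {}"
  proof (rule ccontr)
    assume "cyclic_subs GL m \<noteq> {}"
    then obtain A where A: "A \<in> carrier GL" "GL.ord A = m" unfolding cyclic_subs_def by blast
    obtain h x y where h: "h \<in> carrier GL" "conj_by GL h A = normm x y"
      using nonsplit_conj[OF A m] by blast
    have "normm x y \<in> carrier GL" "GL.ord (normm x y) = m"
      using GL.conj_by_closed[OF h(1) A(1)] GL.ord_conj_by[OF h(1) A(1)] h(2) A(2) by auto
    then show False using KF_ord_dvd[of "normm x y"] False by simp
  qed
  then show ?thesis using False by simp
next
  case True
  define R where "R = {z \<in> carrier KF. z [^]\<^bsub>GL\<^esub> m = \<one>\<^bsub>GL\<^esub>}"
  obtain a where a: "a \<in> carrier GL" "a \<in> carrier KF" "GL.ord a = m" using KF_order_exists[OF True] by blast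
  have aR: "generate GL {a} = R" using generate_in_KF[OF a(2,1,3) m(1)] by (simp add: R_def)
  have "num_conj GL (cyclic_subs GL m) = 1"
  proof (rule GL.num_conj_eq_1[of R])
    show "R \<in> cyclic_subs GL m" unfolding cyclic_subs_def using a aR by blast
    fix T assume T: "T \<in> cyclic_subs GL m"
    then show "T \<subseteq> carrier GL" by (rule GL.cyclic_subs_mem)
    obtain A where A: "A \<in> carrier GL" "GL.ord A = m" "T = generate GL {A}"
      using T unfolding cyclic_subs_def by blast
    obtain h x y where h: "h \<in> carrier GL" "conj_by GL h A = normm x y"
      using nonsplit_conj[OF A(1,2) m] by blast
    have B: "normm x y \<in> carrier GL" "GL.ord (normm x y) = m"
      using GL.conj_by_closed[OF h(1) A(1)] GL.ord_conj_by[OF h(1) A(1)] h(2) A(2) by auto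
    have "conj_by GL h ` T = generate GL {normm x y}"
      unfolding A(3) GL.conj_by_generate[OF h(1) A(1)] h(2) ..
    also have "\<dots> = R" unfolding R_def by (rule generate_in_KF[OF _ B m(1)]) simp
    finally show "\<exists>h\<in>carrier GL. conj_by GL h ` T = R" using h(1) by blast
  qed
  then show ?thesis using True by simp
qed

lemma zeta_exists:
  assumes m: "m dvd q - 1"
  shows "\<exists>z. (\<forall>i. [z ^ i = 1] (mod int q) \<longleftrightarrow> m dvd i) \<and> (\<forall>a. [a ^ m = 1] (mod int q) \<longrightarrow> (\<exists>i. [a = z ^ i] (mod int q)))"
proof -
  obtain e where e: "q - 1 = m * e" using m by (auto elim: dvdE)
  have e0: "0 < e" "0 < m" using e q_gt_1 by (auto intro!: Nat.gr0I)
  have 1: "[(g ^ e) ^ i = 1] (mod int q) \<longleftrightarrow> m dvd i" for i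
    unfolding power_mult[symmetric] ord_g e using e0 by (simp add: mult.commute)
  have 2: "\<exists>i. [a = (g ^ e) ^ i] (mod int q)" if a: "[a ^ m = 1] (mod int q)" for a
  proof -
    have "\<not> int q dvd a"
    proof
      assume "int q dvd a"
      then have "int q dvd a ^ m" using e0 dvd_trans[OF _ dvd_power[of m a]] by simp
      then show False using cong_1_not_dvd[OF a] by simp
    qed
    then obtain j where j: "[a = g ^ j] (mod int q)" using root by blast
    have "[g ^ (j * m) = 1] (mod int q)"
      using cong_trans[OF cong_sym[OF cong_pow[OF j, of m]] a] by (simp add: power_mult)
    then have "m * e dvd m * j" using ord_g e by (simp add: mult.commute)
    then have "e dvd j" using e0 by simp
    then obtain i where "j = e * i" by (auto elim: dvdE)
    then show ?thesis using j by (auto simp: power_mult)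
  qed
  show ?thesis using 1 2 by blast
qed

end

text \<open>The case in which \<open>m = p\<^sup>r\<close> divides \<open>q - 1\<close>, so that the field with \<open>q\<close> elements contains all \<open>m\<close>-th
  roots of unity; \<open>z\<close> is a primitive one.\<close>

locale split_torus = odd_prime_field +
  fixes p r :: nat and z :: int
  assumes p: "prime p" "0 < r" and m_dvd: "p ^ r dvd q - 1"
    and z_ord: "[z ^ i = 1] (mod int q) \<longleftrightarrow> p ^ r dvd i"
    and z_root: "[a ^ (p ^ r) = 1] (mod int q) \<Longrightarrow> \<exists>i. [a = z ^ i] (mod int q)"
begin

abbreviation m where "m \<equiv> p ^ r"

lemma m_gt_1: "1 < m" using prime_gt_1_nat[OF p(1)] p(2) by (rule one_less_power)

lemma m_pos: "0 < m" using m_gt_1 by (rule less_trans[OF zero_less_one])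

lemma z_unit: "\<not> int q dvd z ^ i"
proof -
  have "\<not> int q dvd z ^ (m * i)" using z_ord[of "m * i"] cong_1_not_dvd by simp
  moreover have "z ^ (m * i) = z ^ i * z ^ ((m - 1) * i)"
    using m_gt_1 by (simp flip: power_add) (simp add: algebra_simps)
  ultimately show ?thesis by (metis dvd_mult2)
qed

lemma z_cong_iff: "[z ^ i = z ^ j] (mod int q) \<longleftrightarrow> [i = j] (mod m)"
proof -
  have *: "[z ^ i = z ^ j] (mod int q) \<longleftrightarrow> [i = j] (mod m)" if "i \<le> j" for i j
  proof -
    have "z ^ j = z ^ i * z ^ (j - i)" using that by (simp flip: power_add)
    then have "[z ^ i = z ^ j] (mod int q) \<longleftrightarrow> [z ^ i * 1 = z ^ i * z ^ (j - i)] (mod int q)" by simp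
    also have "\<dots> \<longleftrightarrow> [z ^ (j - i) = 1] (mod int q)" unfolding cancel[OF z_unit] by (rule cong_sym_eq)
    also have "\<dots> \<longleftrightarrow> [i = j] (mod m)" unfolding z_ord
      using cong_altdef_nat[OF that, of m] cong_sym_eq by blast
    finally show ?thesis .
  qed
  show ?thesis
    using *[of i j] *[of j i] cong_sym_eq[of i j m] cong_sym_eq[of "z ^ i" "z ^ j" "int q"] by (cases "i \<le> j") auto
qed

text \<open>The standard generators: after passing to a power and possibly exchanging the two eigenvalues,
  the first eigenvalue of a matrix of order \<open>m\<close> is \<open>z\<close> itself.\<close>

definition D :: "nat \<Rightarrow> mat2" where "D k = diagm z (z ^ k)"

lemma diag_z_in: "diagm (z ^ i) (z ^ j) \<in> carrier GL" by (rule diagm_in[OF z_unit z_unit])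

lemma D_in: "D k \<in> carrier GL" unfolding D_def using diag_z_in[of 1 k] by simp

lemma D_pow: "D k [^]\<^bsub>GL\<^esub> (e::nat) = diagm (z ^ e) (z ^ (k * e))"
  by (simp add: D_def diagm_pow power_mult)

lemma ord_D: "GL.ord (D k) = m"
proof (rule GL.ord_unique[OF D_in, THEN iffD2], intro allI)
  fix i :: nat
  have "D k [^]\<^bsub>GL\<^esub> i = \<one>\<^bsub>GL\<^esub> \<longleftrightarrow> m dvd i \<and> m dvd k * i"
    unfolding D_pow one_eq_diagm diagm_eq_iff z_ord ..
  then show "D k [^]\<^bsub>GL\<^esub> i = \<one>\<^bsub>GL\<^esub> \<longleftrightarrow> m dvd i" by auto
qed

definition swap :: mat2 where "swap = redm q (Mat 0 1 1 0)"

lemma swap_in: "swap \<in> carrier GL"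
  unfolding swap_def by (rule redm_in_gl2) simp

lemma conj_swap:
  assumes "diagm a b \<in> carrier GL" "diagm b a \<in> carrier GL"
  shows "conj_by GL swap (diagm a b) = diagm b a"
proof -
  have "swap \<otimes>\<^bsub>GL\<^esub> diagm a b = diagm b a \<otimes>\<^bsub>GL\<^esub> swap"
    by (simp add: swap_def diagm_def)
  then show ?thesis
    unfolding conj_by_def using GL.inv_solve_right'[OF assms(2) GL.m_closed[OF swap_in assms(1)] swap_in] by blast
qed

text \<open>The \<open>m\<close> scalar powers of \<open>z\<close> already exhaust the roots of \<open>X\<^sup>m - 1\<close> in the field.\<close>

lemma no_norm:
  assumes "normm x y [^]\<^bsub>GL\<^esub> m = \<one>\<^bsub>GL\<^esub>"
  shows "int q dvd y"
proof -
  let ?R = "{u \<in> carrier KF. u [^]\<^bsub>GL\<^esub> m = \<one>\<^bsub>GL\<^esub>}"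
  define f where "f = (\<lambda>i. normm (z ^ i) 0)"
  have fd: "f i = diagm (z ^ i) (z ^ i)" for i by (simp add: f_def normm_def diagm_def)
  have "inj_on f {..<m}"
    by (rule inj_onI) (simp add: fd diagm_eq_iff z_cong_iff cong_less_modulus_unique_nat)
  then have c: "card (f ` {..<m}) = m" by (simp add: card_image)
  have sub: "f ` {..<m} \<subseteq> ?R"
  proof
    fix u assume "u \<in> f ` {..<m}"
    then obtain i where u: "u = f i" by blast
    have "f i [^]\<^bsub>GL\<^esub> m = \<one>\<^bsub>GL\<^esub>"
      unfolding fd diagm_pow one_eq_diagm diagm_eq_iff power_mult[symmetric] z_ord by simp
    then show "u \<in> ?R" unfolding u by (simp add: f_def)
  qed
  have "f ` {..<m} = ?R"
  proof (rule card_seteq[OF _ sub])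
    show "finite ?R" using card_KF(1) by simp
    show "card ?R \<le> card (f ` {..<m})" unfolding c by (rule KF_roots[OF m_pos])
  qed
  then have "normm x y \<in> f ` {..<m}" using assms by simp
  then obtain i where "normm x y = normm (z ^ i) 0" unfolding f_def by blast
  then show ?thesis by (simp add: normm_eq_iff cong_0_iff)
qed

text \<open>By \<open>no_norm\<close> an element of the field with \<open>m\<close>-th power 1 is a scalar, so only the
  diagonal alternative of \<open>conj_diag_or_norm\<close> remains.\<close>

lemma conj_diag:
  assumes A: "A \<in> carrier GL" "A [^]\<^bsub>GL\<^esub> m = \<one>\<^bsub>GL\<^esub>"
  shows "\<exists>h\<in>carrier GL. \<exists>i j. conj_by GL h A = diagm (z ^ i) (z ^ j)"
proof -
  have "m dvd q ^ 2 - 1"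
  proof -
    have "q ^ 2 - 1 = (q - 1) * (q + 1)" by (simp add: power2_eq_square algebra_simps)
    then show ?thesis using m_dvd by simp
  qed
  from conj_diag_or_norm[OF A not_q_dvd[OF this]] obtain h where h: "h \<in> carrier GL" and
    c: "(\<exists>a b. conj_by GL h A = diagm a b \<and> [a ^ m = 1] (mod int q) \<and> [b ^ m = 1] (mod int q)) \<or>
        (\<exists>x y. conj_by GL h A = normm x y \<and> \<not> int q dvd y)" by blast
  have "conj_by GL h A [^]\<^bsub>GL\<^esub> m = \<one>\<^bsub>GL\<^esub>"
    unfolding GL.conj_by_pow[OF h A(1), symmetric] A(2) by (rule GL.conj_by_unit[OF h])
  then have "\<nexists>x y. conj_by GL h A = normm x y \<and> \<not> int q dvd y" using no_norm by metis
  then obtain a b where ab: "conj_by GL h A = diagm a b" "[a ^ m = 1] (mod int q)" "[b ^ m = 1] (mod int q)"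
    using c by blast
  obtain i where i: "[a = z ^ i] (mod int q)" using z_root[OF ab(2)] by blast
  obtain j where j: "[b = z ^ j] (mod int q)" using z_root[OF ab(3)] by blast
  have "diagm a b = diagm (z ^ i) (z ^ j)" using i j by (simp add: diagm_eq_iff)
  then show ?thesis using h ab(1) by auto
qed

text \<open>If \<open>p\<close> does not divide \<open>i\<close>, some power of the matrix has first eigenvalue \<open>z\<close>.\<close>

lemma diag_class:
  assumes "GL.ord (diagm (z ^ i) (z ^ j)) = m" "\<not> p dvd i"
  shows "\<exists>l<m. generate GL {diagm (z ^ i) (z ^ j)} = generate GL {D l}"
proof -
  have "coprime p i" by (rule prime_imp_coprime[OF p(1) assms(2)])
  then have "coprime i m" by (simp add: coprime_commute)
  then obtain u where u: "[i * u = 1] (mod m)" using cong_solve_coprime_nat[OF \<open>coprime i m\<close>] by auto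
  let ?E = "diagm (z ^ i) (z ^ j)" and ?l = "j * u mod m"
  have "?E [^]\<^bsub>GL\<^esub> u = diagm (z ^ (i * u)) (z ^ (j * u))" by (simp add: diagm_pow power_mult)
  also have "\<dots> = diagm (z ^ 1) (z ^ ?l)"
    unfolding diagm_eq_iff z_cong_iff using u by (simp add: cong_def)
  finally have e: "D ?l = ?E [^]\<^bsub>GL\<^esub> u" by (simp add: D_def)
  have "D ?l \<in> generate GL {?E}"
    unfolding e using GL.generate_pow_on_finite_carrier[OF finGL diag_z_in] by blast
  then have "generate GL {D ?l} = generate GL {?E}"
    using GL.generate_eq_of_mem[OF finGL diag_z_in] ord_D assms(1) by simp
  moreover have "?l < m" by (rule mod_less_divisor[OF m_pos])
  ultimately show ?thesis by metis
qed

text \<open>In a diagonal matrix of order \<open>m\<close>, a power of the prime \<open>p\<close>, one of the two eigenvalues has order \<open>m\<close>;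
  exchanging them makes it the first one.\<close>

lemma cyclic_classes: "conj_class GL ` cyclic_subs GL m = (\<lambda>l. conj_class GL (generate GL {D l})) ` {..<m}"
proof (intro equalityI subsetI)
  fix X assume "X \<in> conj_class GL ` cyclic_subs GL m"
  then obtain A where A: "A \<in> carrier GL" "GL.ord A = m" "X = conj_class GL (generate GL {A})"
    unfolding cyclic_subs_def by blast
  have "A [^]\<^bsub>GL\<^esub> m = \<one>\<^bsub>GL\<^esub>" using GL.pow_ord_eq_1[OF A(1)] A(2) by simp
  then obtain h i j where h: "h \<in> carrier GL" "conj_by GL h A = diagm (z ^ i) (z ^ j)"
    using conj_diag[OF A(1)] by blast
  let ?E = "diagm (z ^ i) (z ^ j)" and ?E' = "diagm (z ^ j) (z ^ i)"
  have oE: "GL.ord ?E = m" using GL.ord_conj_by[OF h(1) A(1)] h(2) A(2) by simp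
  have X: "X = conj_class GL (generate GL {?E})"
    unfolding A(3) h(2)[symmetric] by (rule GL.conj_class_generate_eq[OF h(1) A(1), symmetric])
  have sw: "conj_by GL swap ?E = ?E'" by (rule conj_swap[OF diag_z_in diag_z_in])
  have oE': "GL.ord ?E' = m" using GL.ord_conj_by[OF swap_in diag_z_in[of i j]] sw oE by simp
  have X': "X = conj_class GL (generate GL {?E'})"
    unfolding X sw[symmetric] by (rule GL.conj_class_generate_eq[OF swap_in diag_z_in, symmetric])
  have "\<not> p dvd i \<or> \<not> p dvd j"
  proof (rule ccontr)
    assume "\<not> ?thesis"
    then have d: "p dvd i" "p dvd j" by auto
    obtain r' where r': "r = Suc r'" using p(2) by (cases r) auto
    have "m dvd i * p ^ r'" "m dvd j * p ^ r'" using d unfolding r' by (simp_all add: mult_dvd_mono)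
    then have "?E [^]\<^bsub>GL\<^esub> (p ^ r') = \<one>\<^bsub>GL\<^esub>"
      unfolding diagm_pow one_eq_diagm diagm_eq_iff power_mult[symmetric] z_ord by simp
    then have "m dvd p ^ r'" using GL.pow_eq_id[OF diag_z_in] oE by metis
    then have "p ^ Suc r' \<le> p ^ r'" unfolding r' using prime_gt_0_nat[OF p(1)] by (intro dvd_imp_le) auto
    then show False using prime_gt_1_nat[OF p(1)] by simp
  qed
  then obtain l where "l < m" "X = conj_class GL (generate GL {D l})"
    using diag_class[OF oE] diag_class[OF oE'] X X' by metis
  then show "X \<in> (\<lambda>l. conj_class GL (generate GL {D l})) ` {..<m}" by blast
next
  fix X assume "X \<in> (\<lambda>l. conj_class GL (generate GL {D l})) ` {..<m}"
  then obtain l where "X = conj_class GL (generate GL {D l})" by blast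
  moreover have "generate GL {D l} \<in> cyclic_subs GL m" unfolding cyclic_subs_def using D_in ord_D by blast
  ultimately show "X \<in> conj_class GL ` cyclic_subs GL m" by blast
qed

text \<open>A conjugation sends \<open>D k\<^sup>e\<close>, for some exponent \<open>e\<close>, to \<open>D l\<close>.  Equal trace and determinant mean equal
  eigenvalues up to order: either \<open>e = 1\<close> and \<open>l = k\<close>, or the eigenvalues are exchanged, so that
  \<open>k e = 1\<close> and \<open>l = e\<close>.\<close>

lemma D_class_iff:
  assumes kl: "k < m" "l < m"
  shows "conj_class GL (generate GL {D k}) = conj_class GL (generate GL {D l}) \<longleftrightarrow> l = k \<or> [k * l = 1] (mod m)"
proof
  assume "conj_class GL (generate GL {D k}) = conj_class GL (generate GL {D l})"
  then obtain h where h: "h \<in> carrier GL" "conj_by GL h ` generate GL {D k} = generate GL {D l}"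
    using GL.conj_class_eq_iff[OF GL.generate_subset[OF D_in] GL.generate_subset[OF D_in]] by blast
  have "D l \<in> conj_by GL h ` generate GL {D k}" unfolding h(2) by (rule GL.generate_self)
  then obtain e :: nat where e: "D l = conj_by GL h (D k [^]\<^bsub>GL\<^esub> e)"
    using GL.generate_pow_on_finite_carrier[OF finGL D_in] by auto
  have De: "D k [^]\<^bsub>GL\<^esub> e \<in> carrier GL" by (rule GL.nat_pow_closed[OF D_in])
  have t: "[tr2 (D l) = tr2 (D k [^]\<^bsub>GL\<^esub> e)] (mod int q)" and d: "[det2 (D l) = det2 (D k [^]\<^bsub>GL\<^esub> e)] (mod int q)"
    unfolding e using gl2_conj_invariants[OF h(1) De] by blast+
  have trd: "[tr2 (diagm a b) = a + b] (mod int q)" "[det2 (diagm a b) = a * b] (mod int q)" for a b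
    using cong_tr2_redm[of q "Mat a 0 0 b"] cong_det2_redm[of q "Mat a 0 0 b"] by (simp_all add: diagm_def)
  define b c where "b = z ^ e" and "c = z ^ (k * e)"
  have t': "[z + z ^ l = b + c] (mod int q)"
    using cong_trans[OF cong_sym[OF trd(1)] cong_trans[OF t[unfolded D_pow D_def[of l]] trd(1)]] by (simp add: b_def c_def)
  have d': "[z * z ^ l = b * c] (mod int q)"
    using cong_trans[OF cong_sym[OF trd(2)] cong_trans[OF d[unfolded D_pow D_def[of l]] trd(2)]] by (simp add: b_def c_def)
  have "(z - b) * (z - c) = z * z - z * (b + c) + b * c" by (simp add: algebra_simps)
  also have "[\<dots> = z * z - z * (z + z ^ l) + z * z ^ l] (mod int q)"
    by (intro cong_add cong_diff cong_mult cong_refl cong_sym[OF t'] cong_sym[OF d'])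
  finally have "int q dvd (z - b) * (z - c)" by (simp add: algebra_simps cong_0_iff)
  then consider "[z ^ 1 = z ^ e] (mod int q)" | "[z ^ 1 = z ^ (k * e)] (mod int q)"
    using dvd_mult_iff by (auto simp: cong_iff_dvd_diff b_def c_def)
  then show "l = k \<or> [k * l = 1] (mod m)"
  proof cases
    case 1
    then have e1: "[1 = e] (mod m)" unfolding z_cong_iff .
    have "[z + z ^ l - z = b + c - b] (mod int q)"
      using 1 by (intro cong_diff t') (simp add: b_def)
    then have "[z ^ l = z ^ (k * e)] (mod int q)" by (simp add: c_def)
    then have "[l = k * e] (mod m)" unfolding z_cong_iff .
    also have "[k * e = k * 1] (mod m)" by (intro cong_mult cong_refl cong_sym[OF e1])
    finally show ?thesis using kl by (simp add: cong_def)
  next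
    case 2
    then have e1: "[1 = k * e] (mod m)" unfolding z_cong_iff .
    have "[z + z ^ l - z = b + c - c] (mod int q)"
      using 2 by (intro cong_diff t') (simp add: c_def)
    then have "[z ^ l = z ^ e] (mod int q)" by (simp add: b_def)
    then have "[l = e] (mod m)" unfolding z_cong_iff .
    then have "[k * l = k * e] (mod m)" by (intro cong_mult cong_refl)
    then show ?thesis using cong_trans[OF _ cong_sym[OF e1]] by blast
  qed
next
  assume "l = k \<or> [k * l = 1] (mod m)"
  then show "conj_class GL (generate GL {D k}) = conj_class GL (generate GL {D l})"
  proof
    assume kl1: "[k * l = 1] (mod m)"
    let ?E = "diagm (z ^ k) z"
    have EG: "?E \<in> carrier GL" using diag_z_in[of k 1] by simp
    have sw: "conj_by GL swap (D k) = ?E" unfolding D_def by (rule conj_swap[OF D_in[unfolded D_def] EG])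
    have oE: "GL.ord ?E = m" using GL.ord_conj_by[OF swap_in D_in[of k]] sw ord_D by simp
    have "?E [^]\<^bsub>GL\<^esub> l = diagm (z ^ (k * l)) (z ^ l)" by (simp add: diagm_pow power_mult)
    also have "\<dots> = diagm (z ^ 1) (z ^ l)" unfolding diagm_eq_iff z_cong_iff using kl1 by simp
    finally have e: "D l = ?E [^]\<^bsub>GL\<^esub> l" by (simp add: D_def)
    have "D l \<in> generate GL {?E}"
      unfolding e using GL.generate_pow_on_finite_carrier[OF finGL EG] by blast
    then have "generate GL {D l} = generate GL {?E}"
      using GL.generate_eq_of_mem[OF finGL EG] ord_D oE by simp
    then show ?thesis using GL.conj_class_generate_eq[OF swap_in D_in[of k]] sw by simp
  qed simp
qed

lemma num_conj_split: "num_conj GL (cyclic_subs GL m) = card (inverse_orbits m)"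
proof -
  have "conj_class GL (generate GL {D k}) = conj_class GL (generate GL {D l}) \<longleftrightarrow>
      {i\<in>{..<m}. i = k \<or> [k * i = 1] (mod m)} = {i\<in>{..<m}. i = l \<or> [l * i = 1] (mod m)}"
    if kl: "k \<in> {..<m}" "l \<in> {..<m}" for k l
  proof -
    let ?c = "\<lambda>k. conj_class GL (generate GL {D k})"
    have f: "{i\<in>{..<m}. i = k \<or> [k * i = 1] (mod m)} = {i\<in>{..<m}. ?c k = ?c i}" if "k < m" for k
      using D_class_iff[OF that] by blast
    have "{i\<in>{..<m}. ?c k = ?c i} = {i\<in>{..<m}. ?c l = ?c i} \<longleftrightarrow> ?c k = ?c l"
    proof
      assume "{i\<in>{..<m}. ?c k = ?c i} = {i\<in>{..<m}. ?c l = ?c i}"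
      moreover have "l \<in> {i\<in>{..<m}. ?c l = ?c i}" using kl by simp
      ultimately show "?c k = ?c l" by blast
    qed simp
    then show ?thesis using f[of k] f[of l] kl by simp
  qed
  then show ?thesis
    unfolding num_conj_def cyclic_classes inverse_orbits_def by (rule card_image_cong_iff(1))
qed

end

lemma (in group) cyclic_subs_empty: "\<not> m dvd order G \<Longrightarrow> cyclic_subs G m = {}"
  unfolding cyclic_subs_def using ord_dvd_group_order by blast

lemma (in group) elementary_subs_empty:
  assumes "\<not> p^2 dvd order G" shows "elementary_subs G p = {}"
proof (rule ccontr)
  assume "elementary_subs G p \<noteq> {}"
  then obtain S where S: "subgroup S G" "card S = p^2" unfolding elementary_subs_def by blast
  have "p^2 dvd order G" unfolding S(2)[symmetric] lagrange[OF S(1), symmetric] by (rule dvd_triv_right)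
  then show False using assms by simp
qed

lemma (in group) elementary_subs_conj:
  assumes "S \<in> elementary_subs G p" "h \<in> carrier G"
  shows "conj_by G h ` S \<in> elementary_subs G p"
proof -
  have S: "subgroup S G" "card S = p^2" "\<And>x. x \<in> S \<Longrightarrow> x [^] p = \<one>"
    using assms(1) by (auto simp: elementary_subs_def)
  have Sc: "S \<subseteq> carrier G" using subgroup.subset[OF S(1)] .
  have "x [^] p = \<one>" if x: "x \<in> conj_by G h ` S" for x
  proof -
    obtain y where y: "y \<in> S" "x = conj_by G h y" using x by blast
    have yc: "y \<in> carrier G" using y Sc by blast
    have "x [^] p = conj_by G h (y [^] p)" unfolding y(2) by (rule conj_by_pow[OF assms(2) yc, symmetric])
    then show ?thesis using S(3)[OF y(1)] assms(2) by simp
  qed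
  then show ?thesis
    unfolding elementary_subs_def using conj_by_subgroup[OF S(1) assms(2)] card_conj_by[OF assms(2) Sc] S(2) by auto
qed

section \<open>The cyclic group of units modulo the square of an odd prime\<close>

text \<open>A cyclic group has exactly one subgroup of each order dividing its own, and that subgroup contains
  every element of order dividing \<open>m\<close>.\<close>

lemma (in group) cyclic_group_subs:
  assumes fin: "finite (carrier G)" and g: "g \<in> carrier G" "generate G {g} = carrier G"
    and m: "0 < m" "m dvd order G"
  shows "\<exists>S. {x \<in> carrier G. x [^] m = \<one>} = S \<and> cyclic_subs G m = {S} \<and> card S = m"
proof -
  have og: "ord g = order G" using generate_pow_card[OF g(1)] g(2) by (simp add: order_def)
  obtain e where e: "order G = e * m" using m(2) by (metis dvdE mult.commute)
  have "order G \<noteq> 0" using fin order_gt_0_iff_finite by simp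
  then have e0: "0 < e" using e by (cases e) auto
  define a where "a = g [^] e"
  have a: "a \<in> carrier G" using g by (simp add: a_def)
  have oa: "ord a = m" unfolding a_def using ord_pow[OF g(1), of e] og e e0 by simp
  have sub: "{x \<in> carrier G. x [^] m = \<one>} \<subseteq> generate G {a}"
  proof
    fix x assume "x \<in> {x \<in> carrier G. x [^] m = \<one>}"
    then have x: "x \<in> generate G {g}" "x [^] m = \<one>" unfolding g(2) by blast+
    obtain i :: nat where i: "x = g [^] i" using x(1) generate_pow_on_finite_carrier[OF fin g(1)] by blast
    have "g [^] (i * m) = \<one>" using x(2) unfolding i nat_pow_pow[OF g(1)] .
    then have "e * m dvd i * m" using pow_eq_id[OF g(1)] og e by simp
    then have "e dvd i" using m(1) by simp
    then obtain j where "i = e * j" by (auto elim: dvdE)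
    then have "x = a [^] j" using i g(1) by (simp add: a_def nat_pow_pow)
    then show "x \<in> generate G {a}" using generate_pow_on_finite_carrier[OF fin a] by blast
  qed
  have sup: "generate G {b} \<subseteq> {x \<in> carrier G. x [^] m = \<one>}" if b: "b \<in> carrier G" "ord b = m" for b
  proof
    fix x assume "x \<in> generate G {b}"
    then obtain j :: nat where j: "x = b [^] j" using generate_pow_on_finite_carrier[OF fin b(1)] by blast
    have "x [^] m = b [^] (m * j)" using j b(1) by (simp add: nat_pow_pow mult.commute)
    then have "x [^] m = \<one>" using pow_eq_id[OF b(1)] b(2) by simp
    then show "x \<in> {x \<in> carrier G. x [^] m = \<one>}" using j b(1) by simp
  qed
  have eq: "generate G {a} = {x \<in> carrier G. x [^] m = \<one>}" using sub sup[OF a oa] by blast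
  have "S = generate G {a}" if S: "S \<in> cyclic_subs G m" for S
  proof -
    obtain b where b: "b \<in> carrier G" "ord b = m" "S = generate G {b}" using S unfolding cyclic_subs_def by blast
    have "b \<in> generate G {a}" using sup[OF b(1,2)] generate_self sub by blast
    then show ?thesis using generate_eq_of_mem[OF fin a] b oa by simp
  qed
  moreover have "generate G {a} \<in> cyclic_subs G m" unfolding cyclic_subs_def using a oa by blast
  ultimately have "cyclic_subs G m = {generate G {a}}" by blast
  then show ?thesis using eq generate_pow_card[OF a] oa by auto
qed

text \<open>The unit group is cyclic of order \<open>q (q - 1)\<close>, and \<open>p\<close> is prime to \<open>q\<close>.  A cyclic group has
  no elementary abelian subgroup of order \<open>p\<^sup>2\<close>.\<close>

lemma unit_group_p2_counts:
  assumes q: "prime q" "2 < q" and p: "prime p" "p \<noteq> q"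
  shows "num_conj (unit_group (q^2)) (cyclic_subs (unit_group (q^2)) (p^r)) = (if p^r dvd q - 1 then 1 else 0)"
    and "elementary_subs (unit_group (q^2)) p = {}"
proof -
  have q2: "1 < q^2" by (rule one_less_power) (use q in auto)
  interpret U: group "unit_group (q^2)" by (rule group_unit_group[OF q2])
  have fin: "finite (carrier (unit_group (q^2)))" by simp
  have ord: "order (unit_group (q^2)) = q * (q - 1)"
    using totient_prime_power[OF q(1), of 2] by (simp add: order_def totient_def)
  have cop: "coprime (p^i) q" for i using primes_coprime[OF p(1) q(1) p(2)] by simp
  have dv: "p^i dvd order (unit_group (q^2)) \<longleftrightarrow> p^i dvd q - 1" for i
    unfolding ord by (rule coprime_dvd_mult_right_iff[OF cop])
  have "odd q" using q prime_odd_nat by auto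
  then obtain g where "\<forall>k>0. residue_primroot (q ^ k) g"
    using residue_primroot_odd_prime_power_exists[OF q(1)] by blast
  then have pr: "residue_primroot (q^2) g" by simp
  define u where "u = g mod q^2"
  have "coprime g (q^2)" using pr by (simp add: residue_primroot_def coprime_commute)
  then have u: "u \<in> carrier (unit_group (q^2))" using mod_in_totatives[OF q2] by (simp add: u_def)
  have gen: "generate (unit_group (q^2)) {u} = carrier (unit_group (q^2))"
  proof (intro equalityI U.generate_subset[OF u] subsetI)
    fix x assume "x \<in> carrier (unit_group (q^2))"
    then obtain i where "x = g ^ i mod q^2"
      using residue_primroot_is_generator[OF q2 pr] by (auto simp: bij_betw_def)
    then have "x = u [^]\<^bsub>unit_group (q^2)\<^esub> i" unfolding u_def pow_unit_group[OF q2] by (simp add: power_mod)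
    then show "x \<in> generate (unit_group (q^2)) {u}"
      using U.generate_pow_on_finite_carrier[OF fin u] by blast
  qed
  note c = U.cyclic_group_subs[OF fin u gen]
  have pos: "0 < p ^ i" for i using prime_gt_0_nat[OF p(1)] by simp
  show "num_conj (unit_group (q^2)) (cyclic_subs (unit_group (q^2)) (p^r)) = (if p^r dvd q - 1 then 1 else 0)"
  proof (cases "p^r dvd q - 1")
    case True
    then obtain S where "cyclic_subs (unit_group (q^2)) (p^r) = {S}" using c[OF pos, of r] dv by blast
    then show ?thesis using True by (simp add: num_conj_def)
  next
    case False
    then show ?thesis using U.cyclic_subs_empty dv by simp
  qed
  show "elementary_subs (unit_group (q^2)) p = {}"
  proof (cases "p dvd order (unit_group (q^2))")
    case True
    then have cd: "card {x \<in> carrier (unit_group (q^2)). x [^]\<^bsub>unit_group (q^2)\<^esub> p = \<one>\<^bsub>unit_group (q^2)\<^esub>} = p"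
      using c[of p] prime_gt_0_nat[OF p(1)] by blast
    show ?thesis
    proof (rule ccontr)
      assume "elementary_subs (unit_group (q^2)) p \<noteq> {}"
      then obtain S where S: "S \<in> elementary_subs (unit_group (q^2)) p" by blast
      have sub: "S \<subseteq> {x \<in> carrier (unit_group (q^2)). x [^]\<^bsub>unit_group (q^2)\<^esub> p = \<one>\<^bsub>unit_group (q^2)\<^esub>}"
        using U.elementary_subs_mem(1)[OF S] S unfolding elementary_subs_def by blast
      have "card S \<le> p" using card_mono[OF _ sub] cd fin by simp
      then have "p^2 \<le> p" using U.elementary_subs_mem(2)[OF S] by simp
      then show False using prime_gt_1_nat[OF p(1)] by (simp add: power2_eq_square)
    qed
  next
    case False
    have "\<not> p^2 dvd order (unit_group (q^2))"
      using False dvd_trans[of p "p^2"] by (auto simp: power2_eq_square)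
    then show ?thesis by (rule U.elementary_subs_empty)
  qed
qed

lemma unit_group_4:
  "num_conj (unit_group 4) (cyclic_subs (unit_group 4) 3) = 0" "num_conj (unit_group 4) (cyclic_subs (unit_group 4) 9) = 0"
  "elementary_subs (unit_group 4) 3 = {}"
proof -
  interpret U: group "unit_group 4" by (rule group_unit_group) simp
  have "totient (2^2) = 2" using totient_prime_power[OF two_is_prime_nat, of 2] by simp
  then have ord: "order (unit_group 4) = 2" by (simp add: order_def totient_def)
  show "num_conj (unit_group 4) (cyclic_subs (unit_group 4) 3) = 0" "num_conj (unit_group 4) (cyclic_subs (unit_group 4) 9) = 0"
    using U.cyclic_subs_empty[of 3] U.cyclic_subs_empty[of 9] ord by simp_all
  show "elementary_subs (unit_group 4) 3 = {}"
    by (rule U.elementary_subs_empty) (simp add: ord)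
qed

section \<open>The group \<open>GL\<^sub>2(2)\<close>\<close>

lemma carrier_gl2_2: "carrier (gl2 2) = {Mat 1 0 0 1, Mat 0 1 1 0, Mat 1 1 0 1, Mat 1 0 1 1, Mat 0 1 1 1, Mat 1 1 1 0}"
proof (intro equalityI subsetI)
  fix A assume A: "A \<in> carrier (gl2 2)"
  obtain a b c d where AM: "A = Mat a b c d" by (cases A)
  have e: "a mod 2 = a" "b mod 2 = b" "c mod 2 = c" "d mod 2 = d"
    using A by (simp_all add: AM carrier_gl2 redm_def)
  have "x = 0 \<or> x = 1" if "x mod 2 = x" for x :: int using that by presburger
  then have "a = 0 \<or> a = 1" "b = 0 \<or> b = 1" "c = 0 \<or> c = 1" "d = 0 \<or> d = 1" using e by blast+
  moreover have "coprime (a * d - b * c) 2" using A by (simp add: AM carrier_gl2)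
  ultimately show "A \<in> {Mat 1 0 0 1, Mat 0 1 1 0, Mat 1 1 0 1, Mat 1 0 1 1, Mat 0 1 1 1, Mat 1 1 1 0}"
    unfolding AM by auto
qed (auto simp: carrier_gl2 redm_def)

text \<open>A group isomorphic to the symmetric group on three letters: its two elements of order 3 generate
  the same subgroup.\<close>

lemma gl2_2_counts:
  "num_conj (gl2 2) (cyclic_subs (gl2 2) 3) = 1" "num_conj (gl2 2) (cyclic_subs (gl2 2) 9) = 0"
  "elementary_subs (gl2 2) 3 = {}"
proof -
  interpret L: group "gl2 2" by (rule group_gl2)
  have fin: "finite (carrier (gl2 2))" by (rule finite_gl2) simp
  have ord: "order (gl2 2) = 6" by (simp add: order_def carrier_gl2_2)
  show "num_conj (gl2 2) (cyclic_subs (gl2 2) 9) = 0" using L.cyclic_subs_empty[of 9] ord by simp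
  show "elementary_subs (gl2 2) 3 = {}" by (rule L.elementary_subs_empty) (simp add: ord)
  let ?X = "Mat 0 1 1 1" and ?Y = "Mat 1 1 1 0"
  have one: "\<one>\<^bsub>gl2 2\<^esub> = Mat 1 0 0 1" by (simp add: one_gl2 redm_def)
  have pow3: "A [^]\<^bsub>gl2 2\<^esub> (3::nat) = redm 2 (A * (A * A))" for A
    unfolding pow_gl2 by (simp add: numeral_3_eq_3)
  have X: "?X \<in> carrier (gl2 2)" by (simp add: carrier_gl2_2)
  have oX: "L.ord ?X = 3"
  proof (rule L.ord_prime_if_pow[OF _ X])
    show "?X [^]\<^bsub>gl2 2\<^esub> (3::nat) = \<one>\<^bsub>gl2 2\<^esub>" unfolding pow3 one by (simp add: redm_def)
  qed (simp_all add: one)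
  have XY: "generate (gl2 2) {?Y} = generate (gl2 2) {?X}" if "L.ord ?Y = 3"
  proof (rule L.generate_eq_of_mem[OF fin X])
    have "?Y = ?X [^]\<^bsub>gl2 2\<^esub> (2::nat)" unfolding pow_gl2 power2_eq_square by (simp add: redm_def)
    then show "?Y \<in> generate (gl2 2) {?X}" using L.generate_pow_on_finite_carrier[OF fin X] by blast
  qed (simp add: that oX)
  have "S = generate (gl2 2) {?X}" if S: "S \<in> cyclic_subs (gl2 2) 3" for S
  proof -
    obtain A where A: "A \<in> carrier (gl2 2)" "L.ord A = 3" "S = generate (gl2 2) {A}"
      using S unfolding cyclic_subs_def by blast
    have p: "A [^]\<^bsub>gl2 2\<^esub> (3::nat) = \<one>\<^bsub>gl2 2\<^esub>" using L.pow_ord_eq_1[OF A(1)] A(2) by simp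
    have n1: "A \<noteq> Mat 1 0 0 1" using A(2) L.ord_id one by auto
    have "A = ?X \<or> A = ?Y" using A(1) p n1 unfolding carrier_gl2_2 pow3 one by (auto simp: redm_def)
    then show ?thesis using A XY by auto
  qed
  moreover have "generate (gl2 2) {?X} \<in> cyclic_subs (gl2 2) 3" unfolding cyclic_subs_def using X oX by blast
  ultimately have "cyclic_subs (gl2 2) 3 = {generate (gl2 2) {?X}}" by blast
  then show "num_conj (gl2 2) (cyclic_subs (gl2 2) 3) = 1" by (simp add: num_conj_def)
qed

section \<open>Residues up to inversion\<close>

text \<open>Orbits of an involution have one or two elements; counting both sides over the orbits of each size
  gives the identity.\<close>

lemma card_involution_orbits:
  assumes fin: "finite X" and inv: "\<And>x. x \<in> X \<Longrightarrow> s x \<in> X \<and> s (s x) = x"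
  shows "2 * card ((\<lambda>x. {x, s x}) ` X) = card X + card {x\<in>X. s x = x}"
proof -
  let ?F = "{x\<in>X. s x = x}" and ?N = "{x\<in>X. s x \<noteq> x}"
  let ?o = "\<lambda>x. {x, s x}"
  have X: "X = ?F \<union> ?N" by blast
  have dis: "?o ` ?F \<inter> ?o ` ?N = {}"
  proof (rule ccontr)
    assume "?o ` ?F \<inter> ?o ` ?N \<noteq> {}"
    then obtain x y where "x \<in> ?F" "y \<in> ?N" "{x, s x} = {y, s y}" by blast
    then show False by auto
  qed
  have cF: "card (?o ` ?F) = card ?F"
    by (rule card_image) (auto intro: inj_onI)
  have cN: "card ?N = 2 * card (?o ` ?N)"
  proof -
    have U: "?N = \<Union>(?o ` ?N)"
    proof (intro equalityI subsetI)
      fix y assume "y \<in> \<Union>(?o ` ?N)"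
      then obtain x where x: "x \<in> X" "s x \<noteq> x" "y = x \<or> y = s x" by blast
      then show "y \<in> ?N" using inv[OF x(1)] by auto
    qed blast
    have "card (\<Union>(?o ` ?N)) = (\<Sum>c\<in>?o ` ?N. card c)"
    proof (rule card_Union_disjoint)
      show "pairwise disjnt (?o ` ?N)"
      proof (rule pairwiseI)
        fix c d assume "c \<in> ?o ` ?N" "d \<in> ?o ` ?N" and ne: "c \<noteq> d"
        then obtain x y where xy: "x \<in> X" "y \<in> X" "c = {x, s x}" "d = {y, s y}" by blast
        show "disjnt c d"
        proof (rule ccontr)
          assume "\<not> disjnt c d"
          then have "x = y \<or> x = s y \<or> s x = y \<or> s x = s y" unfolding xy disjnt_def by blast
          then have "x = y \<or> x = s y" using inv[OF xy(1)] inv[OF xy(2)] by metis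
          then show False using ne inv[OF xy(2)] unfolding xy by auto
        qed
      qed
    qed auto
    also have "\<dots> = (\<Sum>c\<in>?o ` ?N. 2)" by (rule sum.cong) auto
    finally show ?thesis using U by simp
  qed
  have "card (?o ` X) = card (?o ` ?F) + card (?o ` ?N)"
  proof -
    have "?o ` X = ?o ` ?F \<union> ?o ` ?N" by blast
    then show ?thesis using dis fin by (simp add: card_Un_disjoint)
  qed
  moreover have "card X = card ?F + card ?N"
  proof -
    have "card (?F \<union> ?N) = card ?F + card ?N" by (rule card_Un_disjoint) (use fin in auto)
    then show ?thesis using X by simp
  qed
  ultimately show ?thesis using cF cN by linarith
qed

lemma card_inverse_orbits:
  assumes m: "1 < m"
  shows "2 * card (inverse_orbits m) = m + card {k\<in>{..<m}. \<not> coprime k m \<or> [k * k = 1] (mod m)}"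
proof -
  have ex: "\<exists>l<m. [k * l = 1] (mod m)" if c: "coprime k m" for k
  proof -
    obtain l where "[k * l = 1] (mod m)" using cong_solve_coprime_nat[OF c] by auto
    then have "[k * (l mod m) = 1] (mod m)" by (simp add: cong_def mod_simps)
    then show ?thesis using m by (intro exI[of _ "l mod m"]) simp
  qed
  define s where "s = (\<lambda>k. if coprime k m then SOME l. l < m \<and> [k * l = 1] (mod m) else k)"
  have s: "s k < m \<and> [k * s k = 1] (mod m)" if c: "coprime k m" for k
    using someI_ex[OF ex[OF c]] c by (simp add: s_def)
  have uniq: "l = l'" if "l < m" "l' < m" "[k * l = 1] (mod m)" "[k * l' = 1] (mod m)" for k l l'
  proof -
    have "coprime k m" using that(3) coprime_iff_invertible_nat by auto
    moreover have "[k * l = k * l'] (mod m)" using that(3,4) cong_sym cong_trans by blast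
    ultimately have "[l = l'] (mod m)" by (simp add: cong_mult_lcancel_nat)
    then show ?thesis using that(1,2) by (simp add: cong_less_modulus_unique_nat)
  qed
  have cop: "coprime k m" if "[k * l = 1] (mod m)" for k l
    using that coprime_iff_invertible_nat by auto
  have orb: "{l\<in>{..<m}. l = k \<or> [k * l = 1] (mod m)} = {k, s k}" if k: "k \<in> {..<m}" for k
  proof (cases "coprime k m")
    case True
    then show ?thesis using s[OF True] uniq[of _ "s k" k] k by auto
  next
    case False
    then have "s k = k" by (simp add: s_def)
    then show ?thesis using cop[of k] False k by auto
  qed
  have inv: "s k \<in> {..<m} \<and> s (s k) = k" if k: "k \<in> {..<m}" for k
  proof (cases "coprime k m")
    case True
    have sk: "[s k * k = 1] (mod m)" using s[OF True] by (simp add: mult.commute)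
    have "s (s k) = k" using uniq[of "s (s k)" k "s k"] s[OF cop[OF sk]] sk k by simp
    then show ?thesis using s[OF True] by simp
  next
    case False
    then show ?thesis using k by (simp add: s_def)
  qed
  have "inverse_orbits m = (\<lambda>k. {k, s k}) ` {..<m}"
    unfolding inverse_orbits_def by (rule image_cong[OF refl orb])
  then have "2 * card (inverse_orbits m) = m + card {k\<in>{..<m}. s k = k}"
    using card_involution_orbits[of "{..<m}" s] inv by simp
  also have "{k\<in>{..<m}. s k = k} = {k\<in>{..<m}. \<not> coprime k m \<or> [k * k = 1] (mod m)}"
  proof (intro Collect_cong conj_cong refl)
    fix k assume k: "k \<in> {..<m}"
    show "s k = k \<longleftrightarrow> \<not> coprime k m \<or> [k * k = 1] (mod m)"
    proof (cases "coprime k m")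
      case True
      then show ?thesis using s[OF True] uniq[of "s k" k k] k by auto
    qed (simp add: s_def)
  qed
  finally show ?thesis .
qed

lemma card_inverse_orbits_2: "card (inverse_orbits 2) = 2"
proof -
  have "{k\<in>{..<2::nat}. \<not> coprime k 2 \<or> [k * k = 1] (mod 2)} = {..<2}"
    by (auto simp: less_2_cases_iff)
  then show ?thesis using card_inverse_orbits[of 2] by simp
qed

lemma card_inverse_orbits_4: "card (inverse_orbits 4) = 4"
proof -
  have "\<not> coprime k 4 \<or> [k * k = 1] (mod 4)" if "k < 4" for k :: nat
  proof -
    have "k = 0 \<or> k = 1 \<or> k = 2 \<or> k = 3" using that by linarith
    moreover have "\<not> coprime (2::nat) 4" by (simp add: coprime_iff_gcd_eq_1 gcd_nat.absorb1)
    ultimately show ?thesis by (auto simp: cong_def)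
  qed
  then have "{k\<in>{..<4::nat}. \<not> coprime k 4 \<or> [k * k = 1] (mod 4)} = {..<4}" by auto
  then show ?thesis using card_inverse_orbits[of 4] by simp
qed

text \<open>Besides the \<open>p\<^sup>r\<^sup>-\<^sup>1\<close> residues that are not units, the residues fixed by inversion are 1 and -1: modulo a power
  of an odd prime these are the only square roots of 1.\<close>

lemma card_inverse_orbits_odd_prime_power:
  assumes p: "prime p" "2 < p" and r: "0 < r"
  shows "2 * card (inverse_orbits (p ^ r)) = p ^ r + p ^ (r - 1) + 2"
proof -
  let ?m = "p ^ r"
  have m: "1 < ?m" by (rule one_less_power) (use p r in auto)
  have m2: "2 < ?m" using self_le_power[of p r] p r by simp
  have "{k\<in>{..<?m}. \<not> coprime k ?m \<or> [k * k = 1] (mod ?m)} = {k\<in>{..<?m}. \<not> coprime k ?m} \<union> {1, ?m - 1}"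
  proof (intro equalityI subsetI)
    fix k assume "k \<in> {k\<in>{..<?m}. \<not> coprime k ?m \<or> [k * k = 1] (mod ?m)}"
    then have k: "k < ?m" "\<not> coprime k ?m \<or> [k * k = 1] (mod ?m)" by auto
    show "k \<in> {k\<in>{..<?m}. \<not> coprime k ?m} \<union> {1, ?m - 1}"
    proof (cases "coprime k ?m")
      case True
      then have kk: "[k * k = 1] (mod ?m)" using k by simp
      have k0: "0 < k"
      proof (rule Nat.gr0I)
        assume "k = 0" then show False using True m p r by simp
      qed
      have "?m dvd k * k - 1" using kk k0 cong_altdef_nat[of 1 "k * k" ?m] by (simp add: cong_sym_eq)
      also have "k * k - 1 = (k - 1) * (k + 1)" by (simp add: algebra_simps)
      finally have dv: "?m dvd (k - 1) * (k + 1)" .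
      have "\<not> p dvd k - 1 \<or> \<not> p dvd k + 1"
      proof (rule ccontr)
        assume "\<not> ?thesis"
        then have d: "p dvd k + 1" "p dvd k - 1" by blast+
        have "p dvd (k + 1) - (k - 1)" by (rule dvd_diff_nat[OF d])
        then have "p dvd 2" using k0 by simp
        then show False using p by (auto dest: dvd_imp_le)
      qed
      then have "coprime p (k - 1) \<or> coprime p (k + 1)"
        using prime_imp_coprime[OF p(1), of "k - 1"] prime_imp_coprime[OF p(1), of "k + 1"] by blast
      then have "coprime ?m (k - 1) \<or> coprime ?m (k + 1)" by auto
      then have "?m dvd k + 1 \<or> ?m dvd k - 1"
        using dv coprime_dvd_mult_right_iff[of ?m "k - 1" "k + 1"] coprime_dvd_mult_left_iff[of ?m "k + 1" "k - 1"]
        by blast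
      then show ?thesis
      proof
        assume "?m dvd k + 1"
        then have "?m \<le> k + 1" by (rule dvd_imp_le) simp
        then have "k = ?m - 1" using k(1) by linarith
        then show ?thesis by blast
      next
        assume "?m dvd k - 1"
        then have "k - 1 = 0" using k(1) dvd_imp_le[of ?m "k - 1"] by (cases "k - 1 = 0") auto
        then show ?thesis using k0 by simp
      qed
    qed (use k in simp)
  next
    fix k assume k: "k \<in> {k\<in>{..<?m}. \<not> coprime k ?m} \<union> {1, ?m - 1}"
    have "[(?m - 1) * (?m - 1) = 1] (mod ?m)"
    proof -
      have "(M - 1) * (M - 1) = 1 + M * (M - 2)" if "2 \<le> M" for M :: nat
        using le_Suc_ex[OF that] by auto
      then have "(?m - 1) * (?m - 1) = 1 + ?m * (?m - 2)" using m2 less_imp_le by blast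
      then show ?thesis by (simp only: cong_def mod_mult_self2)
    qed
    then show "k \<in> {k\<in>{..<?m}. \<not> coprime k ?m \<or> [k * k = 1] (mod ?m)}" using k m by auto
  qed
  moreover have "card ({k\<in>{..<?m}. \<not> coprime k ?m} \<union> {1, ?m - 1}) = p ^ (r - 1) + 2"
  proof -
    have "totatives ?m = {k\<in>{..<?m}. coprime k ?m}"
    proof (intro equalityI subsetI)
      fix k assume "k \<in> totatives ?m"
      then show "k \<in> {k\<in>{..<?m}. coprime k ?m}" using totatives_less[OF _ m] by (auto simp: totatives_def)
    next
      fix k assume k: "k \<in> {k\<in>{..<?m}. coprime k ?m}"
      have "k \<noteq> 0" using k m p r by (intro notI) simp
      then show "k \<in> totatives ?m" using k by (auto simp: totatives_def)
    qed
    then have "{k\<in>{..<?m}. \<not> coprime k ?m} = {..<?m} - totatives ?m" by auto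
    then have "card {k\<in>{..<?m}. \<not> coprime k ?m} = ?m - totient ?m"
      using totatives_less[OF _ m] by (simp add: card_Diff_subset totient_def subset_iff)
    also have "totient ?m = p ^ (r - 1) * (p - 1)" using totient_prime_power[OF p(1) r] by simp
    also have "?m - p ^ (r - 1) * (p - 1) = p ^ (r - 1)"
    proof -
      have "?m = p ^ (r - 1) * p" using r by (cases r) auto
      then have "?m - p ^ (r - 1) * (p - 1) = p ^ (r - 1) * (p - (p - 1))" by (simp only: diff_mult_distrib2)
      then show ?thesis using p by simp
    qed
    finally have c: "card {k\<in>{..<?m}. \<not> coprime k ?m} = p ^ (r - 1)" .
    have "coprime (?m - 1) ?m" by (rule coprime_diff_one_left_nat) (use p in simp)
    then have "{k\<in>{..<?m}. \<not> coprime k ?m} \<inter> {1, ?m - 1} = {}" by auto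
    then show ?thesis using c m2 by (subst card_Un_disjoint) auto
  qed
  ultimately show ?thesis using card_inverse_orbits[OF m] by simp
qed

section \<open>Elementary abelian subgroups of the general linear group\<close>

context odd_prime_field begin

text \<open>Conjugate a non-trivial element into the field.  The subgroup is abelian, hence contained in the
  centraliser of that element, which is the field; but the field has only \<open>p\<close> elements with \<open>p\<close>-th
  power 1.\<close>

lemma elementary_nonsplit:
  assumes p: "prime p" "p \<noteq> q" and nd: "\<not> p dvd q - 1"
  shows "elementary_subs GL p = {}"
proof (rule ccontr)
  assume "elementary_subs GL p \<noteq> {}"
  then obtain S where S: "S \<in> elementary_subs GL p" by blast
  have p0: "0 < p" "1 < p" using prime_gt_0_nat[OF p(1)] prime_gt_1_nat[OF p(1)] by auto
  have pp: "p < p^2" using p0 by (simp add: power2_eq_square)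
  have "\<exists>x\<in>S. x \<noteq> \<one>\<^bsub>GL\<^esub>"
  proof (rule ccontr)
    assume "\<not> ?thesis"
    then have "S \<subseteq> {\<one>\<^bsub>GL\<^esub>}" by blast
    then have "card S \<le> 1" using card_mono[of "{\<one>\<^bsub>GL\<^esub>}" S] by simp
    then show False using GL.elementary_subs_mem(2)[OF S] pp p0 by simp
  qed
  then obtain x where x: "x \<in> S" "x \<noteq> \<one>\<^bsub>GL\<^esub>" by blast
  have xG: "x \<in> carrier GL" using GL.elementary_subs_mem(1)[OF S] x by blast
  have xp: "x [^]\<^bsub>GL\<^esub> p = \<one>\<^bsub>GL\<^esub>" using S x unfolding elementary_subs_def by blast
  have ox: "GL.ord x = p" by (rule GL.ord_prime_if_pow[OF p(1) xG xp x(2)])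
  have "\<not> q dvd p" using primes_dvd_imp_eq[OF q(1) p(1)] p(2) by blast
  then obtain h a b where h: "h \<in> carrier GL" "conj_by GL h x = normm a b" "\<not> int q dvd b"
    using nonsplit_conj[OF xG ox p0(1) nd] by blast
  define T where "T = conj_by GL h ` S"
  have T: "T \<in> elementary_subs GL p" unfolding T_def by (rule GL.elementary_subs_conj[OF S h(1)])
  have Ts: "subgroup T GL" "card T = p^2" using T unfolding elementary_subs_def by blast+
  have nT: "normm a b \<in> T" unfolding T_def h(2)[symmetric] using x(1) by (rule imageI)
  have "T \<subseteq> {u \<in> carrier KF. u [^]\<^bsub>GL\<^esub> p = \<one>\<^bsub>GL\<^esub>}"
  proof
    fix B assume B: "B \<in> T"
    have BG: "B \<in> carrier GL" using GL.elementary_subs_mem(1)[OF T] B by blast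
    have "B \<otimes>\<^bsub>GL\<^esub> normm a b = normm a b \<otimes>\<^bsub>GL\<^esub> B"
      by (rule GL.subgroup_order_p2_comm[OF finGL p(1) Ts B nT])
    then have "B \<in> carrier KF" using commutes_normm[OF BG h(3)] by simp
    then show "B \<in> {u \<in> carrier KF. u [^]\<^bsub>GL\<^esub> p = \<one>\<^bsub>GL\<^esub>}" using T B unfolding elementary_subs_def by blast
  qed
  then have "card T \<le> card {u \<in> carrier KF. u [^]\<^bsub>GL\<^esub> p = \<one>\<^bsub>GL\<^esub>}" using card_KF(1) by (intro card_mono) auto
  also have "\<dots> \<le> p" by (rule KF_roots[OF p0(1)])
  finally show False using Ts(2) pp by simp
qed

lemma diagm_mult: "diagm a b \<otimes>\<^bsub>GL\<^esub> diagm c d = diagm (a * c) (b * d)"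
  by (simp add: diagm_def)

lemma conj_scalar:
  assumes "diagm a a \<in> carrier GL" "h \<in> carrier GL"
  shows "conj_by GL h (diagm a a) = diagm a a"
proof -
  obtain u v w x where h: "h = Mat u v w x" by (cases h)
  have "h \<otimes>\<^bsub>GL\<^esub> diagm a a = diagm a a \<otimes>\<^bsub>GL\<^esub> h" by (simp add: h diagm_def mult.commute)
  then show ?thesis unfolding conj_by_def
    using GL.inv_solve_right'[OF assms(1) GL.m_closed[OF assms(2,1)] assms(2)] by blast
qed

end

context split_torus begin

definition diag_roots :: "mat2 set" where "diag_roots = {diagm (z ^ i) (z ^ j) | i j. True}"

text \<open>Not all elements are scalars, since there are only \<open>p\<close> scalars with \<open>p\<close>-th power 1.  Diagonalise an
  element that is not; its centraliser consists of the diagonal matrices, so the whole subgroup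
  becomes diagonal and has to be the group of all diagonal matrices over the \<open>p\<close>-th roots of unity.\<close>

lemma elementary_split:
  assumes r1: "r = 1"
  shows "num_conj GL (elementary_subs GL p) = 1"
proof (rule GL.num_conj_eq_1[of diag_roots])
  have mp: "m = p" using r1 by simp
  have p0: "0 < p" "1 < p" using prime_gt_0_nat[OF p(1)] prime_gt_1_nat[OF p(1)] by auto
  have pp: "p < p^2" using p0 by (simp add: power2_eq_square)
  have zc: "[z ^ i = z ^ j] (mod int q) \<longleftrightarrow> [i = j] (mod p)" for i j using z_cong_iff mp by simp
  have pw: "diagm (z ^ i) (z ^ j) [^]\<^bsub>GL\<^esub> p = \<one>\<^bsub>GL\<^esub>" for i j
    unfolding diagm_pow one_eq_diagm diagm_eq_iff power_mult[symmetric] z_ord mp by simp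
  have cT: "card diag_roots = p^2"
  proof -
    let ?f = "\<lambda>(i, j). diagm (z ^ i) (z ^ j)"
    have "diag_roots = ?f ` ({..<p} \<times> {..<p})"
    proof (intro equalityI subsetI)
      fix A assume "A \<in> diag_roots"
      then obtain i j where "A = diagm (z ^ i) (z ^ j)" unfolding diag_roots_def by blast
      also have "\<dots> = ?f (i mod p, j mod p)" by (simp add: diagm_eq_iff zc)
      finally show "A \<in> ?f ` ({..<p} \<times> {..<p})" by (rule image_eqI) (use p0 in simp)
    qed (auto simp: diag_roots_def)
    moreover have "inj_on ?f ({..<p} \<times> {..<p})"
      by (rule inj_onI) (auto simp: diagm_eq_iff zc cong_less_modulus_unique_nat)
    ultimately show ?thesis by (simp add: card_image card_cartesian_product power2_eq_square)
  qed
  have sub: "diag_roots \<subseteq> carrier GL" unfolding diag_roots_def using diag_z_in by blast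
  have "subgroup diag_roots GL"
  proof (rule GL.subgroupI[OF sub])
    have "diagm (z ^ 0) (z ^ 0) \<in> diag_roots" unfolding diag_roots_def by blast
    then show "diag_roots \<noteq> {}" by blast
  next
    fix A B assume "A \<in> diag_roots" "B \<in> diag_roots"
    then obtain i j i' j' where "A = diagm (z ^ i) (z ^ j)" "B = diagm (z ^ i') (z ^ j')" unfolding diag_roots_def by blast
    then have "A \<otimes>\<^bsub>GL\<^esub> B = diagm (z ^ (i + i')) (z ^ (j + j'))" by (simp only: diagm_mult power_add)
    then show "A \<otimes>\<^bsub>GL\<^esub> B \<in> diag_roots" unfolding diag_roots_def by blast
  next
    fix A assume "A \<in> diag_roots"
    then obtain i j where A: "A = diagm (z ^ i) (z ^ j)" unfolding diag_roots_def by blast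
    have AG: "A \<in> carrier GL" unfolding A by (rule diag_z_in)
    have "A [^]\<^bsub>GL\<^esub> (p - 1) \<otimes>\<^bsub>GL\<^esub> A = A [^]\<^bsub>GL\<^esub> Suc (p - 1)" by (rule GL.nat_pow_Suc[symmetric])
    also have "\<dots> = \<one>\<^bsub>GL\<^esub>" using pw[of i j] p0 A by simp
    finally have "inv\<^bsub>GL\<^esub> A = A [^]\<^bsub>GL\<^esub> (p - 1)" using GL.inv_equality AG GL.nat_pow_closed[OF AG] by blast
    also have "\<dots> = diagm (z ^ (i * (p - 1))) (z ^ (j * (p - 1)))" unfolding A diagm_pow power_mult ..
    finally show "inv\<^bsub>GL\<^esub> A \<in> diag_roots" unfolding diag_roots_def by blast
  qed
  then show "diag_roots \<in> elementary_subs GL p" unfolding elementary_subs_def using cT pw by (auto simp: diag_roots_def)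
  fix S assume S: "S \<in> elementary_subs GL p"
  then show "S \<subseteq> carrier GL" by (rule GL.elementary_subs_mem)
  have Sp: "x [^]\<^bsub>GL\<^esub> p = \<one>\<^bsub>GL\<^esub>" if "x \<in> S" for x using S that unfolding elementary_subs_def by blast
  have "\<exists>x\<in>S. x \<notin> carrier KF"
  proof (rule ccontr)
    assume "\<not> ?thesis"
    then have "S \<subseteq> {u \<in> carrier KF. u [^]\<^bsub>GL\<^esub> p = \<one>\<^bsub>GL\<^esub>}" using Sp by blast
    then have "card S \<le> card {u \<in> carrier KF. u [^]\<^bsub>GL\<^esub> p = \<one>\<^bsub>GL\<^esub>}" using card_KF(1) by (intro card_mono) auto
    also have "\<dots> \<le> p" by (rule KF_roots[OF p0(1)])
    finally show False using GL.elementary_subs_mem(2)[OF S] pp by simp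
  qed
  then obtain x where x: "x \<in> S" "x \<notin> carrier KF" by blast
  have xG: "x \<in> carrier GL" using GL.elementary_subs_mem(1)[OF S] x by blast
  have "x [^]\<^bsub>GL\<^esub> m = \<one>\<^bsub>GL\<^esub>" unfolding mp by (rule Sp[OF x(1)])
  then obtain h i j where h: "h \<in> carrier GL" "conj_by GL h x = diagm (z ^ i) (z ^ j)"
    using conj_diag[OF xG] by blast
  have ne: "\<not> [z ^ i = z ^ j] (mod int q)"
  proof
    assume c: "[z ^ i = z ^ j] (mod int q)"
    have e: "conj_by GL h x = diagm (z ^ i) (z ^ i)"
      unfolding h(2) diagm_eq_iff by (intro conjI cong_refl cong_sym[OF c])
    have "x = conj_by GL (inv\<^bsub>GL\<^esub> h) (diagm (z ^ i) (z ^ i))"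
      unfolding e[symmetric] by (rule GL.conj_by_inv_cancel(1)[OF h(1) xG, symmetric])
    also have "\<dots> = diagm (z ^ i) (z ^ i)" by (rule conj_scalar[OF diag_z_in GL.inv_closed[OF h(1)]])
    also have "\<dots> = normm (z ^ i) 0" by (simp add: diagm_def normm_def)
    finally show False using x(2) by simp
  qed
  define T where "T = conj_by GL h ` S"
  have T: "T \<in> elementary_subs GL p" unfolding T_def by (rule GL.elementary_subs_conj[OF S h(1)])
  have Ts: "subgroup T GL" "card T = p^2" using T unfolding elementary_subs_def by blast+
  have dT: "diagm (z ^ i) (z ^ j) \<in> T" unfolding T_def h(2)[symmetric] using x(1) by (rule imageI)
  have "T \<subseteq> diag_roots"
  proof
    fix B assume B: "B \<in> T"
    have BG: "B \<in> carrier GL" using GL.elementary_subs_mem(1)[OF T] B by blast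
    have "B \<otimes>\<^bsub>GL\<^esub> diagm (z ^ i) (z ^ j) = diagm (z ^ i) (z ^ j) \<otimes>\<^bsub>GL\<^esub> B"
      by (rule GL.subgroup_order_p2_comm[OF finGL p(1) Ts B dT])
    then obtain c d where cd: "B = diagm c d" using commutes_diagm[OF BG ne] by auto
    have "B [^]\<^bsub>GL\<^esub> p = \<one>\<^bsub>GL\<^esub>" using T B unfolding elementary_subs_def by blast
    then have "[c ^ m = 1] (mod int q)" "[d ^ m = 1] (mod int q)"
      unfolding cd mp by (simp_all add: diagm_pow one_eq_diagm diagm_eq_iff)
    then obtain i' j' where "[c = z ^ i'] (mod int q)" "[d = z ^ j'] (mod int q)" using z_root by blast
    then have "B = diagm (z ^ i') (z ^ j')" unfolding cd diagm_eq_iff by blast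
    then show "B \<in> diag_roots" unfolding diag_roots_def by blast
  qed
  then have "T = diag_roots" using finite_subset[OF sub finGL] Ts(2) cT by (intro card_subset_eq) auto
  then show "\<exists>h\<in>carrier GL. conj_by GL h ` S = diag_roots" using h(1) unfolding T_def by blast
qed

end

section \<open>Semidirect products and normal subgroups\<close>

lemma has_normal_iso:
  assumes G: "group G" and H: "group H" and iso: "G \<cong> H" and N: "N \<lhd> G"
  shows "\<exists>M. M \<lhd> H \<and> card M = card N"
proof -
  obtain f where f: "f \<in> iso G H" using iso by (auto simp: is_iso_def)
  interpret f: group_hom G H f using f G H by (auto simp: group_hom_def group_hom_axioms_def iso_def)
  have bij: "inj_on f (carrier G)" "f ` carrier G = carrier H" using f by (auto simp: iso_def bij_betw_def)
  have Ns: "subgroup N G" by (rule normal_imp_subgroup[OF N])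
  have "f ` N \<lhd> H"
  proof (rule f.H.normal_invI[OF f.subgroup_img_is_subgroup[OF Ns]])
    fix y n assume y: "y \<in> carrier H" and n: "n \<in> f ` N"
    then obtain x where x: "x \<in> carrier G" "y = f x" using bij(2) by blast
    obtain k where k: "k \<in> N" "n = f k" using n by blast
    have kc: "k \<in> carrier G" using k subgroup.subset[OF Ns] by blast
    have "y \<otimes>\<^bsub>H\<^esub> n \<otimes>\<^bsub>H\<^esub> inv\<^bsub>H\<^esub> y = f (x \<otimes>\<^bsub>G\<^esub> k \<otimes>\<^bsub>G\<^esub> inv\<^bsub>G\<^esub> x)"
      using x kc k(2) by simp
    then show "y \<otimes>\<^bsub>H\<^esub> n \<otimes>\<^bsub>H\<^esub> inv\<^bsub>H\<^esub> y \<in> f ` N" using normal.inv_op_closed2[OF N x(1) k(1)] by simp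
  qed
  moreover have "card (f ` N) = card N"
    by (rule card_image[OF inj_on_subset[OF bij(1) subgroup.subset[OF Ns]]])
  ultimately show ?thesis by blast
qed

context action_hom begin

lemma kernel_normal: "carrier Q \<times> {\<one>\<^bsub>P\<^esub>} \<lhd> S"
proof -
  interpret S: group S by (rule sdprod_group)
  interpret h: group_hom S P snd by unfold_locales (auto simp: hom_def)
  have "kernel S P snd = carrier Q \<times> {\<one>\<^bsub>P\<^esub>}" by (auto simp: kernel_def)
  then show ?thesis using h.normal_kernel by simp
qed

lemma trivial_imp_complement_normal:
  assumes triv: "\<theta> ` carrier P = {\<one>\<^bsub>A\<^esub>}"
  shows "\<exists>N. N \<lhd> S \<and> card N = order P"
proof (intro exI conjI)
  interpret S: group S by (rule sdprod_group)
  have t: "\<theta> h = \<one>\<^bsub>A\<^esub>" if "h \<in> carrier P" for h using triv that by blast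
  interpret h: group_hom S Q fst
    by unfold_locales (use t in \<open>auto simp: hom_def\<close>)
  have "kernel S Q fst = {\<one>\<^bsub>Q\<^esub>} \<times> carrier P" by (auto simp: kernel_def)
  then show "{\<one>\<^bsub>Q\<^esub>} \<times> carrier P \<lhd> S" using h.normal_kernel by simp
  show "card ({\<one>\<^bsub>Q\<^esub>} \<times> carrier P) = order P" by (simp add: card_cartesian_product order_def)
qed

text \<open>Two normal subgroups of coprime orders commute, so a normal complement acts trivially.\<close>

lemma complement_normal_imp_trivial:
  assumes N: "N \<lhd> S" "card N = order P"
  shows "\<theta> ` carrier P = {\<one>\<^bsub>A\<^esub>}"
proof -
  interpret S: group S by (rule sdprod_group)
  let ?K = "carrier Q \<times> {\<one>\<^bsub>P\<^esub>}"
  have Ns: "subgroup N S" by (rule normal_imp_subgroup[OF N(1)])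
  have Ks: "subgroup ?K S" by (rule normal_imp_subgroup[OF kernel_normal])
  have NS: "N \<subseteq> carrier Q \<times> carrier P" using subgroup.subset[OF Ns] by simp
  have finN: "finite N" using NS finP finQ finite_subset by blast
  have disj: "x = \<one>\<^bsub>S\<^esub>" if x: "x \<in> N" "x \<in> ?K" for x
  proof -
    have "S.ord x dvd order P" using S.ord_dvd_card_subgroup[OF Ns x(1)] N(2) by simp
    moreover have "S.ord x dvd order Q"
      using S.ord_dvd_card_subgroup[OF Ks x(2)] by (simp add: card_cartesian_product order_def)
    ultimately have "S.ord x = 1" using coprime_orders coprime_common_divisor_nat by blast
    then show ?thesis using S.ord_eq_1 subgroup.subset[OF Ns] x(1) by blast
  qed
  have "inj_on snd N"
  proof (rule inj_onI)
    fix x y assume xy: "x \<in> N" "y \<in> N" "snd x = snd y"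
    have c: "x \<in> carrier S" "y \<in> carrier S" using xy subgroup.subset[OF Ns] by blast+
    interpret h: group_hom S P snd by unfold_locales (auto simp: hom_def)
    let ?d = "x \<otimes>\<^bsub>S\<^esub> inv\<^bsub>S\<^esub> y"
    have dN: "?d \<in> N" by (rule subgroup.m_closed[OF Ns xy(1) subgroup.m_inv_closed[OF Ns xy(2)]])
    have "snd ?d = snd x \<otimes>\<^bsub>P\<^esub> inv\<^bsub>P\<^esub> snd y"
      by (simp only: h.hom_mult[OF c(1) S.inv_closed[OF c(2)]] h.hom_inv[OF c(2)])
    also have "\<dots> = \<one>\<^bsub>P\<^esub>" unfolding xy(3) by (rule P.r_inv[OF h.hom_closed[OF c(2)]])
    finally have "?d \<in> ?K" using dN NS by (auto simp: mem_Times_iff)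
    then have "?d = \<one>\<^bsub>S\<^esub>" by (rule disj[OF dN])
    then show "x = y" using S.inv_solve_right'[OF S.one_closed c] c by (simp only: S.l_one)
  qed
  then have "card (snd ` N) = card (carrier P)" using N(2) by (simp add: card_image order_def)
  moreover have "snd ` N \<subseteq> carrier P" using NS by auto
  ultimately have surj: "snd ` N = carrier P" using finP by (intro card_subset_eq) auto
  have tr: "\<theta> h = \<one>\<^bsub>A\<^esub>" if h: "h \<in> carrier P" for h
  proof -
    have "h \<in> snd ` N" unfolding surj by (rule h)
    then obtain a where a: "(a, h) \<in> N" by auto
    have ac: "a \<in> carrier Q" using a NS by blast
    show ?thesis
    proof (rule act_faithful)
      fix x assume x: "x \<in> carrier Q"
      have "(a, h) \<otimes>\<^bsub>S\<^esub> (x, \<one>\<^bsub>P\<^esub>) = (x, \<one>\<^bsub>P\<^esub>) \<otimes>\<^bsub>S\<^esub> (a, h)"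
        by (rule S.normal_imp_commuting[OF N(1) kernel_normal _ a]) (use disj x in auto)
      then have "a \<otimes>\<^bsub>Q\<^esub> act (\<theta> h) x = x \<otimes>\<^bsub>Q\<^esub> a" using ac by simp
      also have "\<dots> = a \<otimes>\<^bsub>Q\<^esub> x" by (rule Q.m_comm[OF x ac])
      finally have "act (\<theta> h) x = x" using ac x h by simp
      then show "act (\<theta> h) x = act \<one>\<^bsub>A\<^esub> x" using x by simp
    qed (use h in auto)
  qed
  have "\<theta> ` carrier P = (\<lambda>_. \<one>\<^bsub>A\<^esub>) ` carrier P" by (rule image_cong[OF refl tr])
  then show ?thesis by (simp only: image_constant[OF P.one_closed])
qed

end

section \<open>The families of semidirect products\<close>

text \<open>All semidirect products of a group of order \<open>q\<^sup>2\<close> by a group of order \<open>p\<^sup>2\<close>, one line for each choice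
  of the two factors; the flag is that of \<^const>\<open>actions\<close>.\<close>

definition family :: "bool \<Rightarrow> nat \<Rightarrow> nat \<Rightarrow> ((int \<times> int) \<times> (int \<times> int)) monoid set" where
  "family b q p =
     sdprod (Zprod (q^2) 1) (Zprod (p^2) 1) (unit_act (q^2)) ` actions b (Zprod (p^2) 1) (unit_group (q^2)) \<union>
     sdprod (Zprod (q^2) 1) (Zprod p p) (unit_act (q^2)) ` actions b (Zprod p p) (unit_group (q^2)) \<union>
     sdprod (Zprod q q) (Zprod (p^2) 1) (gl2_act q) ` actions b (Zprod (p^2) 1) (gl2 q) \<union>
     sdprod (Zprod q q) (Zprod p p) (gl2_act q) ` actions b (Zprod p p) (gl2 q)"

context
  fixes p q :: nat
  assumes p: "prime p" and q: "prime q" and pq: "p \<noteq> q"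
begin

lemma q2_gt_1: "1 < q^2"
  using prime_gt_1_nat[OF q] by (rule one_less_power) simp

lemma unit_group_full_action: "full_action (Zprod (q^2) 1) (unit_group (q^2)) (unit_act (q^2))"
  by (rule full_action_unit_group[OF q2_gt_1])

lemma gl2_full_action: "full_action (Zprod q q) (gl2 q) (gl2_act q)"
  by (rule full_action_gl2[OF prime_gt_1_nat[OF q]])

lemma orders: "order (Zprod (q^2) 1) = q^2" "order (Zprod q q) = q^2" "order (Zprod (p^2) 1) = p^2" "order (Zprod p p) = p^2"
  using order_Zprod[of "q^2" 1] order_Zprod[of q q] order_Zprod[of "p^2" 1] order_Zprod[of p p]
    prime_gt_0_nat[OF p] prime_gt_0_nat[OF q] by (simp_all add: power2_eq_square)

lemma cop: "coprime (q^2) p"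
  using primes_coprime[OF q p] pq by simp

lemma family_cases:
  assumes "G \<in> family b q p"
  obtains Q P \<theta> where "action_hom Q (unit_group (q^2)) (unit_act (q^2)) P \<theta>" "order Q = q^2" "order P = p^2"
      "\<theta> \<in> actions b P (unit_group (q^2))" "G = sdprod Q P (unit_act (q^2)) \<theta>"
    | Q P \<theta> where "action_hom Q (gl2 q) (gl2_act q) P \<theta>" "order Q = q^2" "order P = p^2"
      "\<theta> \<in> actions b P (gl2 q)" "G = sdprod Q P (gl2_act q) \<theta>"
proof -
  have cu: "coprime (order (Zprod (q^2) 1)) p" and cl: "coprime (order (Zprod q q)) p"
    unfolding orders by (rule cop)+
  note iu = full_action.action_homI[OF unit_group_full_action p cu] and il = full_action.action_homI[OF gl2_full_action p cl]
  consider
      \<theta> where "\<theta> \<in> actions b (Zprod (p^2) 1) (unit_group (q^2))" "G = sdprod (Zprod (q^2) 1) (Zprod (p^2) 1) (unit_act (q^2)) \<theta>"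
    | \<theta> where "\<theta> \<in> actions b (Zprod p p) (unit_group (q^2))" "G = sdprod (Zprod (q^2) 1) (Zprod p p) (unit_act (q^2)) \<theta>"
    | \<theta> where "\<theta> \<in> actions b (Zprod (p^2) 1) (gl2 q)" "G = sdprod (Zprod q q) (Zprod (p^2) 1) (gl2_act q) \<theta>"
    | \<theta> where "\<theta> \<in> actions b (Zprod p p) (gl2 q)" "G = sdprod (Zprod q q) (Zprod p p) (gl2_act q) \<theta>"
    using assms unfolding family_def by blast
  then show thesis
  proof cases
    case 1
    then show thesis using that(1)[OF iu orders(1,3)] actions_subset by blast
  next
    case 2
    then show thesis using that(1)[OF iu orders(1,4)] actions_subset by blast
  next
    case 3
    then show thesis using that(2)[OF il orders(2,3)] actions_subset by blast
  next
    case 4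
    then show thesis using that(2)[OF il orders(2,4)] actions_subset by blast
  qed
qed

lemma family_group:
  assumes "G \<in> family b q p"
  shows "group G \<and> finite (carrier G) \<and> order G = q^2 * p^2" "\<exists>N. N \<lhd> G \<and> card N = q^2"
    "b \<Longrightarrow> \<not> (\<exists>N. N \<lhd> G \<and> card N = p^2)"
proof -
  have K: "card (carrier Q \<times> {\<one>\<^bsub>P\<^esub>}) = order Q" for Q P :: "(int \<times> int) monoid"
    by (simp add: card_cartesian_product order_def)
  show "group G \<and> finite (carrier G) \<and> order G = q^2 * p^2"
    using assms
  proof (cases rule: family_cases)
    case (1 Q P \<theta>)
    interpret action_hom Q "unit_group (q^2)" "unit_act (q^2)" P \<theta> by (rule 1)
    show ?thesis using sdprod_group sdprod_finite sdprod_order 1 by simp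
  next
    case (2 Q P \<theta>)
    interpret action_hom Q "gl2 q" "gl2_act q" P \<theta> by (rule 2)
    show ?thesis using sdprod_group sdprod_finite sdprod_order 2 by simp
  qed
  show "\<exists>N. N \<lhd> G \<and> card N = q^2"
    using assms
  proof (cases rule: family_cases)
    case (1 Q P \<theta>)
    then show ?thesis using action_hom.kernel_normal[OF 1(1)] K[of Q P] by metis
  next
    case (2 Q P \<theta>)
    then show ?thesis using action_hom.kernel_normal[OF 2(1)] K[of Q P] by metis
  qed
  assume b
  show "\<not> (\<exists>N. N \<lhd> G \<and> card N = p^2)"
    using assms
  proof (cases rule: family_cases)
    case (1 Q P \<theta>)
    then show ?thesis using action_hom.complement_normal_imp_trivial[OF 1(1)] \<open>b\<close> unfolding actions_def by auto
  next
    case (2 Q P \<theta>)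
    then show ?thesis using action_hom.complement_normal_imp_trivial[OF 2(1)] \<open>b\<close> unfolding actions_def by auto
  qed
qed

text \<open>A normal subgroup \<open>N\<close> of order \<open>q\<^sup>2\<close> is complemented by a Sylow \<open>p\<close>-subgroup.  If no subgroup of order
  \<open>p\<^sup>2\<close> is normal, the action cannot be trivial.\<close>

lemma family_complete:
  fixes H :: "'a monoid"
  assumes H: "group H" "finite (carrier H)" "order H = q^2 * p^2" and N: "N \<lhd> H" "card N = q^2"
    and b: "b \<longrightarrow> \<not> (\<exists>M. M \<lhd> H \<and> card M = p^2)"
  shows "\<exists>G\<in>family b q p. H \<cong> G"
proof -
  interpret H: group H by (rule H)
  have Ns: "subgroup N H" by (rule normal_imp_subgroup[OF N(1)])
  obtain R where R: "subgroup R H" "card R = p^2"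
    using sylow_thm[OF p H(1) _ H(2), of 2 "q^2"] H(3) by (auto simp: mult.commute)
  have fin: "finite N" "finite R"
    using subgroup.subset[OF Ns] subgroup.subset[OF R(1)] H(2) finite_subset by blast+
  have gN: "group (H\<lparr>carrier := N\<rparr>)" and gR: "group (H\<lparr>carrier := R\<rparr>)"
    using subgroup.subgroup_is_group[OF Ns H(1)] subgroup.subgroup_is_group[OF R(1) H(1)] by auto
  have "H\<lparr>carrier := N\<rparr> \<cong> Zprod (q^2) 1 \<or> H\<lparr>carrier := N\<rparr> \<cong> Zprod q q"
    using group.order_p2_cases[OF gN _ q] fin N(2) by (simp add: order_def)
  then have Ncase: "(\<exists>f. f \<in> iso (Zprod (q^2) 1) (H\<lparr>carrier := N\<rparr>)) \<or> (\<exists>f. f \<in> iso (Zprod q q) (H\<lparr>carrier := N\<rparr>))"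
    using group.iso_sym[OF gN] unfolding is_iso_def by blast
  have "H\<lparr>carrier := R\<rparr> \<cong> Zprod (p^2) 1 \<or> H\<lparr>carrier := R\<rparr> \<cong> Zprod p p"
    using group.order_p2_cases[OF gR _ p] fin R(2) by (simp add: order_def)
  then have Rcase: "\<exists>P. (P = Zprod (p^2) 1 \<or> P = Zprod p p) \<and> (\<exists>g. g \<in> iso P (H\<lparr>carrier := R\<rparr>))"
    using group.iso_sym[OF gR] unfolding is_iso_def by blast
  then obtain P g where P: "P = Zprod (p^2) 1 \<or> P = Zprod p p" and g: "g \<in> iso P (H\<lparr>carrier := R\<rparr>)" by blast
  have gP: "group P" and oP: "order P = p^2" using P group_Zprod orders by auto
  have triv: "\<theta> \<in> actions b P A"
    if a: "action_hom Q A act P \<theta>" and t: "\<theta> \<in> hom P A" and iso: "H \<cong> sdprod Q P act \<theta>"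
    for Q :: "(int \<times> int) monoid" and A :: "'g monoid" and act \<theta>
  proof -
    have "\<theta> ` carrier P \<noteq> {\<one>\<^bsub>A\<^esub>}" if b': b
    proof
      assume tr: "\<theta> ` carrier P = {\<one>\<^bsub>A\<^esub>}"
      obtain M where M: "M \<lhd> sdprod Q P act \<theta>" "card M = p^2"
        using action_hom.trivial_imp_complement_normal[OF a tr] oP by auto
      have "sdprod Q P act \<theta> \<cong> H" by (rule group.iso_sym[OF H(1) iso])
      from has_normal_iso[OF action_hom.sdprod_group[OF a] H(1) this M(1)] show False
        using b b' M(2) by simp
    qed
    then show ?thesis using t by (simp add: actions_def)
  qed
  have c: "coprime (q^2) (p^2)" using cop by simp
  from Ncase show ?thesis
  proof
    assume "\<exists>f. f \<in> iso (Zprod (q^2) 1) (H\<lparr>carrier := N\<rparr>)"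
    then obtain f where f: "f \<in> iso (Zprod (q^2) 1) (H\<lparr>carrier := N\<rparr>)" by blast
    obtain \<theta> where t: "\<theta> \<in> hom P (unit_group (q^2))" "H \<cong> sdprod (Zprod (q^2) 1) P (unit_act (q^2)) \<theta>"
      using full_action.iso_sdprod[OF unit_group_full_action H(1,2) _ N(1) f R(1) g gP] H(3) orders(1) oP c by auto
    have a: "action_hom (Zprod (q^2) 1) (unit_group (q^2)) (unit_act (q^2)) P \<theta>"
      by (rule full_action.action_homI[OF unit_group_full_action p _ t(1) P]) (simp only: orders cop)
    have "sdprod (Zprod (q^2) 1) P (unit_act (q^2)) \<theta> \<in> family b q p"
      using P triv[OF a t] unfolding family_def by blast
    then show ?thesis using t(2) by blast
  next
    assume "\<exists>f. f \<in> iso (Zprod q q) (H\<lparr>carrier := N\<rparr>)"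
    then obtain f where f: "f \<in> iso (Zprod q q) (H\<lparr>carrier := N\<rparr>)" by blast
    obtain \<theta> where t: "\<theta> \<in> hom P (gl2 q)" "H \<cong> sdprod (Zprod q q) P (gl2_act q) \<theta>"
      using full_action.iso_sdprod[OF gl2_full_action H(1,2) _ N(1) f R(1) g gP] H(3) orders(2) oP c by auto
    have a: "action_hom (Zprod q q) (gl2 q) (gl2_act q) P \<theta>"
      by (rule full_action.action_homI[OF gl2_full_action p _ t(1) P]) (simp only: orders cop)
    have "sdprod (Zprod q q) P (gl2_act q) \<theta> \<in> family b q p"
      using P triv[OF a t] unfolding family_def by blast
    then show ?thesis using t(2) by blast
  qed
qed

text \<open>The four parts of the family contain no common isomorphism type, since they differ in one of the
  factors.  Cyclic subgroups of order \<open>p\<close> count twice, as images of either group of order \<open>p\<^sup>2\<close>.\<close>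

lemma card_family:
  "card (iso_type (q^2 * p^2) ` family b q p) = (if b then 0 else 4)
     + 2 * num_conj (unit_group (q^2)) (cyclic_subs (unit_group (q^2)) p)
     + num_conj (unit_group (q^2)) (cyclic_subs (unit_group (q^2)) (p^2))
     + num_conj (unit_group (q^2)) (elementary_subs (unit_group (q^2)) p)
     + 2 * num_conj (gl2 q) (cyclic_subs (gl2 q) p) + num_conj (gl2 q) (cyclic_subs (gl2 q) (p^2))
     + num_conj (gl2 q) (elementary_subs (gl2 q) p)" (is "?lhs = ?rhs")
  "finite (iso_type (q^2 * p^2) ` family b q p)"
proof -
  have cu: "coprime (order (Zprod (q^2) 1)) p" and cl: "coprime (order (Zprod q q)) p"
    unfolding orders by (rule cop)+
  note cU = full_action.card_types[OF unit_group_full_action p cu, unfolded orders(1)]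
    and cL = full_action.card_types[OF gl2_full_action p cl, unfolded orders(2)]
  have aU: "action_hom (Zprod (q^2) 1) (unit_group (q^2)) (unit_act (q^2)) P \<theta>"
    if "P = Zprod (p^2) 1 \<or> P = Zprod p p" "\<theta> \<in> actions b P (unit_group (q^2))" for P \<theta>
    by (rule full_action.action_homI[OF unit_group_full_action p cu _ that(1)]) (use that(2) actions_subset in blast)
  have aL: "action_hom (Zprod q q) (gl2 q) (gl2_act q) P \<theta>"
    if "P = Zprod (p^2) 1 \<or> P = Zprod p p" "\<theta> \<in> actions b P (gl2 q)" for P \<theta>
    by (rule full_action.action_homI[OF gl2_full_action p cl _ that(1)]) (use that(2) actions_subset in blast)
  let ?P1 = "Zprod (p^2) 1" and ?P2 = "Zprod p p" and ?n = "q^2 * p^2"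
  let ?U = "unit_group (q^2)" and ?L = "gl2 q" and ?Q1 = "Zprod (q^2) 1" and ?Q2 = "Zprod q q"
  let ?X1 = "iso_type ?n ` sdprod ?Q1 ?P1 (unit_act (q^2)) ` actions b ?P1 ?U"
  let ?X2 = "iso_type ?n ` sdprod ?Q1 ?P2 (unit_act (q^2)) ` actions b ?P2 ?U"
  let ?X3 = "iso_type ?n ` sdprod ?Q2 ?P1 (gl2_act q) ` actions b ?P1 ?L"
  let ?X4 = "iso_type ?n ` sdprod ?Q2 ?P2 (gl2_act q) ` actions b ?P2 ?L"
  have nP: "\<not> ?P1 \<cong> ?P2" and nQ: "\<not> ?Q1 \<cong> ?Q2" using Zprod_not_iso p q by auto
  have X12: "?X1 \<inter> ?X2 = {}"
    by (rule iso_types_disjoint[OF aU aU]) (use nP orders in simp_all)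
  have X13: "?X1 \<inter> ?X3 = {}"
    by (rule iso_types_disjoint[OF aU aL]) (use nQ orders in simp_all)
  have X14: "?X1 \<inter> ?X4 = {}"
    by (rule iso_types_disjoint[OF aU aL]) (use nQ orders in simp_all)
  have X23: "?X2 \<inter> ?X3 = {}"
    by (rule iso_types_disjoint[OF aU aL]) (use nQ orders in simp_all)
  have X24: "?X2 \<inter> ?X4 = {}"
    by (rule iso_types_disjoint[OF aU aL]) (use nQ orders in simp_all)
  have X34: "?X3 \<inter> ?X4 = {}"
    by (rule iso_types_disjoint[OF aL aL]) (use nP orders in simp_all)
  have dis: "?X1 \<inter> ?X2 = {}" "(?X1 \<union> ?X2) \<inter> ?X3 = {}" "(?X1 \<union> ?X2 \<union> ?X3) \<inter> ?X4 = {}"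
    by (simp_all only: Int_Un_distrib2 X12 X13 X14 X23 X24 X34 Un_empty_left)
  have F: "iso_type ?n ` family b q p = ?X1 \<union> ?X2 \<union> ?X3 \<union> ?X4"
    unfolding family_def image_Un ..
  note fin = cU(2)[of b] cU(4)[of b] cL(2)[of b] cL(4)[of b]
  show "finite (iso_type ?n ` family b q p)" unfolding F by (intro finite_UnI fin)
  have "?lhs = card ?X1 + card ?X2 + card ?X3 + card ?X4"
    unfolding F card_Un_disjoint[OF finite_UnI[OF finite_UnI[OF fin(1,2)] fin(3)] fin(4) dis(3)]
      card_Un_disjoint[OF finite_UnI[OF fin(1,2)] fin(3) dis(2)] card_Un_disjoint[OF fin(1,2) dis(1)] ..
  then show "?lhs = ?rhs" unfolding cU(1,3) cL(1,3) by simp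
qed

end

section \<open>The number of groups of order \<open>p\<^sup>2 q\<^sup>2\<close>\<close>

lemma gl2_counts:
  assumes q: "prime q" "2 < q" and p: "prime p" "p \<noteq> q"
  shows "0 < k \<Longrightarrow> num_conj (gl2 q) (cyclic_subs (gl2 q) (p^k)) =
      (if p^k dvd q - 1 then card (inverse_orbits (p^k)) else if p^k dvd q^2 - 1 then 1 else 0)"
    and "num_conj (gl2 q) (elementary_subs (gl2 q) p) = (if p dvd q - 1 then 1 else 0)"
proof -
  obtain g where "odd_prime_field q g" using odd_prime_field_exists[OF q] by blast
  then interpret odd_prime_field q g .
  have torus: "\<exists>z. split_torus q g p k z" if k: "0 < k" "p^k dvd q - 1" for k
  proof -
    obtain z where "\<And>i. [z ^ i = 1] (mod int q) \<longleftrightarrow> p^k dvd i"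
      "\<And>a. [a ^ (p^k) = 1] (mod int q) \<Longrightarrow> \<exists>i. [a = z ^ i] (mod int q)"
      using zeta_exists[OF k(2)] by blast
    then have "split_torus q g p k z"
      using p(1) k odd_prime_field_axioms by (intro split_torus.intro split_torus_axioms.intro)
    then show ?thesis by blast
  qed
  have "\<not> q dvd p"
    using primes_dvd_imp_eq[OF q(1) p(1)] p(2) by blast
  then have nd: "\<not> q dvd p^k" for k using prime_dvd_power[OF q(1)] by blast
  show "num_conj (gl2 q) (cyclic_subs (gl2 q) (p^k)) =
      (if p^k dvd q - 1 then card (inverse_orbits (p^k)) else if p^k dvd q^2 - 1 then 1 else 0)" if k: "0 < k"
  proof (cases "p^k dvd q - 1")
    case True
    then obtain z where "split_torus q g p k z" using torus[OF k] by blast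
    then show ?thesis using split_torus.num_conj_split True by simp
  next
    case False
    have "0 < p^k" using prime_gt_0_nat[OF p(1)] by simp
    then show ?thesis using num_conj_nonsplit[OF _ False nd] False by simp
  qed
  show "num_conj (gl2 q) (elementary_subs (gl2 q) p) = (if p dvd q - 1 then 1 else 0)"
  proof (cases "p dvd q - 1")
    case True
    then obtain z where "split_torus q g p 1 z" using torus[of 1] by auto
    then show ?thesis using split_torus.elementary_split True by simp
  next
    case False
    then show ?thesis using elementary_nonsplit[OF p] by simp
  qed
qed

lemma card_family_odd:
  assumes q: "prime q" "2 < q" and p: "prime p" "p \<noteq> q"
  shows "card (iso_type (q^2 * p^2) ` family False q p) = 4
    + (if p dvd q - 1 then 3 + 2 * card (inverse_orbits p) else if p dvd q^2 - 1 then 2 else 0)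
    + (if p^2 dvd q - 1 then 1 + card (inverse_orbits (p^2)) else if p^2 dvd q^2 - 1 then 1 else 0)"
proof -
  note U = unit_group_p2_counts(1)[OF q p, of 1, unfolded power_one_right] unit_group_p2_counts(1)[OF q p, of 2]
    unit_group_p2_counts(2)[OF q p]
  note L = gl2_counts(1)[OF q p, of 1, unfolded power_one_right, OF zero_less_one]
    gl2_counts(1)[OF q p, of 2, OF pos2] gl2_counts(2)[OF q p]
  show ?thesis
    unfolding card_family(1)[OF p(1) q(1) p(2)] U L num_conj_empty if_False
    by (cases "p dvd q - 1"; cases "p^2 dvd q - 1") simp_all
qed

lemma num_groups_normal:
  assumes pq: "prime p" "prime q" "p < q" and ne: "\<not> (p = 2 \<and> q = 3)"
  shows "num_groups (p^2 * q^2) = card (iso_type (q^2 * p^2) ` family False q p)"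
proof -
  have neq: "p \<noteq> q" using pq by simp
  have "num_groups (q^2 * p^2) = card (iso_type (q^2 * p^2) ` family False q p)"
  proof (rule num_groups_eq_card_iso_types)
    fix G assume "G \<in> family False q p"
    then show "group G \<and> finite (carrier G) \<and> order G = q^2 * p^2"
      by (rule family_group(1)[OF pq(1,2) neq])
  next
    fix H :: "nat monoid" assume "H \<in> groups_of_order (q^2 * p^2)"
    then have H: "group H" "finite (carrier H)" "order H = q^2 * p^2" by (auto simp: groups_of_order_def)
    obtain N where N: "subgroup N H" "card N = q^2" using sylow_thm[OF pq(2) H(1,3,2)] by blast
    have "N \<lhd> H" using group.sylow_p2q2_normal[OF H(1,2) pq _ ne N] H(3) by (simp add: mult.commute)
    then show "\<exists>G\<in>family False q p. H \<cong> G" using family_complete[OF pq(1,2) neq H _ N(2)] by blast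
  qed
  then show ?thesis by (simp add: mult.commute)
qed

text \<open>If a Sylow 3-subgroup is normal, the group is one of 12 semidirect products.  Otherwise the Sylow
  2-subgroup is normal and the action on it is not trivial; the cyclic group of order 4 has no
  automorphism of order 3 and the four-group has one class of them, so each of the two groups of
  order 9 contributes one more.\<close>

lemma num_groups_36: "num_groups 36 = 14"
proof -
  have two: "prime (2::nat)" and three: "prime (3::nat)" by simp_all
  have ne: "(2::nat) \<noteq> 3" "(3::nat) \<noteq> 2" by simp_all
  have n: "(3::nat)^2 * 2^2 = 36" "(2::nat)^2 * 3^2 = 36" by simp_all
  let ?A = "family False 3 2" and ?B = "family True 2 3"
  have gA: "group G \<and> finite (carrier G) \<and> order G = 36" "\<exists>N. N \<lhd> G \<and> card N = 9" if "G \<in> ?A" for G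
    using family_group(1,2)[OF two three ne(1) that] by simp_all
  have gB: "group G \<and> finite (carrier G) \<and> order G = 36" "\<not> (\<exists>N. N \<lhd> G \<and> card N = 9)" if "G \<in> ?B" for G
    using family_group(1,3)[OF three two ne(2) that] by simp_all
  have "num_groups 36 = card (iso_type 36 ` (?A \<union> ?B))"
  proof (rule num_groups_eq_card_iso_types)
    fix G assume "G \<in> ?A \<union> ?B"
    then show "group G \<and> finite (carrier G) \<and> order G = 36" using gA(1) gB(1) by blast
  next
    fix H :: "nat monoid" assume "H \<in> groups_of_order 36"
    then have H: "group H" "finite (carrier H)" "order H = 36" by (auto simp: groups_of_order_def)
    have o: "order H = 3^2 * 2^2" "order H = 2^2 * 3^2" using H(3) by simp_all
    show "\<exists>G\<in>?A \<union> ?B. H \<cong> G"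
    proof (cases "\<exists>N. N \<lhd> H \<and> card N = 9")
      case True
      then obtain N where "N \<lhd> H" "card N = 3^2" by auto
      then show ?thesis using family_complete[OF two three ne(1) H(1,2) o(1), of N False] by blast
    next
      case False
      obtain Q where Q: "subgroup Q H" "card Q = 3^2" using sylow_thm[OF three H(1) o(1) H(2)] by blast
      have "\<not> Q \<lhd> H" using False Q(2) by auto
      then obtain P where P: "P \<lhd> H" "card P = 2^2"
        using group.order36_normal[OF H(1,2,3) Q(1)] Q(2) by auto
      have "True \<longrightarrow> \<not> (\<exists>M. M \<lhd> H \<and> card M = 3^2)" using False by simp
      then show ?thesis using family_complete[OF three two ne(2) H(1,2) o(2) P, of True] by blast
    qed
  qed
  also have "\<dots> = card (iso_type 36 ` ?A) + card (iso_type 36 ` ?B)"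
    unfolding image_Un
  proof (rule card_Un_disjoint)
    show "finite (iso_type 36 ` ?A)" using card_family(2)[OF two three ne(1), of False] by simp
    show "finite (iso_type 36 ` ?B)" using card_family(2)[OF three two ne(2), of True] by simp
    show "iso_type 36 ` ?A \<inter> iso_type 36 ` ?B = {}"
    proof (rule ccontr)
      assume "iso_type 36 ` ?A \<inter> iso_type 36 ` ?B \<noteq> {}"
      then obtain X where "X \<in> iso_type 36 ` ?A" "X \<in> iso_type 36 ` ?B" by blast
      then obtain G G' where G: "G \<in> ?A" "G' \<in> ?B" "iso_type 36 G = iso_type 36 G'" by (elim imageE) simp
      have "G \<cong> G'" using iso_type_eq_iff[of G 36 G'] gA(1)[OF G(1)] gB(1)[OF G(2)] G(3) by blast
      then show False using has_normal_iso[of G G'] gA[OF G(1)] gB[OF G(2)] by metis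
    qed
  qed
  also have "card (iso_type 36 ` ?A) = 12"
  proof -
    have "2 * card (inverse_orbits 2) = 4" using card_inverse_orbits_2 by simp
    then show ?thesis using card_family_odd[of 3 2] by simp
  qed
  also have "card (iso_type 36 ` ?B) = 2"
    using card_family(1)[OF three two ne(2), of True] unit_group_4 gl2_2_counts by (simp add: num_conj_empty)
  finally show ?thesis by simp
qed

theorem theorem16:
  fixes p q :: nat
  assumes "prime p" and "prime q" and "p < q"
  shows "num_groups (2^2 * 3^2) = 14 \<and>
    (p = 2 \<and> q \<noteq> 3 \<longrightarrow> num_groups (p^2 * q^2) = 12 + 4 * w (q - 1) 4) \<and>
    (p > 2 \<longrightarrow> real (num_groups (p^2 * q^2)) =
        4 + (real p ^ 2 + real p + 4) / 2 * real (w (q - 1) (p^2))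
          + (real p + 6) * real (w (q - 1) p)
          + 2 * real (w (q + 1) p) + real (w (q + 1) (p^2)))"
proof (intro conjI impI)
  show "num_groups (2^2 * 3^2) = 14" using num_groups_36 by simp
next
  have q2: "2 < q" using assms prime_ge_2_nat[OF assms(1)] by linarith
  have pq: "p \<noteq> q" using assms by simp
  have odd_q: "odd q" using assms(2) q2 prime_odd_nat by blast
  note count = card_family_odd[OF assms(2) q2 assms(1) pq]
  have sq: "q^2 - 1 = (q - 1) * (q + 1)" by (simp add: power2_eq_square algebra_simps)
  {
    assume h: "p = 2 \<and> q \<noteq> 3"
    have "num_groups (p^2 * q^2) = card (iso_type (q^2 * p^2) ` family False q p)"
      using num_groups_normal[OF assms] h by simp
    moreover have "even (q - 1)" using odd_q by simp
    moreover have "4 dvd q^2 - 1"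
      unfolding sq using mult_dvd_mono[of 2 "q - 1" 2 "q + 1"] odd_q by simp
    ultimately show "num_groups (p^2 * q^2) = 12 + 4 * w (q - 1) 4"
      using count h card_inverse_orbits_2 card_inverse_orbits_4 by (simp add: w_def)
  }
  {
    assume h: "p > 2"
    have num: "num_groups (p^2 * q^2) = card (iso_type (q^2 * p^2) ` family False q p)"
      using num_groups_normal[OF assms] h by simp
    have o1: "2 * card (inverse_orbits p) = p + 3"
      using card_inverse_orbits_odd_prime_power[OF assms(1) h, of 1] by simp
    have o2: "2 * card (inverse_orbits (p^2)) = p^2 + p + 2"
      using card_inverse_orbits_odd_prime_power[OF assms(1) h, of 2] by simp
    have o2': "real (card (inverse_orbits (p^2))) = (real p ^ 2 + real p + 2) / 2"
      using arg_cong[OF o2, of real] by (simp add: field_simps)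
    have p_p2: "p dvd p^2" by simp
    have nb: "\<not> (p dvd q - 1 \<and> p dvd q + 1)"
    proof
      assume d: "p dvd q - 1 \<and> p dvd q + 1"
      then have "p dvd (q + 1) - (q - 1)" using dvd_diff_nat by blast
      then have "p dvd 2" using q2 by simp
      then show False using h by (auto dest: dvd_imp_le)
    qed
    have dv: "p^i dvd q^2 - 1 \<longleftrightarrow> p^i dvd q - 1 \<or> p^i dvd q + 1" for i
    proof
      assume d: "p^i dvd q^2 - 1"
      from nb have "coprime p (q - 1) \<or> coprime p (q + 1)" using prime_imp_coprime[OF assms(1)] by metis
      then show "p^i dvd q - 1 \<or> p^i dvd q + 1"
      proof
        assume "coprime p (q - 1)"
        then have "coprime (p^i) (q - 1)" by simp
        then show ?thesis using d coprime_dvd_mult_right_iff[of "p^i" "q - 1" "q + 1"] by (simp only: sq simp_thms)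
      next
        assume "coprime p (q + 1)"
        then have "coprime (p^i) (q + 1)" by simp
        then show ?thesis using d coprime_dvd_mult_left_iff[of "p^i" "q + 1" "q - 1"] by (simp only: sq simp_thms)
      qed
    next
      assume "p^i dvd q - 1 \<or> p^i dvd q + 1"
      then show "p^i dvd q^2 - 1" unfolding sq by (metis dvd_mult dvd_mult2)
    qed
    have d1: "p dvd q^2 - 1 \<longleftrightarrow> p dvd q - 1 \<or> p dvd q + 1" using dv[of 1] by simp
    note d2 = dv[of 2]
    have i1: "p^2 dvd q - 1 \<Longrightarrow> p dvd q - 1" and i2: "p^2 dvd q + 1 \<Longrightarrow> p dvd q + 1"
      by (rule dvd_trans[OF p_p2], assumption)+
    have total: "num_groups (p^2 * q^2) = 4
      + (if p dvd q - 1 then p + 6 else if p dvd q + 1 then 2 else 0)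
      + (if p^2 dvd q - 1 then 1 + card (inverse_orbits (p^2)) else if p^2 dvd q + 1 then 1 else 0)"
      unfolding num count d1 d2 using o1 by simp
    show "real (num_groups (p^2 * q^2)) =
        4 + (real p ^ 2 + real p + 4) / 2 * real (w (q - 1) (p^2))
          + (real p + 6) * real (w (q - 1) p)
          + 2 * real (w (q + 1) p) + real (w (q + 1) (p^2))"
    proof (cases "p dvd q - 1")
      case True
      then have n: "\<not> p dvd q + 1" "\<not> p^2 dvd q + 1" using nb i2 by blast+
      show ?thesis
        unfolding total using True n o2' by (cases "p^2 dvd q - 1") (simp_all add: w_def field_simps)
    next
      case False
      then have n: "\<not> p^2 dvd q - 1" using i1 by blast
      show ?thesis
        unfolding total using False n i2 by (cases "p dvd q + 1"; cases "p^2 dvd q + 1") (simp_all add: w_def)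
    qed
  }
qed

end
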